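(* Let $d$ be an odd positive integer and let $\mathscr{C}$ be a $K$-linear, Hom-finite $(d+2)$-angulated category with split idempotents. Let $\mathscr{T}=\mathrm{add}(T)$ be an Oppermann-Thomas cluster tilting subcategory of $\mathscr{C}$. Assume that for all indecomposable objects $c,x\in\mathscr{C}$, the spaces $\mathrm{Hom}_{\mathscr{C}/[\Sigma^d\mathscr{T}]}(c,x)$ and $\mathrm{Hom}_{\mathscr{C}}^{[\mathscr{T}]}(\Sigma^{-d}(c),x)$ are not simultaneously non-zero. Then each indecomposable object of $\mathscr{C}$ is uniquely determined up to isomorphism by its index with respect to $\mathscr{T}$; that is, if $c,c'\in\mathscr{C}$ are indecomposable and $\mathrm{Ind}_{\mathscr{T}}(c)=\mathrm{Ind}_{\mathscr{T}}(c')$ in $K_0^{\mathrm{Split}}(\mathscr{T})$, then $c\cong c'$.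
   Context: $K$ is an algebraically closed field. $(d+2)$-angulated categories (Geiss-Keller-Oppermann). Let $d\ge 1$ be an integer and $\mathscr{C}$ an additive category with an automorphism denoted $\Sigma^d$ (inverse $\Sigma^{-d}$; $\Sigma^d$ need not be a $d$-th power of a functor). A $\Sigma^d$-sequence is a diagram $c^0\xrightarrow{\gamma^0}c^1\to\cdots\to c^{d+1}\xrightarrow{\gamma^{d+1}}\Sigma^d(c^0)$. The category $\mathscr{C}$ is $(d+2)$-angulated if it is equipped with a class of $\Sigma^d$-sequences, called $(d+2)$-angles, such that: (N1) the class is closed under sums and summands, contains $c\xrightarrow{\mathrm{id}}c\to0\to\cdots\to0\to\Sigma^d(c)$ for each $c$, and each morphism $\gamma^0$ is the first morphism of some $(d+2)$-angle; (N2) a $\Sigma^d$-sequence $c^0\xrightarrow{\gamma^0}c^1\xrightarrow{\gamma^1}c^2\to\cdots\to c^{d+1}\xrightarrow{\gamma^{d+1}}\Sigma^d(c^0)$ is a $(d+2)$-angle if and only if its left rotation $c^1\xrightarrow{\gamma^1}c^2\to\cdots\to c^{d+1}\xrightarrow{\gamma^{d+1}}\Sigma^d(c^0)\xrightarrow{(-1)^d\Sigma^d(\gamma^0)}\Sigma^d(c^1)$ is one; (N3) given two $(d+2)$-angles $b^0\to\cdots\to b^{d+1}\to\Sigma^d(b^0)$ and $c^0\to\cdots\to c^{d+1}\to\Sigma^d(c^0)$, and morphisms $b^0\to c^0$, $b^1\to c^1$ making the first square commute, these extend to a morphism of $\Sigma^d$-sequences (with last component $\Sigma^d$ of the first); (N4)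 in (N3) the extension can be chosen such that its mapping cone $b^1\oplus c^0\to b^2\oplus c^1\to\cdots\to\Sigma^d(b^0)\oplus c^{d+1}\to\Sigma^d(b^1)\oplus\Sigma^d(c^0)$ is a $(d+2)$-angle. Oppermann-Thomas cluster tilting. An object $T$ of $\mathscr{C}$, with $\mathscr{T}=\mathrm{add}(T)$ (full subcategory), is an Oppermann-Thomas cluster tilting object, and $\mathscr{T}$ is an Oppermann-Thomas cluster tilting subcategory, if (i) $\mathrm{Hom}_{\mathscr{C}}(\mathscr{T},\Sigma^d(\mathscr{T}))=0$, and (ii) for every $c\in\mathscr{C}$ there is a $(d+2)$-angle $t_d\to t_{d-1}\to\cdots\to t_0\to c\to\Sigma^d(t_d)$ with all $t_i\in\mathscr{T}$. Notation. For a full subcategory $\mathscr{S}\subseteq\mathscr{C}$, $\mathrm{Hom}_{\mathscr{C}}^{[\mathscr{S}]}(x,y)$ is the space of morphisms $x\to y$ in $\mathscr{C}$ that factor through some object of $\mathscr{S}$. The quotient category $\mathscr{C}/[\Sigma^d\mathscr{T}]$ has the same objects as $\mathscr{C}$ and $\mathrm{Hom}_{\mathscr{C}/[\Sigma^d\mathscr{T}]}(x,y)=\mathrm{Hom}_{\mathscr{C}}(x,y)/\mathrm{Hom}_{\mathscr{C}}^{[\Sigma^d\mathscr{T}]}(x,y)$. Index. $K_0^{\mathrm{Split}}(\mathscr{T})$ is the abelian group generated by objects of $\mathscr{T}$ modulo the relations $[t]=[t']+[t'']$ whenever $t\cong t'\oplus t''$. For $c\in\mathscr{C}$, $\mathrm{Ind}_{\mathscr{T}}(c)=\sum_{i=0}^d(-1)^i[t_i]$,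 where $t_d\to\cdots\to t_0\to c\to\Sigma^d(t_d)$ is any $(d+2)$-angle with all $t_i\in\mathscr{T}$; this is well defined (Jørgensen) when $\mathscr{C}$ is $K$-linear, Hom-finite with split idempotents. *)

theory Defs
  imports "HOL-Algebra.Free_Abelian_Groups" "HOL-Computational_Algebra.Polynomial"
begin

section \<open>Linear categories\<close>

text \<open>
  All morphism spaces are subspaces of one ambient vector space \<^typ>\<open>'m\<close>, and composition is a
  single binary operation on \<^typ>\<open>'m\<close> that is only constrained on composable morphisms.  Every
  small \<open>K\<close>-linear category has this form: take the direct sum of all its morphism spaces as the
  ambient space, and extend composition bilinearly, by zero on non-composable summands.  In
  particular \<open>0\<close> is the zero morphism of every morphism space.  Nothing requires the
  morphism spaces to be disjoint, so a morphism is always considered together with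
  its domain and codomain.
\<close>

record ('k, 'o, 'm) lincat =
  Ob :: "'o set"
  Hom :: "'o \<Rightarrow> 'o \<Rightarrow> 'm set"
  cmp :: "'m \<Rightarrow> 'm \<Rightarrow> 'm"  (infixl \<open>\<star>\<index>\<close> 70)
  idm :: "'o \<Rightarrow> 'm"
  scl :: "'k \<Rightarrow> 'm \<Rightarrow> 'm"

locale linear_category =
  fixes C :: "('k::field, 'o, 'm::ab_group_add, 'z) lincat_scheme" (structure)
  assumes vector_space_scl: "vector_space (scl C)"
    and Hom_subspace:
      "\<lbrakk>x \<in> Ob C; y \<in> Ob C\<rbrakk> \<Longrightarrow> Modules.module.subspace (scl C) (Hom C x y)"
    and idm_in_Hom: "x \<in> Ob C \<Longrightarrow> idm C x \<in> Hom C x x"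
    and cmp_in_Hom:
      "\<lbrakk>x \<in> Ob C; y \<in> Ob C; z \<in> Ob C; f \<in> Hom C x y; g \<in> Hom C y z\<rbrakk> \<Longrightarrow> g \<star> f \<in> Hom C x z"
    and cmp_assoc:
      "\<lbrakk>w \<in> Ob C; x \<in> Ob C; y \<in> Ob C; z \<in> Ob C;
        f \<in> Hom C w x; g \<in> Hom C x y; h \<in> Hom C y z\<rbrakk> \<Longrightarrow> (h \<star> g) \<star> f = h \<star> (g \<star> f)"
    and cmp_idm_left: "\<lbrakk>x \<in> Ob C; y \<in> Ob C; f \<in> Hom C x y\<rbrakk> \<Longrightarrow> idm C y \<star> f = f"
    and cmp_idm_right: "\<lbrakk>x \<in> Ob C; y \<in> Ob C; f \<in> Hom C x y\<rbrakk> \<Longrightarrow> f \<star> idm C x = f"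
    and cmp_add_left:
      "\<lbrakk>x \<in> Ob C; y \<in> Ob C; z \<in> Ob C; f \<in> Hom C x y; g \<in> Hom C y z; g' \<in> Hom C y z\<rbrakk>
        \<Longrightarrow> (g + g') \<star> f = g \<star> f + g' \<star> f"
    and cmp_add_right:
      "\<lbrakk>x \<in> Ob C; y \<in> Ob C; z \<in> Ob C; f \<in> Hom C x y; f' \<in> Hom C x y; g \<in> Hom C y z\<rbrakk>
        \<Longrightarrow> g \<star> (f + f') = g \<star> f + g \<star> f'"
    and cmp_scl_left:
      "\<lbrakk>x \<in> Ob C; y \<in> Ob C; z \<in> Ob C; f \<in> Hom C x y; g \<in> Hom C y z\<rbrakk>
        \<Longrightarrow> scl C a g \<star> f = scl C a (g \<star> f)"
    and cmp_scl_right: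
      "\<lbrakk>x \<in> Ob C; y \<in> Ob C; z \<in> Ob C; f \<in> Hom C x y; g \<in> Hom C y z\<rbrakk>
        \<Longrightarrow> g \<star> scl C a f = scl C a (g \<star> f)"

definition isomorphic_obj :: "('k, 'o, 'm, 'z) lincat_scheme \<Rightarrow> 'o \<Rightarrow> 'o \<Rightarrow> bool" where
  "isomorphic_obj C x y \<longleftrightarrow> x \<in> Ob C \<and> y \<in> Ob C \<and>
     (\<exists>f\<in>Hom C x y. \<exists>g\<in>Hom C y x. g \<star>\<^bsub>C\<^esub> f = idm C x \<and> f \<star>\<^bsub>C\<^esub> g = idm C y)"

definition zero_obj :: "('k, 'o, 'm::zero, 'z) lincat_scheme \<Rightarrow> 'o \<Rightarrow> bool" where
  "zero_obj C z \<longleftrightarrow> z \<in> Ob C \<and> (\<forall>x\<in>Ob C. Hom C x z = {0} \<and> Hom C z x = {0})"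

definition is_biproduct ::
  "('k, 'o, 'm::ab_group_add, 'z) lincat_scheme \<Rightarrow> 'o \<Rightarrow> 'o \<Rightarrow> 'o \<Rightarrow> 'm \<Rightarrow> 'm \<Rightarrow> 'm \<Rightarrow> 'm \<Rightarrow> bool"
where
  "is_biproduct C s a b i j p q \<longleftrightarrow>
     s \<in> Ob C \<and> a \<in> Ob C \<and> b \<in> Ob C \<and>
     i \<in> Hom C a s \<and> j \<in> Hom C b s \<and> p \<in> Hom C s a \<and> q \<in> Hom C s b \<and>
     p \<star>\<^bsub>C\<^esub> i = idm C a \<and> q \<star>\<^bsub>C\<^esub> j = idm C b \<and> p \<star>\<^bsub>C\<^esub> j = 0 \<and> q \<star>\<^bsub>C\<^esub> i = 0 \<and>
     i \<star>\<^bsub>C\<^esub> p + j \<star>\<^bsub>C\<^esub> q = idm C s"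

text \<open>\<open>is_direct_sum C s a b\<close> says \<open>s \<cong> a \<oplus> b\<close>.\<close>

definition is_direct_sum ::
  "('k, 'o, 'm::ab_group_add, 'z) lincat_scheme \<Rightarrow> 'o \<Rightarrow> 'o \<Rightarrow> 'o \<Rightarrow> bool" where
  "is_direct_sum C s a b \<longleftrightarrow> (\<exists>i j p q. is_biproduct C s a b i j p q)"

text \<open>\<open>is_copower C n t s\<close> says that \<open>s\<close> is a direct sum of \<open>n\<close> copies of \<open>t\<close>.\<close>

definition is_copower ::
  "('k, 'o, 'm::ab_group_add, 'z) lincat_scheme \<Rightarrow> nat \<Rightarrow> 'o \<Rightarrow> 'o \<Rightarrow> bool" where
  "is_copower C n t s \<longleftrightarrow> t \<in> Ob C \<and> s \<in> Ob C \<and>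
     (\<exists>\<iota> \<pi>. (\<forall>k<n. \<iota> k \<in> Hom C t s \<and> \<pi> k \<in> Hom C s t) \<and>
       (\<forall>k<n. \<forall>l<n. \<pi> k \<star>\<^bsub>C\<^esub> \<iota> l = (if k = l then idm C t else 0)) \<and>
       (\<Sum>k<n. \<iota> k \<star>\<^bsub>C\<^esub> \<pi> k) = idm C s)"

definition add_closure :: "('k, 'o, 'm::ab_group_add, 'z) lincat_scheme \<Rightarrow> 'o \<Rightarrow> 'o set" where
  "add_closure C t = {x. \<exists>n s y. is_copower C n t s \<and> is_direct_sum C s x y}"

definition indecomposable :: "('k, 'o, 'm::ab_group_add, 'z) lincat_scheme \<Rightarrow> 'o \<Rightarrow> bool" where
  "indecomposable C c \<longleftrightarrow> c \<in> Ob C \<and> \<not> zero_obj C c \<and>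
     (\<forall>a b. is_direct_sum C c a b \<longrightarrow> zero_obj C a \<or> zero_obj C b)"

definition hom_finite :: "('k::field, 'o, 'm::ab_group_add, 'z) lincat_scheme \<Rightarrow> bool" where
  "hom_finite C \<longleftrightarrow>
     (\<forall>x\<in>Ob C. \<forall>y\<in>Ob C. \<exists>B. finite B \<and> Modules.module.span (scl C) B = Hom C x y)"

definition idempotents_split :: "('k, 'o, 'm, 'z) lincat_scheme \<Rightarrow> bool" where
  "idempotents_split C \<longleftrightarrow>
     (\<forall>x\<in>Ob C. \<forall>e\<in>Hom C x x. e \<star>\<^bsub>C\<^esub> e = e \<longrightarrow>
       (\<exists>y\<in>Ob C. \<exists>r\<in>Hom C x y. \<exists>s\<in>Hom C y x. s \<star>\<^bsub>C\<^esub> r = e \<and> r \<star>\<^bsub>C\<^esub> s = idm C y))"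

locale additive_linear_category = linear_category +
  assumes zero_obj_exists: "\<exists>z. zero_obj C z"
    and direct_sum_exists: "\<lbrakk>a \<in> Ob C; b \<in> Ob C\<rbrakk> \<Longrightarrow> \<exists>s. is_direct_sum C s a b"

definition Hom_through ::
  "('k, 'o, 'm, 'z) lincat_scheme \<Rightarrow> 'o set \<Rightarrow> 'o \<Rightarrow> 'o \<Rightarrow> 'm set" where
  "Hom_through C S x y = {g \<star>\<^bsub>C\<^esub> f | f g s. s \<in> S \<and> f \<in> Hom C x s \<and> g \<in> Hom C s y}"

definition quot_class ::
  "('k, 'o, 'm::ab_group_add, 'z) lincat_scheme \<Rightarrow> 'o set \<Rightarrow> 'o \<Rightarrow> 'o \<Rightarrow> 'm \<Rightarrow> 'm set" where
  "quot_class C S x y f = (\<lambda>w. f + w) ` Hom_through C S x y"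

text \<open>The morphism space from \<open>x\<close> to \<open>y\<close> in the quotient category \<open>C/[S]\<close>; its zero is
  \<open>quot_class C S x y 0\<close>.\<close>

definition quot_Hom ::
  "('k, 'o, 'm::ab_group_add, 'z) lincat_scheme \<Rightarrow> 'o set \<Rightarrow> 'o \<Rightarrow> 'o \<Rightarrow> 'm set set" where
  "quot_Hom C S x y = quot_class C S x y ` Hom C x y"


section \<open>\<open>(d+2)\<close>-angulated categories\<close>

text \<open>
  \<open>SigO\<close> and \<open>SigM\<close> are the object and morphism parts of the automorphism \<open>\<Sigma>\<^sup>d\<close>.
  The \<open>\<Sigma>\<^sup>d\<close>-sequence \<open>c\<^sup>0 \<rightarrow> \<dots> \<rightarrow> c\<^sup>d\<^sup>+\<^sup>1 \<rightarrow> \<Sigma>\<^sup>d c\<^sup>0\<close> is the pair of the lists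
  \<open>[c\<^sup>0, \<dots>, c\<^sup>d\<^sup>+\<^sup>1]\<close> and \<open>[\<gamma>\<^sup>0, \<dots>, \<gamma>\<^sup>d\<^sup>+\<^sup>1]\<close>.
\<close>

record ('k, 'o, 'm) angcat = "('k, 'o, 'm) lincat" +
  SigO :: "'o \<Rightarrow> 'o"
  SigM :: "'m \<Rightarrow> 'm"
  Ang :: "('o list \<times> 'm list) set"

definition SigO_inv :: "('k, 'o, 'm, 'z) angcat_scheme \<Rightarrow> 'o \<Rightarrow> 'o" where
  "SigO_inv C = inv_into (Ob C) (SigO C)"

text \<open>For a sequence \<open>X\<close> as above, \<open>seq_ob C X (d + 2)\<close> is \<open>\<Sigma>\<^sup>d c\<^sup>0\<close> and \<open>seq_mor C X (d + 2)\<close>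
  is \<open>\<Sigma>\<^sup>d \<gamma>\<^sup>0\<close>.\<close>

definition seq_ob :: "('k, 'o, 'm, 'z) angcat_scheme \<Rightarrow> 'o list \<times> 'm list \<Rightarrow> nat \<Rightarrow> 'o" where
  "seq_ob C X i = (fst X @ [SigO C (hd (fst X))]) ! i"

definition seq_mor :: "('k, 'o, 'm, 'z) angcat_scheme \<Rightarrow> 'o list \<times> 'm list \<Rightarrow> nat \<Rightarrow> 'm" where
  "seq_mor C X i = (snd X @ [SigM C (hd (snd X))]) ! i"

definition sigma_sequence ::
  "('k, 'o, 'm, 'z) angcat_scheme \<Rightarrow> nat \<Rightarrow> 'o list \<times> 'm list \<Rightarrow> bool" where
  "sigma_sequence C d X \<longleftrightarrow>
     length (fst X) = d + 2 \<and> length (snd X) = d + 2 \<and> set (fst X) \<subseteq> Ob C \<and>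
     (\<forall>i\<le>d + 1. seq_mor C X i \<in> Hom C (seq_ob C X i) (seq_ob C X (Suc i)))"

definition is_seq_morphism ::
  "('k, 'o, 'm, 'z) angcat_scheme \<Rightarrow> nat \<Rightarrow> 'o list \<times> 'm list \<Rightarrow> 'o list \<times> 'm list
    \<Rightarrow> (nat \<Rightarrow> 'm) \<Rightarrow> bool" where
  "is_seq_morphism C d X Y \<phi> \<longleftrightarrow>
     (\<forall>i\<le>d + 2. \<phi> i \<in> Hom C (seq_ob C X i) (seq_ob C Y i)) \<and>
     \<phi> (d + 2) = SigM C (\<phi> 0) \<and>
     (\<forall>i\<le>d + 1. \<phi> (Suc i) \<star>\<^bsub>C\<^esub> seq_mor C X i = seq_mor C Y i \<star>\<^bsub>C\<^esub> \<phi> i)"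

definition is_seq_direct_sum ::
  "('k, 'o, 'm::ab_group_add, 'z) angcat_scheme \<Rightarrow> nat \<Rightarrow> 'o list \<times> 'm list
    \<Rightarrow> 'o list \<times> 'm list \<Rightarrow> 'o list \<times> 'm list \<Rightarrow> bool" where
  "is_seq_direct_sum C d Z X Y \<longleftrightarrow>
     (\<exists>\<iota> \<kappa> \<pi> \<rho>. is_seq_morphism C d X Z \<iota> \<and> is_seq_morphism C d Y Z \<kappa> \<and>
        is_seq_morphism C d Z X \<pi> \<and> is_seq_morphism C d Z Y \<rho> \<and>
        (\<forall>i\<le>d + 1. is_biproduct C (seq_ob C Z i) (seq_ob C X i) (seq_ob C Y i)
                     (\<iota> i) (\<kappa> i) (\<pi> i) (\<rho> i)))"

definition left_rotation ::
  "('k::field, 'o, 'm, 'z) angcat_scheme \<Rightarrow> nat \<Rightarrow> 'o list \<times> 'm list \<Rightarrow> 'o list \<times> 'm list" where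
  "left_rotation C d X =
     (tl (fst X) @ [SigO C (hd (fst X))],
      tl (snd X) @ [scl C ((- 1) ^ d) (SigM C (hd (snd X)))])"

text \<open>
  The mapping cone of \<open>\<phi> : X \<rightarrow> Y\<close>, with \<open>X = (b\<^sup>i, \<beta>\<^sup>i)\<close> and \<open>Y = (c\<^sup>i, \<gamma>\<^sup>i)\<close>, has
  objects \<open>b\<^sup>i\<^sup>+\<^sup>1 \<oplus> c\<^sup>i\<close> and morphisms given by the matrices
  \<open>(-\<beta>\<^sup>i\<^sup>+\<^sup>1, 0; \<phi>\<^sup>i\<^sup>+\<^sup>1, \<gamma>\<^sup>i)\<close>, the last of them being \<open>(-\<Sigma>\<^sup>d\<beta>\<^sup>0, 0; \<Sigma>\<^sup>d\<phi>\<^sup>0, \<gamma>\<^sup>d\<^sup>+\<^sup>1)\<close>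
  (the sign convention of Geiss, Keller and Oppermann).
  As biproducts are determined only up to isomorphism, so is the cone.  The last target
  \<open>\<Sigma>\<^sup>d(b\<^sup>1 \<oplus> c\<^sup>0)\<close> is identified with \<open>\<Sigma>\<^sup>d b\<^sup>1 \<oplus> \<Sigma>\<^sup>d c\<^sup>0\<close> through \<open>\<Sigma>\<^sup>d\<close> of the injections.
\<close>

definition is_mapping_cone ::
  "('k, 'o, 'm::ab_group_add, 'z) angcat_scheme \<Rightarrow> nat \<Rightarrow> 'o list \<times> 'm list
    \<Rightarrow> 'o list \<times> 'm list \<Rightarrow> (nat \<Rightarrow> 'm) \<Rightarrow> 'o list \<times> 'm list \<Rightarrow> bool" where
  "is_mapping_cone C d X Y \<phi> Z \<longleftrightarrow> sigma_sequence C d Z \<and>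
     (\<exists>\<iota> \<kappa> \<pi> \<rho>.
        (\<forall>i\<le>d + 1. is_biproduct C (seq_ob C Z i) (seq_ob C X (Suc i)) (seq_ob C Y i)
                     (\<iota> i) (\<kappa> i) (\<pi> i) (\<rho> i)) \<and>
        \<iota> (d + 2) = SigM C (\<iota> 0) \<and> \<kappa> (d + 2) = SigM C (\<kappa> 0) \<and>
        (\<forall>i\<le>d + 1. seq_mor C Z i =
            \<iota> (Suc i) \<star>\<^bsub>C\<^esub> (- seq_mor C X (Suc i)) \<star>\<^bsub>C\<^esub> \<pi> i
          + \<kappa> (Suc i) \<star>\<^bsub>C\<^esub> \<phi> (Suc i) \<star>\<^bsub>C\<^esub> \<pi> i
          + \<kappa> (Suc i) \<star>\<^bsub>C\<^esub> seq_mor C Y i \<star>\<^bsub>C\<^esub> \<rho> i))"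

text \<open>\<open>\<Sigma>\<^sup>d\<close> is an automorphism of the additive category; it need not be \<open>K\<close>-linear.\<close>

locale angulated_category = additive_linear_category C
  for C :: "('k::field, 'o, 'm::ab_group_add, 'z) angcat_scheme" (structure) +
  fixes d :: nat
  assumes d_pos: "d \<ge> 1"
    and SigO_bij: "bij_betw (SigO C) (Ob C) (Ob C)"
    and SigM_bij: "\<lbrakk>x \<in> Ob C; y \<in> Ob C\<rbrakk>
        \<Longrightarrow> bij_betw (SigM C) (Hom C x y) (Hom C (SigO C x) (SigO C y))"
    and SigM_idm: "x \<in> Ob C \<Longrightarrow> SigM C (idm C x) = idm C (SigO C x)"
    and SigM_cmp:
      "\<lbrakk>x \<in> Ob C; y \<in> Ob C; z \<in> Ob C; f \<in> Hom C x y; g \<in> Hom C y z\<rbrakk>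
        \<Longrightarrow> SigM C (g \<star> f) = SigM C g \<star> SigM C f"
    and SigM_add:
      "\<lbrakk>x \<in> Ob C; y \<in> Ob C; f \<in> Hom C x y; g \<in> Hom C x y\<rbrakk>
        \<Longrightarrow> SigM C (f + g) = SigM C f + SigM C g"
    and Ang_sequence: "X \<in> Ang C \<Longrightarrow> sigma_sequence C d X"
    and N1_sums_and_summands:
      "\<lbrakk>sigma_sequence C d X; sigma_sequence C d Y; sigma_sequence C d Z;
        is_seq_direct_sum C d Z X Y\<rbrakk> \<Longrightarrow> Z \<in> Ang C \<longleftrightarrow> X \<in> Ang C \<and> Y \<in> Ang C"
    and N1_trivial:
      "\<lbrakk>c \<in> Ob C; zero_obj C z\<rbrakk>
        \<Longrightarrow> (c # c # replicate d z, idm C c # replicate (d + 1) 0) \<in> Ang C"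
    and N1_first_morphism:
      "\<lbrakk>x \<in> Ob C; y \<in> Ob C; f \<in> Hom C x y\<rbrakk>
        \<Longrightarrow> \<exists>X\<in>Ang C. seq_ob C X 0 = x \<and> seq_ob C X 1 = y \<and> seq_mor C X 0 = f"
    and N2: "sigma_sequence C d X \<Longrightarrow> X \<in> Ang C \<longleftrightarrow> left_rotation C d X \<in> Ang C"
    and N3:
      "\<lbrakk>X \<in> Ang C; Y \<in> Ang C;
        f \<in> Hom C (seq_ob C X 0) (seq_ob C Y 0); g \<in> Hom C (seq_ob C X 1) (seq_ob C Y 1);
        g \<star> seq_mor C X 0 = seq_mor C Y 0 \<star> f\<rbrakk>
        \<Longrightarrow> \<exists>\<phi>. is_seq_morphism C d X Y \<phi> \<and> \<phi> 0 = f \<and> \<phi> 1 = g"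
    and N4:
      "\<lbrakk>X \<in> Ang C; Y \<in> Ang C;
        f \<in> Hom C (seq_ob C X 0) (seq_ob C Y 0); g \<in> Hom C (seq_ob C X 1) (seq_ob C Y 1);
        g \<star> seq_mor C X 0 = seq_mor C Y 0 \<star> f\<rbrakk>
        \<Longrightarrow> \<exists>\<phi>. is_seq_morphism C d X Y \<phi> \<and> \<phi> 0 = f \<and> \<phi> 1 = g \<and>
              (\<exists>Z\<in>Ang C. is_mapping_cone C d X Y \<phi> Z)"


section \<open>Oppermann-Thomas cluster tilting and the index\<close>

text \<open>\<open>S_resolution C d S c t\<close> says that there is a \<open>(d+2)\<close>-angle
  \<open>t\<^sub>d \<rightarrow> t\<^sub>d\<^sub>-\<^sub>1 \<rightarrow> \<dots> \<rightarrow> t\<^sub>0 \<rightarrow> c \<rightarrow> \<Sigma>\<^sup>d t\<^sub>d\<close> with all \<open>t\<^sub>i\<close> in \<open>S\<close>.\<close>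

definition S_resolution ::
  "('k, 'o, 'm, 'z) angcat_scheme \<Rightarrow> nat \<Rightarrow> 'o set \<Rightarrow> 'o \<Rightarrow> (nat \<Rightarrow> 'o) \<Rightarrow> bool" where
  "S_resolution C d S c t \<longleftrightarrow> (\<forall>i\<le>d. t i \<in> S) \<and>
     (\<exists>\<gamma>. (map t (rev [0..<Suc d]) @ [c], \<gamma>) \<in> Ang C)"

definition OT_cluster_tilting_subcategory ::
  "('k, 'o, 'm::ab_group_add, 'z) angcat_scheme \<Rightarrow> nat \<Rightarrow> 'o set \<Rightarrow> bool" where
  "OT_cluster_tilting_subcategory C d S \<longleftrightarrow>
     (\<forall>t\<in>S. \<forall>t'\<in>S. Hom C t (SigO C t') = {0}) \<and>
     (\<forall>c\<in>Ob C. \<exists>t. S_resolution C d S c t)"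

definition OT_cluster_tilting_object ::
  "('k, 'o, 'm::ab_group_add, 'z) angcat_scheme \<Rightarrow> nat \<Rightarrow> 'o \<Rightarrow> bool" where
  "OT_cluster_tilting_object C d T \<longleftrightarrow>
     T \<in> Ob C \<and> OT_cluster_tilting_subcategory C d (add_closure C T)"

text \<open>The split Grothendieck group, as a multiplicatively written HOL-Algebra group.\<close>

definition split_relations ::
  "('k, 'o, 'm::ab_group_add, 'z) lincat_scheme \<Rightarrow> 'o set \<Rightarrow> ('o \<Rightarrow>\<^sub>0 int) set" where
  "split_relations C S = generate (free_Abelian_group S)
     {frag_of t - (frag_of t' + frag_of t'') | t t' t''.
        t \<in> S \<and> t' \<in> S \<and> t'' \<in> S \<and> is_direct_sum C t t' t''}"

definition K0_split ::
  "('k, 'o, 'm::ab_group_add, 'z) lincat_scheme \<Rightarrow> 'o set \<Rightarrow> ('o \<Rightarrow>\<^sub>0 int) set monoid" where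
  "K0_split C S = free_Abelian_group S Mod split_relations C S"

definition K0_class ::
  "('k, 'o, 'm::ab_group_add, 'z) lincat_scheme \<Rightarrow> 'o set \<Rightarrow> 'o \<Rightarrow> ('o \<Rightarrow>\<^sub>0 int) set" where
  "K0_class C S t = split_relations C S #>\<^bsub>free_Abelian_group S\<^esub> frag_of t"

text \<open>The sum \<open>\<Sum>\<^sub>i (-1)\<^sup>i [t\<^sub>i]\<close> for some resolution \<open>t\<close> of \<open>c\<close>.  For an Oppermann-Thomas cluster
  tilting subcategory \<open>S\<close> of a Hom-finite category with split idempotents, it does not depend
  on the resolution.\<close>

definition ot_index ::
  "('k, 'o, 'm::ab_group_add, 'z) angcat_scheme \<Rightarrow> nat \<Rightarrow> 'o set \<Rightarrow> 'o \<Rightarrow> ('o \<Rightarrow>\<^sub>0 int) set" where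
  "ot_index C d S c =
     (let t = (SOME t. S_resolution C d S c t)
      in finprod (K0_split C S)
           (\<lambda>i. K0_class C S (t i) [^]\<^bsub>K0_split C S\<^esub> ((- 1) ^ i :: int)) {..d})"

end

theory Submission
  imports Defs
begin

text \<open>
  Write \<open>\<T>\<close> for the cluster tilting subcategory.  The index of \<open>u\<close> determines every alternating sum
  \<open>\<Sum>(-1)\<^sup>i \<phi>(t\<^sub>i)\<close> over a resolution \<open>t\<^sub>d \<rightarrow> \<dots> \<rightarrow> t\<^sub>0 \<rightarrow> u\<close>, for \<open>\<phi>\<close> additive on direct sums.  Take
  \<open>\<phi>(t) = dim Hom(t, x)\<close>.  The functor \<open>Hom(-, x)\<close> turns the resolution into a complex that is exact
  except at its two ends, where it has the cohomology \<open>Hom(u, x)\<close> in the quotient category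
  \<open>C/[\<Sigma>\<^sup>d \<T>]\<close> and \<open>Hom\<^sup>[\<^sup>\<T>\<^sup>](\<Sigma>\<^sup>-\<^sup>d u, x)\<close> (\<open>resolution_Euler_characteristic\<close>).  For odd \<open>d\<close> the index
  therefore determines the difference of the dimensions of these two spaces.  When \<open>u\<close> and \<open>x\<close> are
  indecomposable one of the two dimensions is zero, so each of them is determined; decomposing \<open>x\<close>
  extends this to all objects \<open>x\<close>.

  It remains to recover an indecomposable \<open>c\<close> from the numbers \<open>dim Hom(c, x)\<close>, taken in the quotient
  category (\<open>isomorphic_if_quot_dim_eq\<close>).  The argument is dual to that of Bongartz for modules.
  Suppose that \<open>c'\<close> has the same numbers.  Let \<open>Q \<rightarrow> c\<close> be a right approximation by copies of \<open>c'\<close>, and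
  continue it to the left by an exact sequence.  The dimensions of the terms of this sequence
  determine the rank of \<open>Hom(u, Q) \<rightarrow> Hom(u, c)\<close> in the same way for \<open>u = c\<close> and \<open>u = c'\<close>.  For \<open>u = c'\<close>
  the map is onto, so it is onto for \<open>u = c\<close>: the identity of \<open>c\<close> factors through \<open>Q\<close>, and
  since the endomorphism ring of \<open>c\<close> is local, \<open>c\<close> is a summand of \<open>c'\<close>.

  The exact sequence comes from an angle \<open>c\<^sup>0 \<rightarrow> \<dots> \<rightarrow> c\<^sup>d = Q \<rightarrow> c \<rightarrow> \<Sigma>\<^sup>d c\<^sup>0\<close>.  Applying \<open>Hom(s, -)\<close> with
  \<open>s \<in> \<T>\<close> gives an exact sequence that starts with \<open>0\<close> as soon as every morphism \<open>\<Sigma>\<^sup>d s \<rightarrow> c\<close> factors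
  through \<open>Q\<close>, and this is achieved by adding copies of \<open>\<Sigma>\<^sup>d T\<close> to \<open>Q\<close>, which are zero objects of the
  quotient category.  Exactness for \<open>Hom(u, -)\<close> in the quotient category then follows from a double
  complex that resolves \<open>u\<close> by \<open>\<T>\<close> (\<open>double_complex_exact\<close>).

  If \<open>c\<close> and \<open>c'\<close> vanish in the quotient category, then \<open>c = \<Sigma>\<^sup>d t\<close> and \<open>c' = \<Sigma>\<^sup>d t'\<close> with \<open>t\<close>, \<open>t'\<close> in \<open>\<T>\<close>.
  Then \<open>Hom\<^sup>[\<^sup>\<T>\<^sup>](\<Sigma>\<^sup>-\<^sup>d c, x) = Hom(t, x)\<close>, which is also the morphism space in the quotient
  category, and the same argument identifies \<open>t\<close> and \<open>t'\<close>.
\<close>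

section \<open>Dimensions of finite-dimensional subspaces\<close>

text \<open>All morphism spaces of a linear category lie in one ambient vector space, which need not be
  finite-dimensional; so dimensions are compared between finite-dimensional subspaces.\<close>

locale subspace_dimension = vector_space
begin

definition fin_dim :: "'b set \<Rightarrow> bool" where
  "fin_dim V \<longleftrightarrow> (\<exists>B. finite B \<and> span B = V)"

definition linear_on :: "'b set \<Rightarrow> ('b \<Rightarrow> 'b) \<Rightarrow> bool" where
  "linear_on V f \<longleftrightarrow> (\<forall>x\<in>V. \<forall>y\<in>V. f (x + y) = f x + f y) \<and> (\<forall>a. \<forall>x\<in>V. f (a *s x) = a *s f x)"

lemma fin_dim_subspace: "fin_dim V \<Longrightarrow> subspace V"
  unfolding fin_dim_def using subspace_span by auto

lemma fin_dim_basis: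
  assumes "fin_dim V" "subspace W" "W \<subseteq> V" "A \<subseteq> W" "independent A"
  obtains B where "A \<subseteq> B" "B \<subseteq> W" "independent B" "span B = W" "finite B" "card B = dim W"
proof -
  obtain F where F: "finite F" "span F = V" using assms(1) by (auto simp: fin_dim_def)
  obtain B where B: "A \<subseteq> B" "B \<subseteq> W" "independent B" "W \<subseteq> span B"
    using maximal_independent_subset_extend[OF assms(4,5)] by blast
  have s: "span B = W" using B assms(2) by (simp add: span_minimal subset_antisym)
  have "finite B" using independent_span_bound[OF F(1) B(3)] F(2) B(2) assms(3) by auto
  moreover have "card B = dim W" using basis_card_eq_dim B by blast
  ultimately show ?thesis using that B s by blast
qed

lemma fin_dim_mono: "fin_dim V \<Longrightarrow> subspace W \<Longrightarrow> W \<subseteq> V \<Longrightarrow> fin_dim W"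
  by (metis fin_dim_basis fin_dim_def empty_subsetI independent_empty)

lemma dim_mono_fin_dim:
  assumes "fin_dim V" "subspace W" "W \<subseteq> V" shows "dim W \<le> dim V"
proof -
  obtain A where A: "A \<subseteq> W" "independent A" "span A = W" "finite A" "card A = dim W"
    by (rule fin_dim_basis[OF assms, of "{}"]) (auto simp: independent_empty)
  obtain B where B: "A \<subseteq> B" "finite B" "card B = dim V"
    by (rule fin_dim_basis[OF assms(1) fin_dim_subspace[OF assms(1)] order_refl, of A])
      (use A assms in auto)
  show ?thesis using card_mono[OF B(2,1)] A B by simp
qed

lemma fin_dim_eqI:
  assumes "fin_dim V" "subspace W" "W \<subseteq> V" "dim V \<le> dim W" shows "W = V"
proof -
  obtain A where A: "A \<subseteq> W" "independent A" "span A = W" "finite A" "card A = dim W"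
    by (rule fin_dim_basis[OF assms(1-3), of "{}"]) (auto simp: independent_empty)
  obtain B where B: "A \<subseteq> B" "finite B" "card B = dim V" "span B = V"
    by (rule fin_dim_basis[OF assms(1) fin_dim_subspace[OF assms(1)] order_refl, of A])
      (use A assms in auto)
  have "A = B" using card_seteq[OF B(2,1)] A B assms(4) by simp
  then show ?thesis using A B by simp
qed

lemma dim_zero_space [simp]: "dim {0} = 0"
  by (metis card.empty dim_span_eq_card_independent independent_empty span_empty)

lemma fin_dim_eq_zero_iff:
  assumes "fin_dim V" shows "dim V = 0 \<longleftrightarrow> V = {0}"
  using fin_dim_eqI[OF assms, of "{0}"] subspace_0[OF fin_dim_subspace[OF assms]] subspace_single_0
  by auto

lemma linear_on_extend:
  assumes "subspace V" "linear_on V f"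
  obtains g where "Vector_Spaces.linear scale scale g" "\<And>x. x \<in> V \<Longrightarrow> g x = f x"
proof -
  interpret p: vector_space_pair scale scale ..
  obtain B where B: "B \<subseteq> V" "independent B" "V \<subseteq> span B"
    using maximal_independent_subset by blast
  obtain g where g: "Vector_Spaces.linear scale scale g" "\<And>x. x \<in> B \<Longrightarrow> g x = f x"
    using p.linear_independent_extend[OF B(2)] by metis
  interpret g: Vector_Spaces.linear scale scale g by (fact g)
  have "x \<in> V \<and> g x = f x" if "x \<in> span B" for x
    using that
  proof (induction rule: span_induct_alt)
    case base
    have "f 0 = 0" using assms subspace_0[OF assms(1)] by (metis add_cancel_right_right linear_on_def)
    then show ?case using assms subspace_0 by (simp add: g.zero)
  next
    case (step c x y)
    then have "x \<in> V" "c *s x \<in> V" using B assms by (auto intro: subspace_scale)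
    then show ?case using step g(2) assms
      by (simp add: g.add g.scale linear_on_def subspace_add)
  qed
  then show ?thesis using that g(1) B(3) by blast
qed

lemma linear_on_subset: "linear_on V f \<Longrightarrow> W \<subseteq> V \<Longrightarrow> linear_on W f"
  unfolding linear_on_def by blast

lemma linear_on_zero: "subspace V \<Longrightarrow> linear_on V f \<Longrightarrow> f 0 = 0"
  by (metis add_cancel_right_right linear_on_def subspace_0)

text \<open>The complement of a basis of the kernel in a basis of \<open>V\<close> is mapped bijectively onto a
  basis of the image.  Linearity is stated on \<open>V\<close>, because composition in a category is bilinear
  on morphism spaces and not on the ambient space.\<close>

lemma rank_nullity:
  assumes V: "fin_dim V" and f: "linear_on V f"
  shows "dim V = dim {x\<in>V. f x = 0} + dim (f ` V)"
    and "fin_dim {x\<in>V. f x = 0}" and "fin_dim (f ` V)"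
proof -
  have sV: "subspace V" using V by (rule fin_dim_subspace)
  obtain g where g: "Vector_Spaces.linear scale scale g" "\<And>x. x \<in> V \<Longrightarrow> g x = f x"
    using linear_on_extend[OF sV f] by blast
  interpret g: Vector_Spaces.linear scale scale g by (fact g)
  interpret p: vector_space_pair scale scale ..
  define N where "N = {x\<in>V. g x = 0}"
  have N: "N = {x\<in>V. f x = 0}" and im: "f ` V = g ` V" using g(2) by (auto simp: N_def)
  have sN: "subspace N" using sV unfolding N_def subspace_def by (auto simp: g.add g.scale g.zero)
  have NV: "N \<subseteq> V" by (auto simp: N_def)
  obtain K where K: "K \<subseteq> N" "independent K" "span K = N" "card K = dim N"
    by (rule fin_dim_basis[OF V sN NV, of "{}"]) (auto simp: independent_empty)
  obtain B where B: "K \<subseteq> B" "B \<subseteq> V" "independent B" "span B = V" "finite B" "card B = dim V"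
    by (rule fin_dim_basis[OF V sV order_refl, of K]) (use K NV in auto)
  have indep: "independent (B - K)" using B(3) independent_mono by blast
  have "inj_on g (span (B - K))"
    unfolding g.inj_on_iff_eq_0[OF subspace_span]
  proof (intro ballI impI)
    fix x assume x: "x \<in> span (B - K)" "g x = 0"
    then have "x \<in> V" using span_mono[of "B - K" B] B by auto
    then have xK: "x \<in> span K" using x K by (simp add: N_def)
    define h where "h = p.construct B (\<lambda>b. if b \<in> K then b else 0)"
    have h: "Vector_Spaces.linear scale scale h" unfolding h_def by (rule p.linear_construct[OF B(3)])
    have hb: "h b = (if b \<in> K then b else 0)" if "b \<in> B" for b
      unfolding h_def using p.construct_basis[OF B(3) that] by simp
    have "h x = x"
      by (rule p.linear_eq_on[OF h _ xK, where g = "\<lambda>x. x"]) (use hb B in \<open>auto intro: linear_ident\<close>)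
    moreover have "h x = 0"
      by (rule p.linear_eq_on[OF h _ x(1), where g = "\<lambda>x. 0"]) (use hb B p.linear_zero in auto)
    ultimately show "x = 0" by simp
  qed
  then have ind: "independent (g ` (B - K))" and inj: "inj_on g (B - K)"
    using g.independent_injective_image[OF indep] inj_on_subset span_superset by blast+
  have "g ` V = span (g ` B)" using g.span_image B(4) by metis
  also have "\<dots> = span (g ` (B - K))"
  proof -
    have "g ` B \<subseteq> insert 0 (g ` (B - K))" using K(1) by (auto simp: N_def)
    then have "span (g ` B) \<subseteq> span (g ` (B - K))" using span_mono span_insert_0 by blast
    then show ?thesis using span_mono[of "g ` (B - K)" "g ` B"] by blast
  qed
  finally have sp: "g ` V = span (g ` (B - K))" .
  have "dim (g ` V) = card (B - K)"
    using sp ind inj dim_span_eq_card_independent card_image by metis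
  also have "\<dots> = card B - card K" by (metis B(1,5) card_Diff_subset finite_subset)
  finally show "dim V = dim {x\<in>V. f x = 0} + dim (f ` V)"
    using K(4) B(1,5,6) card_mono[OF B(5,1)] N im by simp
  show "fin_dim {x\<in>V. f x = 0}" using fin_dim_mono[OF V sN NV] N by simp
  show "fin_dim (f ` V)" using sp im B(5) unfolding fin_dim_def by (metis finite_Diff finite_imageI)
qed

lemma dim_image_inj:
  assumes "fin_dim V" "linear_on V f" "\<And>x. x \<in> V \<Longrightarrow> f x = 0 \<Longrightarrow> x = 0"
  shows "dim (f ` V) = dim V"
proof -
  have s: "subspace V" using assms fin_dim_subspace by blast
  have "{x\<in>V. f x = 0} = {0}"
    using assms(3) linear_on_zero[OF s assms(2)] subspace_0[OF s] by blast
  then show ?thesis using rank_nullity(1)[OF assms(1,2)] by simp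
qed

text \<open>The Euler characteristic of a complex that is exact except at its two ends.  Each term contributes the
  rank of the map into it and the rank of the map out of it, and these telescope.\<close>

lemma alternating_dim_sum:
  fixes V :: "nat \<Rightarrow> 'b set"
  assumes "\<And>j. j \<le> n \<Longrightarrow> fin_dim (V j)" "\<And>j. j \<le> n \<Longrightarrow> linear_on (V j) (f j)"
    and "\<And>j. j < n \<Longrightarrow> f j ` V j = {x\<in>V (Suc j). f (Suc j) x = 0}"
  shows "(\<Sum>j\<le>n. (- 1) ^ j * int (dim (V j)))
    = int (dim {x\<in>V 0. f 0 x = 0}) + (- 1) ^ n * int (dim (f n ` V n))"
  using assms
proof (induction n)
  case 0
  then show ?case using rank_nullity(1)[of "V 0" "f 0"] by simp
next
  case (Suc n)
  have IH: "(\<Sum>j\<le>n. (- 1) ^ j * int (dim (V j)))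
    = int (dim {x\<in>V 0. f 0 x = 0}) + (- 1) ^ n * int (dim (f n ` V n))"
    using Suc by (intro Suc.IH) auto
  have "dim (V (Suc n)) = dim (f n ` V n) + dim (f (Suc n) ` V (Suc n))"
    using rank_nullity(1)[of "V (Suc n)" "f (Suc n)"] Suc.prems by simp
  then show ?case using IH by (simp add: algebra_simps)
qed

end

section \<open>Linear categories\<close>

sublocale linear_category \<subseteq> vs: subspace_dimension "scl C"
  by (simp add: subspace_dimension_def vector_space_scl)

context linear_category
begin

lemma Hom_zero: "x \<in> Ob C \<Longrightarrow> y \<in> Ob C \<Longrightarrow> 0 \<in> Hom C x y"
  using Hom_subspace vs.subspace_0 by blast

lemma Hom_add: "x \<in> Ob C \<Longrightarrow> y \<in> Ob C \<Longrightarrow> f \<in> Hom C x y \<Longrightarrow> g \<in> Hom C x y \<Longrightarrow> f + g \<in> Hom C x y"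
  using Hom_subspace vs.subspace_add by blast

lemma Hom_diff: "x \<in> Ob C \<Longrightarrow> y \<in> Ob C \<Longrightarrow> f \<in> Hom C x y \<Longrightarrow> g \<in> Hom C x y \<Longrightarrow> f - g \<in> Hom C x y"
  using Hom_subspace vs.subspace_diff by blast

lemma Hom_uminus: "x \<in> Ob C \<Longrightarrow> y \<in> Ob C \<Longrightarrow> f \<in> Hom C x y \<Longrightarrow> - f \<in> Hom C x y"
  using Hom_subspace vs.subspace_neg by blast

lemma Hom_scl: "x \<in> Ob C \<Longrightarrow> y \<in> Ob C \<Longrightarrow> f \<in> Hom C x y \<Longrightarrow> scl C a f \<in> Hom C x y"
  using Hom_subspace vs.subspace_scale by blast

lemmas Hom_closed = idm_in_Hom cmp_in_Hom Hom_zero Hom_add Hom_diff Hom_uminus Hom_scl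

lemma linear_on_precomp:
  "x \<in> Ob C \<Longrightarrow> y \<in> Ob C \<Longrightarrow> z \<in> Ob C \<Longrightarrow> f \<in> Hom C x y \<Longrightarrow> vs.linear_on (Hom C y z) (\<lambda>g. g \<star> f)"
  unfolding vs.linear_on_def using cmp_add_left cmp_scl_left by simp

lemma linear_on_postcomp:
  "x \<in> Ob C \<Longrightarrow> y \<in> Ob C \<Longrightarrow> z \<in> Ob C \<Longrightarrow> g \<in> Hom C y z \<Longrightarrow> vs.linear_on (Hom C x y) (\<lambda>f. g \<star> f)"
  unfolding vs.linear_on_def using cmp_add_right cmp_scl_right by simp

lemma cmp_zero_left: "x \<in> Ob C \<Longrightarrow> y \<in> Ob C \<Longrightarrow> z \<in> Ob C \<Longrightarrow> f \<in> Hom C x y \<Longrightarrow> 0 \<star> f = 0"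
  using vs.linear_on_zero[OF Hom_subspace linear_on_precomp] by blast

lemma cmp_zero_right: "x \<in> Ob C \<Longrightarrow> y \<in> Ob C \<Longrightarrow> z \<in> Ob C \<Longrightarrow> g \<in> Hom C y z \<Longrightarrow> g \<star> 0 = 0"
  using vs.linear_on_zero[OF Hom_subspace linear_on_postcomp] by blast

lemma cmp_uminus_left:
  assumes "x \<in> Ob C" "y \<in> Ob C" "z \<in> Ob C" "f \<in> Hom C x y" "g \<in> Hom C y z"
  shows "(- g) \<star> f = - (g \<star> f)"
proof -
  have "(g + - g) \<star> f = g \<star> f + (- g) \<star> f" using assms by (intro cmp_add_left) (auto intro: Hom_closed)
  then show ?thesis using cmp_zero_left[OF assms(1-4)] by (simp add: eq_neg_iff_add_eq_0 add.commute)
qed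

lemma cmp_uminus_right:
  assumes "x \<in> Ob C" "y \<in> Ob C" "z \<in> Ob C" "f \<in> Hom C x y" "g \<in> Hom C y z"
  shows "g \<star> (- f) = - (g \<star> f)"
proof -
  have "g \<star> (f + - f) = g \<star> f + g \<star> (- f)" using assms by (intro cmp_add_right) (auto intro: Hom_closed)
  then show ?thesis using cmp_zero_right[OF assms(1-3,5)] by (simp add: eq_neg_iff_add_eq_0 add.commute)
qed

lemma cmp_diff_left:
  assumes "x \<in> Ob C" "y \<in> Ob C" "z \<in> Ob C" "f \<in> Hom C x y" "g \<in> Hom C y z" "g' \<in> Hom C y z"
  shows "(g - g') \<star> f = g \<star> f - g' \<star> f"
  using cmp_add_left[OF assms(1-5), of "- g'"] cmp_uminus_left[OF assms(1-4,6)] assms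
  by (simp add: Hom_uminus)

lemma cmp_diff_right:
  assumes "x \<in> Ob C" "y \<in> Ob C" "z \<in> Ob C" "f \<in> Hom C x y" "f' \<in> Hom C x y" "g \<in> Hom C y z"
  shows "g \<star> (f - f') = g \<star> f - g \<star> f'"
  using cmp_add_right[OF assms(1-4) _ assms(6), of "- f'"] cmp_uminus_right[OF assms(1-3,5,6)] assms
  by (simp add: Hom_uminus)

lemma cmp_sum_right:
  assumes "x \<in> Ob C" "y \<in> Ob C" "z \<in> Ob C" "g \<in> Hom C y z" "finite I" "\<And>i. i \<in> I \<Longrightarrow> f i \<in> Hom C x y"
  shows "g \<star> (\<Sum>i\<in>I. f i) = (\<Sum>i\<in>I. g \<star> f i)"
  using assms(5,6)
proof (induction I rule: finite_induct)
  case empty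
  then show ?case using cmp_zero_right[OF assms(1-4)] by simp
next
  case (insert i I)
  have "(\<Sum>i\<in>I. f i) \<in> Hom C x y"
    using vs.subspace_sum[OF Hom_subspace[OF assms(1,2)], of I f] insert.prems by simp
  then show ?case using insert cmp_add_right[OF assms(1-3) _ _ assms(4)] by simp
qed

lemma zero_obj_iff: "zero_obj C x \<longleftrightarrow> x \<in> Ob C \<and> idm C x = 0"
proof
  assume "zero_obj C x"
  then show "x \<in> Ob C \<and> idm C x = 0" using idm_in_Hom by (fastforce simp: zero_obj_def)
next
  assume x: "x \<in> Ob C \<and> idm C x = 0"
  have "f = 0" if "y \<in> Ob C" "f \<in> Hom C y x" for y f
    using cmp_idm_left[of y x f] cmp_zero_left[of y x x f] x that by simp
  moreover have "f = 0" if "y \<in> Ob C" "f \<in> Hom C x y" for y f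
    using cmp_idm_right[of x y f] cmp_zero_right[of x x y f] x that by simp
  ultimately show "zero_obj C x" unfolding zero_obj_def using x Hom_zero by blast
qed

lemma dim_Hom_biproduct_left:
  assumes bp: "is_biproduct C s a b i j p q" and x: "x \<in> Ob C" and fin: "vs.fin_dim (Hom C s x)"
  shows "vs.dim (Hom C s x) = vs.dim (Hom C a x) + vs.dim (Hom C b x)"
proof -
  note [simp] = bp[unfolded is_biproduct_def] x
  have lin: "vs.linear_on (Hom C s x) (\<lambda>g. g \<star> i)" by (rule linear_on_precomp[of a s x i]) auto
  have im: "(\<lambda>g. g \<star> i) ` Hom C s x = Hom C a x"
  proof (intro equalityI subsetI)
    fix f assume f: "f \<in> Hom C a x"
    have "(f \<star> p) \<star> i = f" using cmp_assoc[of a s a x i p f] cmp_idm_right[of a x f] f by simp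
    then show "f \<in> (\<lambda>g. g \<star> i) ` Hom C s x" using f cmp_in_Hom[of s a x p f] by force
  qed (auto intro: cmp_in_Hom[of a s x])
  have ker: "{g\<in>Hom C s x. g \<star> i = 0} = (\<lambda>f. f \<star> q) ` Hom C b x"
  proof (intro equalityI subsetI)
    fix g assume g: "g \<in> {g\<in>Hom C s x. g \<star> i = 0}"
    have "g = g \<star> (i \<star> p + j \<star> q)" using g cmp_idm_right[of s x g] by simp
    also have "\<dots> = g \<star> (i \<star> p) + g \<star> (j \<star> q)"
      using g by (intro cmp_add_right[of s s x]) (auto intro: cmp_in_Hom[of s a s] cmp_in_Hom[of s b s])
    also have "\<dots> = (g \<star> j) \<star> q"
      using g cmp_assoc[of s a s x p i g] cmp_assoc[of s b s x q j g] cmp_zero_left[of s a x p] by simp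
    finally have "g = (g \<star> j) \<star> q" .
    then show "g \<in> (\<lambda>f. f \<star> q) ` Hom C b x"
      by (rule image_eqI) (use g cmp_in_Hom[of b s x j g] in simp)
  next
    fix g assume "g \<in> (\<lambda>f. f \<star> q) ` Hom C b x"
    then obtain f where f: "f \<in> Hom C b x" "g = f \<star> q" by blast
    then show "g \<in> {g\<in>Hom C s x. g \<star> i = 0}"
      using cmp_assoc[of a s b x i q f] cmp_zero_right[of a b x f] cmp_in_Hom[of s b x q f] by simp
  qed
  have "vs.dim (Hom C b x) = vs.dim ((\<lambda>f. f \<star> q) ` Hom C b x)"
  proof (rule vs.dim_image_inj[symmetric])
    have eq: "Hom C b x = (\<lambda>g. g \<star> j) ` Hom C s x"
    proof (intro equalityI subsetI)
      fix f assume f: "f \<in> Hom C b x"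
      have "(f \<star> q) \<star> j = f" using cmp_assoc[of b s b x j q f] cmp_idm_right[of b x f] f by simp
      then show "f \<in> (\<lambda>g. g \<star> j) ` Hom C s x" using f cmp_in_Hom[of s b x q f] by force
    qed (auto intro: cmp_in_Hom[of b s x])
    show "vs.fin_dim (Hom C b x)"
      unfolding eq by (rule vs.rank_nullity(3)[OF fin linear_on_precomp[of b s x j]]) auto
    show "vs.linear_on (Hom C b x) (\<lambda>f. f \<star> q)" by (rule linear_on_precomp[of s b x q]) auto
    fix f assume f: "f \<in> Hom C b x" "f \<star> q = 0"
    then show "f = 0"
      using cmp_assoc[of b s b x j q f] cmp_idm_right[of b x f] cmp_zero_left[of b s x j] by simp
  qed
  then show ?thesis using vs.rank_nullity(1)[OF fin lin] im ker by simp
qed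

text \<open>Subfunctors of \<open>Hom(u, -)\<close>.  The examples that matter are \<open>Hom(u, -)\<close> itself and the morphisms
  that factor through a class of objects; dimensions of both are additive.\<close>

definition Hom_subfunctor :: "'o \<Rightarrow> ('o \<Rightarrow> 'm set) \<Rightarrow> bool" where
  "Hom_subfunctor u I \<longleftrightarrow> (\<forall>x\<in>Ob C. vs.subspace (I x) \<and> I x \<subseteq> Hom C u x) \<and>
     (\<forall>x\<in>Ob C. \<forall>y\<in>Ob C. \<forall>f\<in>I x. \<forall>g\<in>Hom C x y. g \<star> f \<in> I y)"

lemma dim_subfunctor_biproduct:
  assumes bp: "is_biproduct C s a b i j p q" and u: "u \<in> Ob C" and I: "Hom_subfunctor u I"
    and fin: "vs.fin_dim (I s)"
  shows "vs.dim (I s) = vs.dim (I a) + vs.dim (I b)"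
proof -
  note [simp] = bp[unfolded is_biproduct_def] u
  have I_Hom: "f \<in> Hom C u x" if "f \<in> I x" "x \<in> Ob C" for f x
    using I that unfolding Hom_subfunctor_def by blast
  have I_cmp: "g \<star> f \<in> I y" if "x \<in> Ob C" "y \<in> Ob C" "f \<in> I x" "g \<in> Hom C x y" for x y f g
    using I that unfolding Hom_subfunctor_def by blast
  have lin: "vs.linear_on (I x) (\<lambda>f. g \<star> f)" if "x \<in> Ob C" "y \<in> Ob C" "g \<in> Hom C x y" for x y g
    by (rule vs.linear_on_subset[OF linear_on_postcomp[of u x y g]]) (use that I_Hom in auto)
  have im: "(\<lambda>f. p \<star> f) ` I s = I a"
  proof (intro equalityI subsetI)
    fix f assume f: "f \<in> I a"
    have "p \<star> (i \<star> f) = f"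
      using cmp_assoc[of u a s a f i p] cmp_idm_left[of u a f] f I_Hom[of f a] by simp
    then show "f \<in> (\<lambda>f. p \<star> f) ` I s" using f I_cmp[of a s f i] by force
  qed (auto intro: I_cmp[of s])
  have ker: "{f\<in>I s. p \<star> f = 0} = (\<lambda>f. j \<star> f) ` I b"
  proof (intro equalityI subsetI)
    fix f assume f: "f \<in> {f\<in>I s. p \<star> f = 0}"
    then have fH: "f \<in> Hom C u s" using I_Hom[of f s] by simp
    have "f = (i \<star> p + j \<star> q) \<star> f" using fH cmp_idm_left[of u s f] by simp
    also have "\<dots> = (i \<star> p) \<star> f + (j \<star> q) \<star> f"
      using fH by (intro cmp_add_left[of u s s]) (auto intro: cmp_in_Hom[of s a s] cmp_in_Hom[of s b s])
    also have "\<dots> = j \<star> (q \<star> f)"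
      using f fH cmp_assoc[of u s a s f p i] cmp_assoc[of u s b s f q j] cmp_zero_right[of u a s i] by simp
    finally have "f = j \<star> (q \<star> f)" .
    then show "f \<in> (\<lambda>f. j \<star> f) ` I b"
      by (rule image_eqI) (use f I_cmp[of s b f q] in simp)
  next
    fix f assume "f \<in> (\<lambda>f. j \<star> f) ` I b"
    then obtain g where g: "g \<in> I b" "f = j \<star> g" by blast
    then show "f \<in> {f\<in>I s. p \<star> f = 0}"
      using cmp_assoc[of u b s a g j p] cmp_zero_left[of u b a g] I_Hom[of g b] I_cmp[of b s g j] by simp
  qed
  have inj: "vs.dim ((\<lambda>f. j \<star> f) ` I b) = vs.dim (I b)"
  proof (rule vs.dim_image_inj)
    have eq: "I b = (\<lambda>f. q \<star> f) ` I s"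
    proof (intro equalityI subsetI)
      fix f assume f: "f \<in> I b"
      have "q \<star> (j \<star> f) = f"
        using cmp_assoc[of u b s b f j q] cmp_idm_left[of u b f] f I_Hom[of f b] by simp
      then show "f \<in> (\<lambda>f. q \<star> f) ` I s" using f I_cmp[of b s f j] by force
    qed (auto intro: I_cmp[of s])
    show "vs.fin_dim (I b)"
      unfolding eq by (rule vs.rank_nullity(3)[OF fin lin[of s b]]) auto
    show "vs.linear_on (I b) (\<lambda>f. j \<star> f)" by (rule lin[of b s]) auto
    fix f assume f: "f \<in> I b" "j \<star> f = 0"
    then show "f = 0"
      using cmp_assoc[of u b s b f j q] cmp_idm_left[of u b f] cmp_zero_right[of u s b q] I_Hom[of f b] by simp
  qed
  show ?thesis using vs.rank_nullity(1)[OF fin lin[of s a p]] im ker inj by simp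
qed

definition End_unit :: "'o \<Rightarrow> 'm \<Rightarrow> bool" where
  "End_unit c f \<longleftrightarrow> f \<in> Hom C c c \<and> (\<exists>g\<in>Hom C c c. g \<star> f = idm C c \<and> f \<star> g = idm C c)"

lemma End_unitI:
  assumes "c \<in> Ob C" "f \<in> Hom C c c" "g \<in> Hom C c c" "h \<in> Hom C c c"
    and "g \<star> f = idm C c" "f \<star> h = idm C c"
  shows "End_unit c f"
proof -
  have "g = h"
    using cmp_assoc[of c c c c h f g] cmp_idm_left[of c c h] cmp_idm_right[of c c g] assms by simp
  then show ?thesis unfolding End_unit_def using assms by blast
qed

lemma End_unit_cancel_right:
  assumes c: "c \<in> Ob C" and f: "f \<in> Hom C c c" and g: "End_unit c g" and fg: "End_unit c (f \<star> g)"
  shows "End_unit c f"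
proof -
  obtain g' where g': "g' \<in> Hom C c c" "g' \<star> g = idm C c" "g \<star> g' = idm C c"
    using g by (auto simp: End_unit_def)
  obtain k where k: "k \<in> Hom C c c" "k \<star> (f \<star> g) = idm C c" "(f \<star> g) \<star> k = idm C c"
    using fg by (auto simp: End_unit_def)
  have gH: "g \<in> Hom C c c" using g by (simp add: End_unit_def)
  note H = c f g' k gH cmp_in_Hom[of c c c]
  have 1: "f \<star> (g \<star> k) = idm C c" using cmp_assoc[of c c c c k g f] H by simp
  have "(g \<star> k) \<star> f = (g \<star> k) \<star> (f \<star> (g \<star> g'))" using H cmp_idm_right[of c c f] by simp
  also have "\<dots> = (g \<star> k) \<star> ((f \<star> g) \<star> g')" using cmp_assoc[of c c c c g' g f] H by simp
  also have "\<dots> = g \<star> (k \<star> ((f \<star> g) \<star> g'))" using H by (intro cmp_assoc[of c c c c]) auto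
  also have "k \<star> ((f \<star> g) \<star> g') = (k \<star> (f \<star> g)) \<star> g'"
    using H by (intro cmp_assoc[of c c c c, symmetric]) auto
  also have "\<dots> = g'" using H cmp_idm_left[of c c g'] by simp
  finally have "(g \<star> k) \<star> f = idm C c" using H by simp
  then show ?thesis using 1 H by (intro End_unitI[of c f "g \<star> k" "g \<star> k"]) auto
qed

primrec End_pow :: "'o \<Rightarrow> 'm \<Rightarrow> nat \<Rightarrow> 'm" where
  "End_pow c f 0 = idm C c"
| "End_pow c f (Suc n) = f \<star> End_pow c f n"

context
  fixes c f assumes c: "c \<in> Ob C" and f: "f \<in> Hom C c c"
begin

lemma End_pow_Hom: "End_pow c f n \<in> Hom C c c"
  by (induction n) (use c f in \<open>auto intro: idm_in_Hom cmp_in_Hom[of c c c]\<close>)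

lemma End_pow_add: "End_pow c f (m + n) = End_pow c f m \<star> End_pow c f n"
  by (induction m)
    (use c f End_pow_Hom cmp_assoc[of c c c c] cmp_idm_left[of c c] in simp_all)

lemma End_pow_Suc_right: "End_pow c f (Suc n) = End_pow c f n \<star> f"
  using End_pow_add[of n 1] cmp_idm_right[of c c f] c f by simp

text \<open>The inverse is the geometric series in \<open>f\<close>.\<close>

lemma End_unit_of_nilpotent:
  assumes "End_pow c f n = 0" shows "End_unit c (idm C c - f)"
proof -
  have "\<exists>s\<in>Hom C c c. s \<star> (idm C c - f) = idm C c - End_pow c f n \<and>
      (idm C c - f) \<star> s = idm C c - End_pow c f n" for n
  proof (induction n)
    case 0
    have "idm C c - f \<in> Hom C c c" using c f by (auto intro: Hom_closed)
    then show ?case using c f cmp_zero_left[of c c c] cmp_zero_right[of c c c] Hom_zero[of c c]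
      by (intro bexI[of _ 0]) auto
  next
    case (Suc n)
    then obtain s where s: "s \<in> Hom C c c" "s \<star> (idm C c - f) = idm C c - End_pow c f n"
      "(idm C c - f) \<star> s = idm C c - End_pow c f n" by blast
    let ?P = "End_pow c f n"
    have P: "?P \<in> Hom C c c" by (rule End_pow_Hom)
    have d: "idm C c - f \<in> Hom C c c" using c f by (auto intro: Hom_closed)
    have "(s + ?P) \<star> (idm C c - f) = s \<star> (idm C c - f) + (?P - ?P \<star> f)"
      using cmp_add_left[of c c c "idm C c - f" s ?P] cmp_diff_right[of c c c "idm C c" f ?P]
        cmp_idm_right[of c c ?P] c f s P d idm_in_Hom by simp
    moreover have "(idm C c - f) \<star> (s + ?P) = (idm C c - f) \<star> s + (?P - f \<star> ?P)"
      using cmp_add_right[of c c c s ?P "idm C c - f"] cmp_diff_left[of c c c ?P "idm C c" f]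
        cmp_idm_left[of c c ?P] c f s P d idm_in_Hom by simp
    ultimately show ?case using s P c End_pow_Suc_right[of n]
      by (intro bexI[of _ "s + ?P"]) (auto intro: Hom_closed)
  qed
  from this[of n] show ?thesis using assms c f by (auto simp: End_unit_def intro: Hom_closed)
qed

text \<open>Fitting's lemma in ring-theoretic form: left multiplication by a high power \<open>h\<close> of \<open>f\<close> has the
  same rank as left multiplication by \<open>h\<^sup>2\<close>, so both the images and the kernels coincide.  The
  first gives \<open>x\<close> with \<open>h = h\<^sup>2 x\<close>, the second turns this into \<open>h = h x h\<close>.\<close>

lemma power_von_Neumann_regular:
  assumes fin: "vs.fin_dim (Hom C c c)"
  obtains n x where "n > 0" "x \<in> Hom C c c" "End_pow c f n = End_pow c f n \<star> x \<star> End_pow c f n"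
proof -
  define im where "im n = (\<lambda>a. End_pow c f n \<star> a) ` Hom C c c" for n
  have lin: "vs.linear_on (Hom C c c) (\<lambda>a. End_pow c f n \<star> a)" for n
    using linear_on_postcomp[of c c c] c End_pow_Hom by blast
  have fin_im: "vs.fin_dim (im n)" for n unfolding im_def by (rule vs.rank_nullity(3)[OF fin lin])
  have anti: "im (m + n) \<subseteq> im m" for m n
    unfolding im_def End_pow_add using cmp_assoc[of c c c c] End_pow_Hom c cmp_in_Hom[of c c c] by force
  obtain N where N: "\<And>m. vs.dim (im N) \<le> vs.dim (im m)"
    using ex_has_least_nat[of "\<lambda>_. True" 0 "\<lambda>n. vs.dim (im n)"] by auto
  define n where "n = Suc N"
  have eqN: "im (N + m) = im N" for m
    by (rule vs.fin_dim_eqI[OF fin_im]) (use anti N vs.fin_dim_subspace[OF fin_im] in auto)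
  have eq: "im (n + n) = im n" using eqN[of 1] eqN[of "n + 1"] by (simp add: n_def)
  let ?h = "End_pow c f n"
  have h: "?h \<in> Hom C c c" "?h \<star> ?h \<in> Hom C c c" using End_pow_Hom c cmp_in_Hom[of c c c] by auto
  have "?h \<star> idm C c \<in> im n" using c idm_in_Hom unfolding im_def by blast
  then have "?h \<in> im (n + n)" using eq h c cmp_idm_right[of c c ?h] by simp
  then obtain x where x: "x \<in> Hom C c c" "?h = (?h \<star> ?h) \<star> x" by (auto simp: im_def End_pow_add)
  have "{a\<in>Hom C c c. ?h \<star> a = 0} = {a\<in>Hom C c c. (?h \<star> ?h) \<star> a = 0}" (is "?K = ?K2")
  proof (rule vs.fin_dim_eqI)
    show "vs.fin_dim ?K2" "vs.subspace ?K"
      using vs.rank_nullity(2)[OF fin lin[of "n + n"]] vs.rank_nullity(2)[OF fin lin[of n]]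
      by (auto simp: End_pow_add intro: vs.fin_dim_subspace)
    show "?K \<subseteq> ?K2" using cmp_assoc[of c c c c] h c cmp_zero_right[of c c c ?h] by auto
    show "vs.dim ?K2 \<le> vs.dim ?K"
      using vs.rank_nullity(1)[OF fin lin[of "n + n"]] vs.rank_nullity(1)[OF fin lin[of n]] eq
      unfolding im_def[symmetric] by (simp add: End_pow_add)
  qed
  moreover have "x \<star> ?h - idm C c \<in> ?K2"
  proof -
    have xh: "x \<star> ?h \<in> Hom C c c" using x h c cmp_in_Hom[of c c c] by blast
    have "(?h \<star> ?h) \<star> (x \<star> ?h) = ?h \<star> ?h"
      using cmp_assoc[of c c c c ?h x "?h \<star> ?h"] x h c by simp
    then show ?thesis
      using cmp_diff_right[of c c c "x \<star> ?h" "idm C c" "?h \<star> ?h"] xh h c idm_in_Hom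
        cmp_idm_right[of c c "?h \<star> ?h"] Hom_diff[of c c] by simp
  qed
  ultimately have "?h \<star> (x \<star> ?h - idm C c) = 0" by blast
  then have "?h \<star> (x \<star> ?h) = ?h"
    using cmp_diff_right[of c c c "x \<star> ?h" "idm C c" ?h] h c x idm_in_Hom cmp_in_Hom[of c c c]
      cmp_idm_right[of c c ?h] by simp
  then have "?h = ?h \<star> x \<star> ?h" using cmp_assoc[of c c c c ?h x ?h] h x c by simp
  then show ?thesis using that[of n x] x by (simp add: n_def)
qed

end

end

section \<open>Krull-Schmidt categories\<close>

locale krull_schmidt_category = additive_linear_category C
  for C :: "('k::field, 'o, 'm::ab_group_add, 'z) lincat_scheme" (structure) +
  assumes Hom_finite: "hom_finite C" and idem_split: "idempotents_split C"
begin

lemma fin_dim_Hom: "x \<in> Ob C \<Longrightarrow> y \<in> Ob C \<Longrightarrow> vs.fin_dim (Hom C x y)"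
  using Hom_finite unfolding hom_finite_def vs.fin_dim_def by blast

text \<open>The complement of a retract splits off with the complementary idempotent.\<close>

lemma retract_biproduct:
  assumes "x \<in> Ob C" "a \<in> Ob C" "f \<in> Hom C a x" "g \<in> Hom C x a" "g \<star> f = idm C a"
  obtains b j q where "is_biproduct C x a b f j g q"
proof -
  note [simp] = assms
  define e where "e = idm C x - f \<star> g"
  have fg: "f \<star> g \<in> Hom C x x" using cmp_in_Hom[of x a x] by simp
  have e[simp]: "e \<in> Hom C x x" using fg Hom_diff idm_in_Hom by (simp add: e_def)
  have ef: "e \<star> f = 0"
    using cmp_diff_left[of a x x f "idm C x" "f \<star> g"] fg idm_in_Hom cmp_assoc[of a x a x f g f]
      cmp_idm_left[of a x f] cmp_idm_right[of a x f] by (simp add: e_def)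
  have ge: "g \<star> e = 0"
    using cmp_diff_right[of x x a "idm C x" "f \<star> g" g] fg idm_in_Hom cmp_assoc[of x a x a g f g]
      cmp_idm_left[of x a g] cmp_idm_right[of x a g] by (simp add: e_def)
  have "e \<star> e = (idm C x - f \<star> g) \<star> e" by (simp add: e_def)
  also have "\<dots> = e"
    using cmp_diff_left[of x x x e "idm C x" "f \<star> g"] fg idm_in_Hom cmp_assoc[of x x a x e g f]
      cmp_idm_left[of x x e] ge cmp_zero_right[of x a x f] by simp
  finally have "e \<star> e = e" .
  then obtain b r s where b[simp]: "b \<in> Ob C" "r \<in> Hom C x b" "s \<in> Hom C b x"
    and sr: "s \<star> r = e" and rs: "r \<star> s = idm C b"
    using idem_split e unfolding idempotents_split_def by (metis assms(1))
  have "r \<star> f = (r \<star> s) \<star> (r \<star> f)"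
    using rs cmp_idm_left[of a b "r \<star> f"] cmp_in_Hom[of a x b f r] by simp
  also have "\<dots> = r \<star> ((s \<star> r) \<star> f)"
    using cmp_assoc[of a b x b "r \<star> f" s r] cmp_assoc[of a x b x f r s] cmp_in_Hom[of a x b f r] by simp
  finally have rf: "r \<star> f = 0" using sr ef cmp_zero_right[of a x b r] by simp
  have "g \<star> s = (g \<star> s) \<star> (r \<star> s)"
    using rs cmp_idm_right[of b a "g \<star> s"] cmp_in_Hom[of b x a s g] by simp
  also have "\<dots> = (g \<star> (s \<star> r)) \<star> s"
    using cmp_assoc[of b x b a s r "g \<star> s"] cmp_assoc[of x b x a r s g] cmp_in_Hom[of b x a s g] by simp
  finally have gs: "g \<star> s = 0" using sr ge cmp_zero_left[of b x a s] by simp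
  have "is_biproduct C x a b f s g r"
    unfolding is_biproduct_def using rf gs rs sr by (simp add: e_def)
  then show ?thesis by (rule that)
qed

lemma indecomposable_retract_iso:
  assumes "c \<in> Ob C" "\<not> zero_obj C c" "indecomposable C c'"
    and f: "f \<in> Hom C c c'" and g: "g \<in> Hom C c' c" and gf: "g \<star> f = idm C c"
  shows "isomorphic_obj C c c'"
proof -
  have c': "c' \<in> Ob C" using assms by (simp add: indecomposable_def)
  obtain b j q where bp: "is_biproduct C c' c b f j g q"
    using retract_biproduct[OF c' assms(1) f g gf] by blast
  then have "zero_obj C b" using assms(2,3) unfolding indecomposable_def is_direct_sum_def by blast
  then have "j = 0" using bp by (auto simp: zero_obj_def is_biproduct_def)
  then have "f \<star> g = idm C c'" using bp cmp_zero_left[of c' b c' q] by (simp add: is_biproduct_def)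
  then show ?thesis unfolding isomorphic_obj_def using assms c' by blast
qed

lemma indecomposable_idempotent:
  assumes c: "indecomposable C c" and e: "e \<in> Hom C c c" "e \<star> e = e"
  shows "e = 0 \<or> e = idm C c"
proof -
  have cO: "c \<in> Ob C" using c by (simp add: indecomposable_def)
  obtain a r s where a: "a \<in> Ob C" "r \<in> Hom C c a" "s \<in> Hom C a c"
    and sr: "s \<star> r = e" and rs: "r \<star> s = idm C a"
    using idem_split e cO unfolding idempotents_split_def by metis
  obtain b j q where bp: "is_biproduct C c a b s j r q"
    using retract_biproduct[OF cO a(1,3,2) rs] by blast
  then have "zero_obj C a \<or> zero_obj C b"
    using c unfolding indecomposable_def is_direct_sum_def by blast
  then show ?thesis
  proof
    assume "zero_obj C a"
    then have "s = 0" using a cO by (auto simp: zero_obj_def)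
    then show ?thesis using sr cmp_zero_left[of c a c r] a cO by simp
  next
    assume "zero_obj C b"
    then have "j = 0" using bp by (auto simp: zero_obj_def is_biproduct_def)
    then show ?thesis using bp sr cmp_zero_left[of c b c q] by (simp add: is_biproduct_def)
  qed
qed

text \<open>If \<open>h = h x h\<close> for a power \<open>h\<close> of \<open>f\<close>, then \<open>h x\<close> and \<open>x h\<close> are idempotents, hence \<open>0\<close> or the identity;
  so \<open>h\<close> is zero or invertible.\<close>

lemma indecomposable_local:
  assumes c: "indecomposable C c" and f: "f \<in> Hom C c c"
  shows "End_unit c f \<or> End_unit c (idm C c - f)"
proof -
  have cO: "c \<in> Ob C" and nz: "idm C c \<noteq> 0" using c zero_obj_iff by (auto simp: indecomposable_def)
  obtain n x where n: "n > 0" and x: "x \<in> Hom C c c"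
    and reg: "End_pow c f n = End_pow c f n \<star> x \<star> End_pow c f n"
    using power_von_Neumann_regular[OF cO f fin_dim_Hom[OF cO cO]] by blast
  define h where "h = End_pow c f n"
  have h: "h \<in> Hom C c c" unfolding h_def by (rule End_pow_Hom[OF cO f])
  have hxh: "h \<star> x \<star> h = h" using reg by (simp add: h_def)
  have hx: "h \<star> x \<in> Hom C c c" and xh: "x \<star> h \<in> Hom C c c" using cmp_in_Hom[of c c c] cO h x by auto
  have "(h \<star> x) \<star> (h \<star> x) = h \<star> x"
    using cmp_assoc[of c c c c x h "h \<star> x"] hxh cO h x hx by simp
  then have 1: "h \<star> x = 0 \<or> h \<star> x = idm C c" using indecomposable_idempotent[OF c hx] by simp
  have "(x \<star> h) \<star> (x \<star> h) = x \<star> h"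
    using cmp_assoc[of c c c c "x \<star> h" h x] cmp_assoc[of c c c c h x h] hxh cO h x xh by simp
  then have 2: "x \<star> h = 0 \<or> x \<star> h = idm C c" using indecomposable_idempotent[OF c xh] by simp
  show ?thesis
  proof (cases "h = 0")
    case True
    then show ?thesis using End_unit_of_nilpotent[OF cO f] by (simp add: h_def)
  next
    case False
    have "h \<star> (x \<star> h) = h" using hxh cmp_assoc[of c c c c h x h] cO h x by simp
    then have hx1: "h \<star> x = idm C c" and xh1: "x \<star> h = idm C c"
      using 1 2 False hxh cmp_zero_left[of c c c h] cmp_zero_right[of c c c h] cO h by auto
    obtain m where m: "n = Suc m" using n by (cases n) auto
    let ?p = "End_pow c f m"
    have p: "?p \<in> Hom C c c" by (rule End_pow_Hom[OF cO f])
    have "f \<star> (?p \<star> x) = idm C c"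
      using hx1 cmp_assoc[of c c c c x ?p f] cO f p x by (simp add: h_def m)
    moreover have "h = ?p \<star> f" unfolding h_def m by (rule End_pow_Suc_right[OF cO f])
    then have "(x \<star> ?p) \<star> f = idm C c"
      using xh1 cmp_assoc[of c c c c f ?p x] cO f p x by simp
    ultimately have "End_unit c f"
      using cmp_in_Hom[of c c c] cO f p x by (intro End_unitI[of c f "x \<star> ?p" "?p \<star> x"]) auto
    then show ?thesis ..
  qed
qed

lemma indecomposable_unit_sum:
  assumes c: "indecomposable C c" and f: "f \<in> Hom C c c" and g: "g \<in> Hom C c c"
    and u: "End_unit c (f + g)"
  shows "End_unit c f \<or> End_unit c g"
proof -
  have cO: "c \<in> Ob C" using c by (simp add: indecomposable_def)
  obtain k where k: "k \<in> Hom C c c" "k \<star> (f + g) = idm C c" "(f + g) \<star> k = idm C c"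
    using u by (auto simp: End_unit_def)
  have ku: "End_unit c k"
    unfolding End_unit_def using k f g Hom_add[OF cO cO f g] by auto
  have H: "f \<star> k \<in> Hom C c c" "g \<star> k \<in> Hom C c c" using cmp_in_Hom[of c c c] cO k f g by auto
  have "idm C c - f \<star> k = g \<star> k"
    using k cmp_add_left[of c c c k f g] cO f g by (simp add: algebra_simps)
  then have "End_unit c (f \<star> k) \<or> End_unit c (g \<star> k)" using indecomposable_local[OF c H(1)] by simp
  then show ?thesis using End_unit_cancel_right[OF cO _ ku] f g by blast
qed

text \<open>The endomorphisms of \<open>a\<close> embed into those of \<open>x\<close> by \<open>u \<mapsto> i u p\<close>, and the identity of \<open>x\<close> is missed
  when \<open>b\<close> is nonzero.  This makes the dimension of the endomorphism ring a measure for decomposing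
  objects.\<close>

lemma dim_End_summand:
  assumes bp: "is_biproduct C x a b i j p q" and b: "\<not> zero_obj C b"
  shows "vs.dim (Hom C a a) < vs.dim (Hom C x x)"
proof -
  note [simp] = bp[unfolded is_biproduct_def]
  define W where "W = (\<lambda>u. i \<star> (u \<star> p)) ` Hom C a a"
  have up: "u \<star> p \<in> Hom C x a" if "u \<in> Hom C a a" for u using cmp_in_Hom[of x a a p u] that by simp
  have lin: "vs.linear_on (Hom C a a) (\<lambda>u. i \<star> (u \<star> p))"
    unfolding vs.linear_on_def
  proof (intro conjI ballI allI)
    fix u v assume "u \<in> Hom C a a" "v \<in> Hom C a a"
    then show "i \<star> ((u + v) \<star> p) = i \<star> (u \<star> p) + i \<star> (v \<star> p)"
      using cmp_add_left[of x a a p u v] cmp_add_right[of x a x "u \<star> p" "v \<star> p" i] up by simp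
  next
    fix k u assume "u \<in> Hom C a a"
    then show "i \<star> (scl C k u \<star> p) = scl C k (i \<star> (u \<star> p))"
      using cmp_scl_left[of x a a p u k] cmp_scl_right[of x a x "u \<star> p" i k] up by simp
  qed
  have inj: "u = 0" if u: "u \<in> Hom C a a" "i \<star> (u \<star> p) = 0" for u
  proof -
    have "u \<star> p = p \<star> (i \<star> (u \<star> p))"
      using cmp_assoc[of x a x a "u \<star> p" i p] cmp_idm_left[of x a "u \<star> p"] up[OF u(1)] by simp
    then have "u \<star> p = 0" using u cmp_zero_right[of x x a p] by simp
    then show "u = 0"
      using cmp_assoc[of a x a a i p u] cmp_idm_right[of a a u] u cmp_zero_left[of a x a i] by simp
  qed
  have WH: "W \<subseteq> Hom C x x" unfolding W_def using cmp_in_Hom[of x a x] up by auto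
  have dimW: "vs.dim W = vs.dim (Hom C a a)"
    unfolding W_def by (rule vs.dim_image_inj[OF fin_dim_Hom lin inj]) auto
  have sub: "vs.subspace W"
    unfolding W_def by (rule vs.fin_dim_subspace[OF vs.rank_nullity(3)[OF fin_dim_Hom lin]]) auto
  have "idm C x \<notin> W"
  proof
    assume "idm C x \<in> W"
    then obtain u where u: "u \<in> Hom C a a" "idm C x = i \<star> (u \<star> p)" by (auto simp: W_def)
    have upj: "(u \<star> p) \<star> j = 0"
      using cmp_assoc[of b x a a j p u] cmp_zero_right[of b a a u] u by simp
    have "idm C b = q \<star> (idm C x \<star> j)" using cmp_idm_left[of b x j] by simp
    also have "idm C x \<star> j = 0"
      using u(2) cmp_assoc[of b x a x j "u \<star> p" i] up[OF u(1)] upj cmp_zero_right[of b a x i] by simp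
    finally have "idm C b = 0" using cmp_zero_right[of b x b q] by simp
    then show False using b zero_obj_iff by simp
  qed
  then have "W \<noteq> Hom C x x" using idm_in_Hom by auto
  then show ?thesis
    using vs.fin_dim_eqI[OF fin_dim_Hom sub WH] vs.dim_mono_fin_dim[OF fin_dim_Hom sub WH] dimW
    by (simp add: less_le not_le) force
qed

lemma is_biproduct_swap: "is_biproduct C s a b i j p q \<Longrightarrow> is_biproduct C s b a j i q p"
  unfolding is_biproduct_def by (simp add: add.commute)

text \<open>Splitting an object into two nonzero parts gives both of them smaller endomorphism rings.\<close>

lemma indecomposable_decomposition_induct [consumes 1, case_names zero indecomposable sum]:
  assumes x: "x \<in> Ob C"
    and "\<And>z. zero_obj C z \<Longrightarrow> P z" and "\<And>c. indecomposable C c \<Longrightarrow> P c"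
    and "\<And>s a b. is_direct_sum C s a b \<Longrightarrow> P a \<Longrightarrow> P b \<Longrightarrow> P s"
  shows "P x"
  using x
proof (induction "vs.dim (Hom C x x)" arbitrary: x rule: less_induct)
  case less
  show ?case
  proof (cases "zero_obj C x \<or> indecomposable C x")
    case False
    then obtain a b where ab: "is_direct_sum C x a b" "\<not> zero_obj C a" "\<not> zero_obj C b"
      using less.prems by (auto simp: indecomposable_def)
    then obtain i j p q where bp: "is_biproduct C x a b i j p q" by (auto simp: is_direct_sum_def)
    have "P a" using less.hyps[OF dim_End_summand[OF bp ab(3)]] bp by (auto simp: is_biproduct_def)
    moreover have "P b"
      using less.hyps[OF dim_End_summand[OF is_biproduct_swap[OF bp] ab(2)]] bp
      by (auto simp: is_biproduct_def)
    ultimately show ?thesis using assms(4) ab(1) by blast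
  qed (use assms in blast)
qed

text \<open>Direct sums of copies of members of \<open>A\<close>, without their summands: this lets a local
  endomorphism ring be tested against one member of \<open>A\<close> at a time.\<close>

inductive_set finite_sums :: "'o set \<Rightarrow> 'o set" for A where
  zero: "zero_obj C z \<Longrightarrow> z \<in> finite_sums A"
| insert: "a \<in> A \<Longrightarrow> q \<in> finite_sums A \<Longrightarrow> is_direct_sum C s a q \<Longrightarrow> s \<in> finite_sums A"

lemma finite_sums_Ob: "s \<in> finite_sums A \<Longrightarrow> s \<in> Ob C"
  by (induction rule: finite_sums.induct) (auto simp: zero_obj_def is_direct_sum_def is_biproduct_def)

lemma unit_through_finite_sums:
  assumes c: "indecomposable C c" and Q: "Q \<in> finite_sums A"
  shows "f \<in> Hom C c Q \<Longrightarrow> g \<in> Hom C Q c \<Longrightarrow> End_unit c (g \<star> f) \<Longrightarrow>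
    \<exists>a\<in>A. \<exists>f'\<in>Hom C c a. \<exists>g'\<in>Hom C a c. g' \<star> f' = idm C c"
  using Q
proof (induction arbitrary: f g rule: finite_sums.induct)
  case (zero z)
  have cO: "c \<in> Ob C" "idm C c \<noteq> 0" using c zero_obj_iff by (auto simp: indecomposable_def)
  have "g = 0" using zero cO by (auto simp: zero_obj_def)
  then have "g \<star> f = 0" using zero cO cmp_zero_left[of c z c f] by (auto simp: zero_obj_def)
  then show ?case using zero(4) cO cmp_zero_right[of c c c] by (auto simp: End_unit_def)
next
  case (insert a q s)
  have cO[simp]: "c \<in> Ob C" using c by (simp add: indecomposable_def)
  obtain i j p r where bp: "is_biproduct C s a q i j p r" using insert by (auto simp: is_direct_sum_def)
  note [simp] = bp[unfolded is_biproduct_def] insert.prems(1,2)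
  have H[simp]: "i \<star> p \<in> Hom C s s" "j \<star> r \<in> Hom C s s" "p \<star> f \<in> Hom C c a" "r \<star> f \<in> Hom C c q"
    "g \<star> i \<in> Hom C a c" "g \<star> j \<in> Hom C q c"
    using cmp_in_Hom[of s a s p i] cmp_in_Hom[of s q s r j] cmp_in_Hom[of c s a f p]
      cmp_in_Hom[of c s q f r] cmp_in_Hom[of a s c i g] cmp_in_Hom[of q s c j g] by simp_all
  have "f = (i \<star> p + j \<star> r) \<star> f" using cmp_idm_left[of c s f] by simp
  also have "\<dots> = i \<star> (p \<star> f) + j \<star> (r \<star> f)"
    using cmp_add_left[of c s s f "i \<star> p" "j \<star> r"] cmp_assoc[of c s a s f p i] cmp_assoc[of c s q s f r j]
    by simp
  finally have "g \<star> f = g \<star> (i \<star> (p \<star> f) + j \<star> (r \<star> f))" by simp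
  also have "\<dots> = (g \<star> i) \<star> (p \<star> f) + (g \<star> j) \<star> (r \<star> f)"
    using cmp_add_right[of c s c "i \<star> (p \<star> f)" "j \<star> (r \<star> f)" g] cmp_in_Hom[of c a s "p \<star> f" i]
      cmp_in_Hom[of c q s "r \<star> f" j] cmp_assoc[of c a s c "p \<star> f" i g] cmp_assoc[of c q s c "r \<star> f" j g]
    by simp
  finally have "End_unit c ((g \<star> i) \<star> (p \<star> f)) \<or> End_unit c ((g \<star> j) \<star> (r \<star> f))"
    using indecomposable_unit_sum[OF c, of "(g \<star> i) \<star> (p \<star> f)" "(g \<star> j) \<star> (r \<star> f)"] insert.prems(3)
      cmp_in_Hom[of c a c] cmp_in_Hom[of c q c] by simp
  then show ?case
  proof
    assume "End_unit c ((g \<star> i) \<star> (p \<star> f))"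
    then obtain k where k: "k \<in> Hom C c c" "k \<star> ((g \<star> i) \<star> (p \<star> f)) = idm C c"
      by (auto simp: End_unit_def)
    then have "(k \<star> (g \<star> i)) \<star> (p \<star> f) = idm C c" using cmp_assoc[of c a c c "p \<star> f" "g \<star> i" k] by simp
    moreover have "k \<star> (g \<star> i) \<in> Hom C a c" using cmp_in_Hom[of a c c "g \<star> i" k] k by simp
    ultimately show ?thesis using insert(1) H(3) by blast
  next
    assume "End_unit c ((g \<star> j) \<star> (r \<star> f))"
    then show ?thesis using insert.IH[OF H(4,6)] by blast
  qed
qed

text \<open>Right approximations: finitely many morphisms generate \<open>Hom(a, c)\<close> for the finitely many
  \<open>a\<close> in \<open>A\<close>, and they assemble into one morphism from a direct sum.\<close>

lemma right_approximation:
  assumes A: "finite A" "A \<subseteq> Ob C" and c: "c \<in> Ob C"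
  obtains Q f where "Q \<in> finite_sums A" "f \<in> Hom C Q c"
    "\<And>a h. a \<in> A \<Longrightarrow> h \<in> Hom C a c \<Longrightarrow> \<exists>k\<in>Hom C a Q. h = f \<star> k"
proof -
  have fin: "\<exists>Q\<in>finite_sums A. \<exists>f\<in>Hom C Q c. \<forall>(a, h)\<in>P. \<exists>k\<in>Hom C a Q. h = f \<star> k"
    if "finite P" "\<forall>(a, h)\<in>P. a \<in> A \<and> h \<in> Hom C a c" for P
    using that
  proof (induction P rule: finite_induct)
    case empty
    obtain z where "zero_obj C z" using zero_obj_exists by blast
    then show ?case using c finite_sums.zero[of z A] Hom_zero[of z c] unfolding zero_obj_def by blast
  next
    case (insert x P)
    obtain a h where x: "x = (a, h)" by fastforce
    obtain Q f where Q: "Q \<in> finite_sums A" "f \<in> Hom C Q c" "\<forall>(a, h)\<in>P. \<exists>k\<in>Hom C a Q. h = f \<star> k"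
      using insert by auto
    have a: "a \<in> A" "a \<in> Ob C" "h \<in> Hom C a c" using insert.prems x A by auto
    have QO: "Q \<in> Ob C" using Q(1) by (rule finite_sums_Ob)
    obtain s i j p q where bp: "is_biproduct C s a Q i j p q"
      using direct_sum_exists[OF a(2) QO] by (auto simp: is_direct_sum_def)
    note [simp] = bp[unfolded is_biproduct_def] c a Q(2) QO
    have sA: "s \<in> finite_sums A" using finite_sums.insert[OF a(1) Q(1)] bp
      unfolding is_direct_sum_def by blast
    define f' where "f' = h \<star> p + f \<star> q"
    have H[simp]: "h \<star> p \<in> Hom C s c" "f \<star> q \<in> Hom C s c" "f' \<in> Hom C s c"
      unfolding f'_def using cmp_in_Hom[of s a c p h] cmp_in_Hom[of s Q c q f] Hom_add[of s c] by simp_all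
    have i: "f' \<star> i = h"
      unfolding f'_def using cmp_add_left[of a s c i "h \<star> p" "f \<star> q"] cmp_assoc[of a s a c i p h]
        cmp_assoc[of a s Q c i q f] cmp_idm_right[of a c h] cmp_zero_right[of a Q c f] by simp
    have j: "f' \<star> j = f"
      unfolding f'_def using cmp_add_left[of Q s c j "h \<star> p" "f \<star> q"] cmp_assoc[of Q s a c j p h]
        cmp_assoc[of Q s Q c j q f] cmp_idm_right[of Q c f] cmp_zero_right[of Q a c h] by simp
    have "\<exists>k\<in>Hom C a' s. h' = f' \<star> k" if h': "(a', h') \<in> P" for a' h'
    proof -
      obtain k where k: "k \<in> Hom C a' Q" "h' = f \<star> k" using Q(3) h' by auto
      have a': "a' \<in> Ob C" using insert.prems h' A by auto
      have "h' = f' \<star> (j \<star> k)" using cmp_assoc[of a' Q s c k j f'] j k a' by simp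
      then show ?thesis using cmp_in_Hom[of a' Q s k j] a' k by auto
    qed
    moreover have "\<exists>k\<in>Hom C a s. h = f' \<star> k" using i by force
    ultimately show ?case using sA H(3) x by blast
  qed
  have "\<exists>B. finite B \<and> vs.span B = Hom C a c" if "a \<in> A" for a
    using fin_dim_Hom[of a c] that A c unfolding vs.fin_dim_def by blast
  then obtain B where B: "\<And>a. a \<in> A \<Longrightarrow> finite (B a) \<and> vs.span (B a) = Hom C a c" by metis
  have "finite (Sigma A B)" using A B by blast
  moreover have "\<forall>(a, h)\<in>Sigma A B. a \<in> A \<and> h \<in> Hom C a c" using B vs.span_base by blast
  ultimately obtain Q f where Q: "Q \<in> finite_sums A" "f \<in> Hom C Q c"
    "\<forall>(a, h)\<in>Sigma A B. \<exists>k\<in>Hom C a Q. h = f \<star> k" using fin by meson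
  have "\<exists>k\<in>Hom C a Q. h = f \<star> k" if a: "a \<in> A" and h: "h \<in> Hom C a c" for a h
  proof -
    have aO: "a \<in> Ob C" "Q \<in> Ob C" using a A finite_sums_Ob Q by auto
    have "vs.fin_dim ((\<lambda>k. f \<star> k) ` Hom C a Q)"
      by (rule vs.rank_nullity(3)[OF fin_dim_Hom linear_on_postcomp[of a Q c f]]) (use aO c Q in auto)
    then have "vs.subspace ((\<lambda>k. f \<star> k) ` Hom C a Q)" by (rule vs.fin_dim_subspace)
    moreover have "B a \<subseteq> (\<lambda>k. f \<star> k) ` Hom C a Q" using Q(3) a by auto
    ultimately have "vs.span (B a) \<subseteq> (\<lambda>k. f \<star> k) ` Hom C a Q" by (simp add: vs.span_minimal)
    then show ?thesis using B[OF a] h by auto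
  qed
  then show ?thesis using that Q by blast
qed

end

section \<open>Exactness of angles\<close>

context angulated_category
begin

lemma SigO_Ob: "x \<in> Ob C \<Longrightarrow> SigO C x \<in> Ob C"
  using SigO_bij bij_betw_apply by fastforce

lemma SigM_Hom: "x \<in> Ob C \<Longrightarrow> y \<in> Ob C \<Longrightarrow> f \<in> Hom C x y \<Longrightarrow> SigM C f \<in> Hom C (SigO C x) (SigO C y)"
  using SigM_bij bij_betw_apply by fastforce

lemma SigM_inj:
  "x \<in> Ob C \<Longrightarrow> y \<in> Ob C \<Longrightarrow> f \<in> Hom C x y \<Longrightarrow> g \<in> Hom C x y \<Longrightarrow> SigM C f = SigM C g \<Longrightarrow> f = g"
  using SigM_bij[of x y] by (auto simp: bij_betw_def inj_on_def)

lemma SigM_surj: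
  assumes "x \<in> Ob C" "y \<in> Ob C" "g \<in> Hom C (SigO C x) (SigO C y)"
  obtains f where "f \<in> Hom C x y" "g = SigM C f"
  using SigM_bij[of x y] assms by (auto simp: bij_betw_def)

lemma SigM_zero [simp]: "SigM C 0 = 0"
proof -
  obtain z where "zero_obj C z" using zero_obj_exists by blast
  then have z: "z \<in> Ob C" by (simp add: zero_obj_def)
  show ?thesis using SigM_add[of z z 0 0] Hom_zero[OF z z] z by simp
qed

lemma SigM_uminus:
  assumes "x \<in> Ob C" "y \<in> Ob C" "f \<in> Hom C x y" shows "SigM C (- f) = - SigM C f"
  using SigM_add[OF assms(1,2,3) Hom_uminus[OF assms]] by (simp add: eq_neg_iff_add_eq_0 add.commute)

lemma SigO_inv:
  assumes "x \<in> Ob C" shows "SigO_inv C x \<in> Ob C" "SigO C (SigO_inv C x) = x"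
  using assms SigO_bij unfolding SigO_inv_def
  by (metis bij_betw_imp_surj_on inv_into_into, metis bij_betw_imp_surj_on f_inv_into_f)

text \<open>The sign that a left rotation puts on the new last morphism.\<close>

definition twist :: "'m \<Rightarrow> 'm" where
  "twist f = scl C ((- 1) ^ d) f"

lemma twist_twist [simp]: "twist (twist f) = f"
  unfolding twist_def by (simp flip: power_add)

lemma twist_eq_iff: "twist f = twist g \<longleftrightarrow> f = g"
  by (metis twist_twist)

lemma twist_zero [simp]: "twist 0 = 0"
  by (simp add: twist_def)

lemma twist_Hom: "x \<in> Ob C \<Longrightarrow> y \<in> Ob C \<Longrightarrow> f \<in> Hom C x y \<Longrightarrow> twist f \<in> Hom C x y"
  unfolding twist_def by (rule Hom_scl)

lemma twist_cmp_left:
  "x \<in> Ob C \<Longrightarrow> y \<in> Ob C \<Longrightarrow> z \<in> Ob C \<Longrightarrow> f \<in> Hom C x y \<Longrightarrow> g \<in> Hom C y z \<Longrightarrow> twist g \<star> f = twist (g \<star> f)"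
  unfolding twist_def by (rule cmp_scl_left)

lemma twist_cmp_right:
  "x \<in> Ob C \<Longrightarrow> y \<in> Ob C \<Longrightarrow> z \<in> Ob C \<Longrightarrow> f \<in> Hom C x y \<Longrightarrow> g \<in> Hom C y z \<Longrightarrow> g \<star> twist f = twist (g \<star> f)"
  unfolding twist_def by (rule cmp_scl_right)

lemma SigM_twist: "x \<in> Ob C \<Longrightarrow> y \<in> Ob C \<Longrightarrow> f \<in> Hom C x y \<Longrightarrow> SigM C (twist f) = twist (SigM C f)"
  unfolding twist_def by (cases "even d") (simp_all add: SigM_uminus)

text \<open>Closed form of the \<open>k\<close>-fold left rotation for \<open>k \<le> d + 2\<close>.\<close>

definition rotate_left :: "nat \<Rightarrow> 'o list \<times> 'm list \<Rightarrow> 'o list \<times> 'm list" where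
  "rotate_left k X = (drop k (fst X) @ map (SigO C) (take k (fst X)),
     drop k (snd X) @ map (\<lambda>f. twist (SigM C f)) (take k (snd X)))"

lemma rotate_left_0 [simp]: "rotate_left 0 X = X"
  by (simp add: rotate_left_def)

lemma rotate_left_Suc:
  assumes "k < length (fst X)" "length (snd X) = length (fst X)"
  shows "rotate_left (Suc k) X = left_rotation C d (rotate_left k X)"
proof -
  have [simp]: "drop k (fst X) = fst X ! k # drop (Suc k) (fst X)"
    "drop k (snd X) = snd X ! k # drop (Suc k) (snd X)"
    using assms by (simp_all add: Cons_nth_drop_Suc)
  show ?thesis
    using assms by (simp add: rotate_left_def left_rotation_def twist_def take_Suc_conv_app_nth)
qed

lemma Ang_length: "X \<in> Ang C \<Longrightarrow> length (fst X) = d + 2 \<and> length (snd X) = d + 2"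
  using Ang_sequence unfolding sigma_sequence_def by blast

lemma rotate_left_Ang:
  assumes X: "X \<in> Ang C" and "k \<le> d + 2" shows "rotate_left k X \<in> Ang C"
  using assms(2)
proof (induction k)
  case (Suc k)
  then have "rotate_left k X \<in> Ang C" by simp
  then have "left_rotation C d (rotate_left k X) \<in> Ang C" using N2 Ang_sequence by blast
  then show ?case using rotate_left_Suc[of k X] Ang_length[OF X] Suc.prems by simp
qed (use X in simp)

lemma seq_ob_Sigma: "X \<in> Ang C \<Longrightarrow> seq_ob C X (d + 2) = SigO C (seq_ob C X 0)"
  using Ang_length[of X] by (cases "fst X") (auto simp: seq_ob_def nth_append)

lemma seq_ob_Ob:
  assumes X: "X \<in> Ang C" and "i \<le> d + 2" shows "seq_ob C X i \<in> Ob C"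
proof (cases "i = d + 2")
  case True
  have "set (fst X) \<subseteq> Ob C" using X Ang_sequence unfolding sigma_sequence_def by blast
  then have "hd (fst X) \<in> Ob C" using Ang_length[OF X] by (cases "fst X") auto
  then show ?thesis using True Ang_length[OF X] SigO_Ob by (simp add: seq_ob_def nth_append)
next
  case False
  have "set (fst X) \<subseteq> Ob C" using X Ang_sequence unfolding sigma_sequence_def by blast
  then show ?thesis using False Ang_length[OF X] assms(2) nth_mem[of i "fst X"]
    by (auto simp: seq_ob_def nth_append)
qed

lemma seq_mor_Hom:
  assumes X: "X \<in> Ang C" and "i \<le> d + 1"
  shows "seq_mor C X i \<in> Hom C (seq_ob C X i) (seq_ob C X (Suc i))"
  using X assms(2) Ang_sequence unfolding sigma_sequence_def by blast

lemma rotate_left_ob: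
  assumes X: "X \<in> Ang C" and k: "k \<le> d + 2"
  shows "i + k \<le> d + 2 \<Longrightarrow> i \<le> d + 1 \<Longrightarrow> seq_ob C (rotate_left k X) i = seq_ob C X (i + k)"
    and "i + k < 2 * d + 4 \<Longrightarrow> d + 2 \<le> i + k \<Longrightarrow> i \<le> d + 2 \<Longrightarrow>
      seq_ob C (rotate_left k X) i = SigO C (seq_ob C X (i + k - (d + 2)))"
proof -
  obtain os ms where Xe: "X = (os, ms)" by fastforce
  have len: "length os = d + 2" using Ang_length[OF X] Xe by simp
  have hd: "hd os = os ! 0" using len by (cases os) auto
  have hdk: "hd (drop k os @ map (SigO C) (take k os)) = (if k < d + 2 then os ! k else SigO C (os ! 0))"
  proof (cases "k < d + 2")
    case True
    then show ?thesis using len by (simp add: hd_append hd_drop_conv_nth)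
  next
    case False
    then show ?thesis using len k hd by (cases os) auto
  qed
  show "seq_ob C (rotate_left k X) i = seq_ob C X (i + k)" if "i + k \<le> d + 2" "i \<le> d + 1"
    using that len k hd by (auto simp: Xe seq_ob_def rotate_left_def nth_append add.commute)
  show "seq_ob C (rotate_left k X) i = SigO C (seq_ob C X (i + k - (d + 2)))"
    if "i + k < 2 * d + 4" "d + 2 \<le> i + k" "i \<le> d + 2"
  proof (cases "i = d + 2")
    case True
    then show ?thesis using that len k hdk by (auto simp: Xe seq_ob_def rotate_left_def nth_append)
  next
    case False
    then show ?thesis using that len k by (auto simp: Xe seq_ob_def rotate_left_def nth_append)
  qed
qed

lemma rotate_left_mor:
  assumes X: "X \<in> Ang C" and k: "k \<le> d + 2"
  shows "i + k \<le> d + 1 \<Longrightarrow> seq_mor C (rotate_left k X) i = seq_mor C X (i + k)"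
    and "i \<le> d + 1 \<Longrightarrow> d + 2 \<le> i + k \<Longrightarrow>
      seq_mor C (rotate_left k X) i = twist (SigM C (seq_mor C X (i + k - (d + 2))))"
proof -
  obtain os ms where Xe: "X = (os, ms)" by fastforce
  have len: "length ms = d + 2" using Ang_length[OF X] Xe by simp
  show "seq_mor C (rotate_left k X) i = seq_mor C X (i + k)" if "i + k \<le> d + 1"
    using that len k by (auto simp: Xe seq_mor_def rotate_left_def nth_append add.commute)
  show "seq_mor C (rotate_left k X) i = twist (SigM C (seq_mor C X (i + k - (d + 2))))"
    if "i \<le> d + 1" "d + 2 \<le> i + k"
    using that len k
    by (auto simp: Xe seq_mor_def rotate_left_def nth_append not_less)
qed

lemma trivial_angle:
  assumes x: "x \<in> Ob C" and z: "zero_obj C z"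
  shows "\<exists>X\<in>Ang C. seq_ob C X 0 = x \<and> seq_ob C X 1 = x \<and> seq_mor C X 0 = idm C x \<and>
    (\<forall>i\<in>{2..d + 1}. seq_ob C X i = z) \<and> (\<forall>i\<in>{1..d + 1}. seq_mor C X i = 0)"
proof -
  let ?X = "(x # x # replicate d z, idm C x # replicate (d + 1) (0 :: 'm))"
  have "seq_ob C ?X 0 = x \<and> seq_ob C ?X 1 = x \<and> seq_mor C ?X 0 = idm C x"
    by (simp add: seq_ob_def seq_mor_def)
  moreover have "seq_ob C ?X i = z" if i: "i \<in> {2..d + 1}" for i
  proof -
    obtain j where "i = Suc (Suc j)" using i by (metis atLeastAtMost_iff add_2_eq_Suc le_Suc_ex)
    then show ?thesis using i by (auto simp: seq_ob_def nth_append)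
  qed
  moreover have "seq_mor C ?X i = 0" if i: "i \<in> {1..d + 1}" for i
  proof -
    obtain j where "i = Suc j" using i by (cases i) auto
    then show ?thesis using i by (auto simp: seq_mor_def nth_append simp del: replicate.simps)
  qed
  ultimately show ?thesis using N1_trivial[OF x z] by blast
qed

text \<open>The pair \<open>(id, \<gamma>\<^sup>0)\<close> extends to a morphism from the trivial angle on \<open>c\<^sup>0\<close>, whose third object is
  zero.\<close>

lemma angle_cmp_zero_0:
  assumes X: "X \<in> Ang C" shows "seq_mor C X 1 \<star> seq_mor C X 0 = 0"
proof -
  obtain z where z: "zero_obj C z" using zero_obj_exists by blast
  let ?x = "seq_ob C X 0"
  have O: "\<And>i. i \<le> d + 2 \<Longrightarrow> seq_ob C X i \<in> Ob C" using seq_ob_Ob[OF X] .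
  have x: "?x \<in> Ob C" by (rule O) simp
  obtain Y where Y: "Y \<in> Ang C" "seq_ob C Y 0 = ?x" "seq_ob C Y 1 = ?x" "seq_mor C Y 0 = idm C ?x"
    "\<forall>i\<in>{2..d + 1}. seq_ob C Y i = z" "\<forall>i\<in>{1..d + 1}. seq_mor C Y i = 0"
    using trivial_angle[OF x z] by blast
  then have Y2: "seq_ob C Y 2 = z" "seq_mor C Y 1 = 0" using d_pos by simp_all
  have m: "seq_mor C X 0 \<in> Hom C ?x (seq_ob C X 1)" using seq_mor_Hom[OF X, of 0] by simp
  have "seq_mor C X 0 \<star> seq_mor C Y 0 = seq_mor C X 0 \<star> idm C ?x" using Y by simp
  then obtain \<phi> where phi: "is_seq_morphism C d Y X \<phi>" "\<phi> 1 = seq_mor C X 0"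
    using N3[OF Y(1) X, of "idm C ?x" "seq_mor C X 0"] m x idm_in_Hom Y by auto
  then have "\<phi> (Suc 1) \<star> seq_mor C Y 1 = seq_mor C X 1 \<star> \<phi> 1" "\<phi> 2 \<in> Hom C z (seq_ob C X 2)"
    using Y2 unfolding is_seq_morphism_def by auto
  moreover have "\<phi> 2 \<star> 0 = 0"
    by (rule cmp_zero_right[of z z "seq_ob C X 2"]) (use z O calculation in \<open>auto simp: zero_obj_def\<close>)
  ultimately show ?thesis using Y2 phi(2) by (simp add: numeral_2_eq_2)
qed

lemma angle_cmp_zero:
  assumes X: "X \<in> Ang C" and i: "i \<le> d"
  shows "seq_mor C X (Suc i) \<star> seq_mor C X i = 0"
  using angle_cmp_zero_0[OF rotate_left_Ang[OF X, of i]] rotate_left_mor(1)[OF X, of i 0]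
    rotate_left_mor(1)[OF X, of i 1] i by simp

lemma angle_cmp_zero_last:
  assumes X: "X \<in> Ang C" shows "SigM C (seq_mor C X 0) \<star> seq_mor C X (d + 1) = 0"
proof -
  have O: "\<And>i. i \<le> d + 2 \<Longrightarrow> seq_ob C X i \<in> Ob C" using seq_ob_Ob[OF X] .
  have "twist (SigM C (seq_mor C X 0)) \<star> seq_mor C X (d + 1) = 0"
    using angle_cmp_zero_0[OF rotate_left_Ang[OF X, of "d + 1"]] rotate_left_mor(1)[OF X, of "d + 1" 0]
      rotate_left_mor(2)[OF X, of "d + 1" 1] by simp
  moreover have "SigM C (seq_mor C X 0) \<in> Hom C (SigO C (seq_ob C X 0)) (SigO C (seq_ob C X 1))"
    using SigM_Hom seq_mor_Hom[OF X, of 0] O by simp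
  moreover have "seq_mor C X (d + 1) \<in> Hom C (seq_ob C X (d + 1)) (SigO C (seq_ob C X 0))"
    using seq_mor_Hom[OF X, of "d + 1"] seq_ob_Sigma[OF X] by simp
  ultimately have "twist (SigM C (seq_mor C X 0) \<star> seq_mor C X (d + 1)) = 0"
    using twist_cmp_left[of "seq_ob C X (d + 1)" "SigO C (seq_ob C X 0)" "SigO C (seq_ob C X 1)"] O SigO_Ob
    by simp
  then show ?thesis by (metis twist_twist twist_zero)
qed

text \<open>A morphism killed by \<open>\<gamma>\<^sup>0\<close> gives a commutative first square from the rotated trivial angle
  \<open>w \<rightarrow> 0 \<rightarrow> \<dots> \<rightarrow> 0 \<rightarrow> \<Sigma>\<^sup>d w\<close>; the last square of its extension is the factorisation.\<close>

lemma angle_exact_cov_first: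
  assumes X: "X \<in> Ang C" and w: "w \<in> Ob C" and g: "g \<in> Hom C w (seq_ob C X 0)"
    and g0: "seq_mor C X 0 \<star> g = 0"
  obtains h where "h \<in> Hom C (SigO C w) (seq_ob C X (d + 1))" "SigM C g = seq_mor C X (d + 1) \<star> h"
proof -
  obtain z where z: "zero_obj C z" using zero_obj_exists by blast
  have zO: "z \<in> Ob C" using z by (simp add: zero_obj_def)
  have O: "\<And>i. i \<le> d + 2 \<Longrightarrow> seq_ob C X i \<in> Ob C" using seq_ob_Ob[OF X] .
  have XO: "seq_ob C X 0 \<in> Ob C" "seq_ob C X 1 \<in> Ob C" "seq_ob C X (d + 1) \<in> Ob C" using O by auto
  obtain T where T: "T \<in> Ang C" "seq_ob C T 0 = w" "seq_ob C T 1 = w" "seq_mor C T 0 = idm C w"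
    "\<forall>i\<in>{2..d + 1}. seq_ob C T i = z" "\<forall>i\<in>{1..d + 1}. seq_mor C T i = 0"
    using trivial_angle[OF w z] by blast
  define Y where "Y = rotate_left 1 T"
  have Y: "Y \<in> Ang C" "seq_ob C Y 0 = w" "seq_ob C Y 1 = z" "seq_mor C Y 0 = 0"
    "seq_ob C Y (d + 1) = SigO C w" "seq_mor C Y (d + 1) = twist (idm C (SigO C w))"
    using rotate_left_Ang[OF T(1), of 1] rotate_left_ob[OF T(1), of 1] rotate_left_mor[OF T(1), of 1]
      T d_pos w SigM_idm seq_ob_Sigma[OF T(1)] by (simp_all add: Y_def)
  have "0 \<star> seq_mor C Y 0 = seq_mor C X 0 \<star> g"
    using Y g0 cmp_zero_right[of z z z 0] cmp_zero_left[of w z "seq_ob C X 1" 0] zO w XO Hom_zero by simp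
  then obtain \<phi> where phi: "is_seq_morphism C d Y X \<phi>" "\<phi> 0 = g"
    using N3[OF Y(1) X, of g 0] g Y(2,3) Hom_zero[OF zO XO(2)] by auto
  then have sq: "SigM C g \<star> seq_mor C Y (d + 1) = seq_mor C X (d + 1) \<star> \<phi> (d + 1)"
    unfolding is_seq_morphism_def by (auto simp: numeral_2_eq_2)
  have "\<phi> (d + 1) \<in> Hom C (seq_ob C Y (d + 1)) (seq_ob C X (d + 1))"
    using phi(1) unfolding is_seq_morphism_def by simp
  then have h: "\<phi> (d + 1) \<in> Hom C (SigO C w) (seq_ob C X (d + 1))" by (simp only: Y(5))
  have Sg: "SigM C g \<in> Hom C (SigO C w) (SigO C (seq_ob C X 0))" by (rule SigM_Hom[OF w XO(1) g])
  have m: "seq_mor C X (d + 1) \<in> Hom C (seq_ob C X (d + 1)) (SigO C (seq_ob C X 0))"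
    using seq_mor_Hom[OF X, of "d + 1"] seq_ob_Sigma[OF X] by simp
  note SO = SigO_Ob[OF w] SigO_Ob[OF XO(1)]
  have "twist (SigM C g) = seq_mor C X (d + 1) \<star> \<phi> (d + 1)"
    using sq Y(6) twist_cmp_right[OF SO(1) SO(1) SO(2) idm_in_Hom[OF SO(1)] Sg]
      cmp_idm_right[OF SO(1,2) Sg] by simp
  then have "SigM C g = seq_mor C X (d + 1) \<star> twist (\<phi> (d + 1))"
    using twist_cmp_right[OF SO(1) XO(3) SO(2) h m] by (metis twist_twist)
  then show ?thesis using that twist_Hom[OF SO(1) XO(3) h] by blast
qed

lemma angle_exact_cov:
  assumes X: "X \<in> Ang C" and w: "w \<in> Ob C" and i: "i \<le> d" and g: "g \<in> Hom C w (seq_ob C X (Suc i))"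
    and g0: "seq_mor C X (Suc i) \<star> g = 0"
  obtains h where "h \<in> Hom C w (seq_ob C X i)" "g = seq_mor C X i \<star> h"
proof -
  have O: "seq_ob C X i \<in> Ob C" "seq_ob C X (Suc i) \<in> Ob C" using seq_ob_Ob[OF X] i by auto
  let ?Y = "rotate_left (Suc i) X"
  have Y: "?Y \<in> Ang C" using rotate_left_Ang[OF X, of "Suc i"] i by simp
  obtain h where h: "h \<in> Hom C (SigO C w) (SigO C (seq_ob C X i))"
    "SigM C g = twist (SigM C (seq_mor C X i)) \<star> h"
    using angle_exact_cov_first[OF Y w, of g] g g0 i rotate_left_ob[OF X, of "Suc i"]
      rotate_left_mor[OF X, of "Suc i"] by auto
  obtain k where k: "k \<in> Hom C w (seq_ob C X i)" "h = SigM C k" using SigM_surj[OF w O(1) h(1)] by blast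
  have m: "seq_mor C X i \<in> Hom C (seq_ob C X i) (seq_ob C X (Suc i))" using seq_mor_Hom[OF X] i by simp
  note H = w O m k(1) SigO_Ob[OF w] SigO_Ob[OF O(1)] SigO_Ob[OF O(2)] SigM_Hom[OF w O(1) k(1)]
    SigM_Hom[OF O m] cmp_in_Hom[OF w O k(1) m] twist_Hom[OF w O(1) k(1)]
  have "SigM C g = SigM C (seq_mor C X i \<star> twist k)"
    using h(2) k(2) twist_cmp_left[of "SigO C w" "SigO C (seq_ob C X i)" "SigO C (seq_ob C X (Suc i))"]
      twist_cmp_right[of w "seq_ob C X i" "seq_ob C X (Suc i)" k] SigM_twist[OF w O(2)]
      SigM_cmp[OF w O k(1) m] H by simp
  then have "g = seq_mor C X i \<star> twist k"
    using SigM_inj[OF w O(2) g] cmp_in_Hom[OF w O] H by blast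
  then show ?thesis using that H by blast
qed

text \<open>Dually, a morphism killing \<open>\<gamma>\<^sup>0\<close> gives a commutative first square into an angle
  \<open>0 \<rightarrow> x \<rightarrow> x \<rightarrow> \<dots>\<close>.  Such an angle arises from rotating a trivial one almost completely, which
  replaces \<open>x\<close> by \<open>\<Sigma>\<^sup>d x\<close>.\<close>

lemma angle_exact_contra_0:
  assumes X: "X \<in> Ang C" and x: "x \<in> Ob C" and g: "g \<in> Hom C (seq_ob C X 1) x"
    and g0: "g \<star> seq_mor C X 0 = 0"
  obtains h where "h \<in> Hom C (seq_ob C X 2) x" "g = h \<star> seq_mor C X 1"
proof -
  obtain z where z: "zero_obj C z" using zero_obj_exists by blast
  have zO: "z \<in> Ob C" using z by (simp add: zero_obj_def)
  have O: "\<And>i. i \<le> d + 2 \<Longrightarrow> seq_ob C X i \<in> Ob C" using seq_ob_Ob[OF X] .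
  have XO: "seq_ob C X 0 \<in> Ob C" "seq_ob C X 1 \<in> Ob C" "seq_ob C X 2 \<in> Ob C" using O by auto
  note SO = XO[THEN SigO_Ob] SigO_Ob[OF x]
  obtain T where T: "T \<in> Ang C" "seq_ob C T 0 = x" "seq_ob C T 1 = x" "seq_mor C T 0 = idm C x"
    "\<forall>i\<in>{2..d + 1}. seq_ob C T i = z" "\<forall>i\<in>{1..d + 1}. seq_mor C T i = 0"
    using trivial_angle[OF x z] by blast
  define Y where "Y = rotate_left (d + 1) T"
  have Y: "Y \<in> Ang C" "seq_ob C Y 0 = z" "seq_ob C Y 1 = SigO C x" "seq_mor C Y 0 = 0"
    "seq_ob C Y 2 = SigO C x" "seq_mor C Y 1 = twist (idm C (SigO C x))"
    using rotate_left_Ang[OF T(1), of "d + 1"] rotate_left_ob[OF T(1), of "d + 1"]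
      rotate_left_mor[OF T(1), of "d + 1"] T d_pos x SigM_idm seq_ob_Sigma[OF T(1)] by (simp_all add: Y_def)
  define X' where "X' = rotate_left (d + 2) X"
  have X': "X' \<in> Ang C" "seq_ob C X' 0 = SigO C (seq_ob C X 0)" "seq_ob C X' 1 = SigO C (seq_ob C X 1)"
    "seq_ob C X' 2 = SigO C (seq_ob C X 2)" "seq_mor C X' 0 = twist (SigM C (seq_mor C X 0))"
    "seq_mor C X' 1 = twist (SigM C (seq_mor C X 1))"
    using rotate_left_Ang[OF X, of "d + 2"] rotate_left_ob[OF X, of "d + 2"]
      rotate_left_mor[OF X, of "d + 2"] d_pos by (simp_all add: X'_def)
  have m0: "seq_mor C X 0 \<in> Hom C (seq_ob C X 0) (seq_ob C X 1)" using seq_mor_Hom[OF X, of 0] by simp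
  have m1: "seq_mor C X 1 \<in> Hom C (seq_ob C X 1) (seq_ob C X 2)"
    using seq_mor_Hom[OF X, of 1] by (simp add: numeral_2_eq_2)
  have Sg: "SigM C g \<in> Hom C (SigO C (seq_ob C X 1)) (SigO C x)" by (rule SigM_Hom[OF XO(2) x g])
  have "SigM C g \<star> seq_mor C X' 0 = twist (SigM C (g \<star> seq_mor C X 0))"
    using X'(5) twist_cmp_right[OF SO(1,2,4) SigM_Hom[OF XO(1,2) m0] Sg] SigM_cmp[OF XO(1,2) x m0 g] by simp
  then have "SigM C g \<star> seq_mor C X' 0 = 0" using g0 by simp
  also have "\<dots> = seq_mor C Y 0 \<star> 0"
    using Y(4) cmp_zero_right[of z z z 0] zO Hom_zero by simp
  finally obtain \<phi> where phi: "is_seq_morphism C d X' Y \<phi>" "\<phi> 1 = SigM C g"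
    using N3[OF X'(1) Y(1), of 0 "SigM C g"] X'(2,3) Y(2,3) Sg Hom_zero[OF SO(1) zO] by auto
  have "\<phi> 2 \<in> Hom C (seq_ob C X' 2) (seq_ob C Y 2)"
    using phi(1) unfolding is_seq_morphism_def by simp
  then have h: "\<phi> 2 \<in> Hom C (SigO C (seq_ob C X 2)) (SigO C x)" by (simp only: X'(4) Y(5))
  have "\<phi> (Suc 1) \<star> seq_mor C X' 1 = seq_mor C Y 1 \<star> \<phi> 1"
    using phi(1) unfolding is_seq_morphism_def by simp
  then have "\<phi> 2 \<star> twist (SigM C (seq_mor C X 1)) = twist (idm C (SigO C x)) \<star> SigM C g"
    using X'(6) Y(6) phi(2) by (simp add: numeral_2_eq_2)
  then have "twist (\<phi> 2 \<star> SigM C (seq_mor C X 1)) = twist (SigM C g)"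
    using twist_cmp_right[OF SO(2,3,4) SigM_Hom[OF XO(2,3) m1] h]
      twist_cmp_left[OF SO(2,4,4) Sg idm_in_Hom[OF SO(4)]] cmp_idm_left[OF SO(2,4) Sg] by simp
  then have eq: "\<phi> 2 \<star> SigM C (seq_mor C X 1) = SigM C g" by (simp add: twist_eq_iff)
  obtain k where k: "k \<in> Hom C (seq_ob C X 2) x" "\<phi> 2 = SigM C k" using SigM_surj[OF XO(3) x h] by blast
  have "SigM C (k \<star> seq_mor C X 1) = SigM C g" using eq k SigM_cmp[OF XO(2,3) x m1 k(1)] by simp
  then have "k \<star> seq_mor C X 1 = g"
    using SigM_inj[OF XO(2) x _ g] cmp_in_Hom[OF XO(2,3) x m1 k(1)] by blast
  then show ?thesis using that k by blast
qed

lemma angle_exact_contra: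
  assumes X: "X \<in> Ang C" and x: "x \<in> Ob C" and i: "i \<le> d" and g: "g \<in> Hom C (seq_ob C X (Suc i)) x"
    and g0: "g \<star> seq_mor C X i = 0"
  obtains h where "h \<in> Hom C (seq_ob C X (Suc (Suc i))) x" "g = h \<star> seq_mor C X (Suc i)"
proof -
  have Y: "rotate_left i X \<in> Ang C" using rotate_left_Ang[OF X, of i] i by simp
  show ?thesis
    using angle_exact_contra_0[OF Y x, of g] g g0 i that d_pos rotate_left_ob(1)[OF X, of i 1]
      rotate_left_ob(1)[OF X, of i 2] rotate_left_mor(1)[OF X, of i 0] rotate_left_mor(1)[OF X, of i 1]
    by auto
qed

lemma angle_exact_contra_last:
  assumes X: "X \<in> Ang C" and x: "x \<in> Ob C" and g: "g \<in> Hom C (seq_ob C X (d + 2)) x"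
    and g0: "g \<star> seq_mor C X (d + 1) = 0"
  obtains h where "h \<in> Hom C (SigO C (seq_ob C X 1)) x" "g = h \<star> SigM C (seq_mor C X 0)"
proof -
  have XO: "seq_ob C X 0 \<in> Ob C" "seq_ob C X 1 \<in> Ob C" using seq_ob_Ob[OF X] by auto
  note SO = XO[THEN SigO_Ob]
  have Y: "rotate_left (d + 1) X \<in> Ang C" using rotate_left_Ang[OF X, of "d + 1"] by simp
  obtain h where h: "h \<in> Hom C (SigO C (seq_ob C X 1)) x"
    "g = h \<star> twist (SigM C (seq_mor C X 0))"
    using angle_exact_contra_0[OF Y x, of g] g g0 d_pos rotate_left_ob(1)[OF X, of "d + 1" 1]
      rotate_left_ob(2)[OF X, of "d + 1" 2] rotate_left_mor(1)[OF X, of "d + 1" 0]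
      rotate_left_mor(2)[OF X, of "d + 1" 1]
    by auto
  have m: "SigM C (seq_mor C X 0) \<in> Hom C (SigO C (seq_ob C X 0)) (SigO C (seq_ob C X 1))"
    using SigM_Hom[OF XO] seq_mor_Hom[OF X, of 0] by simp
  have "g = twist h \<star> SigM C (seq_mor C X 0)"
    using h twist_cmp_right[OF SO x m h(1)] twist_cmp_left[OF SO x m h(1)] by simp
  then show ?thesis using that twist_Hom[OF SO(2) x h(1)] by blast
qed

text \<open>A first morphism \<open>\<Sigma>\<^sup>-\<^sup>d f\<close> is moved to position \<open>d\<close> by two left rotations, which change it to \<open>f\<close> up to
  the sign \<open>(-1)\<^sup>d\<close>.\<close>

lemma angle_with_penultimate_morphism:
  assumes x: "x \<in> Ob C" and y: "y \<in> Ob C" and f: "f \<in> Hom C x y"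
  obtains X where "X \<in> Ang C" "seq_ob C X d = x" "seq_ob C X (d + 1) = y" "seq_mor C X d = f"
proof -
  let ?x = "SigO_inv C x" and ?y = "SigO_inv C y"
  have O: "?x \<in> Ob C" "?y \<in> Ob C" "SigO C ?x = x" "SigO C ?y = y" using SigO_inv x y by auto
  obtain f' where f': "f' \<in> Hom C ?x ?y" "twist f = SigM C f'"
    using SigM_surj[OF O(1,2)] twist_Hom[OF x y f] O by metis
  obtain X where X: "X \<in> Ang C" "seq_ob C X 0 = ?x" "seq_ob C X 1 = ?y" "seq_mor C X 0 = f'"
    using N1_first_morphism[OF O(1,2) f'(1)] by blast
  show ?thesis
  proof (rule that)
    show "rotate_left 2 X \<in> Ang C" using rotate_left_Ang[OF X(1)] by simp
    show "seq_ob C (rotate_left 2 X) d = x" using rotate_left_ob(2)[OF X(1), of 2 d] X O d_pos by simp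
    show "seq_ob C (rotate_left 2 X) (d + 1) = y"
      using rotate_left_ob(2)[OF X(1), of 2 "d + 1"] X O d_pos by simp
    show "seq_mor C (rotate_left 2 X) d = f"
      using rotate_left_mor(2)[OF X(1), of 2 d] X f'(2)[symmetric] by simp
  qed
qed

end

section \<open>Morphism spaces and resolutions by a cluster tilting subcategory\<close>

locale oppermann_thomas_category = angulated_category C d + krull_schmidt_category C
  for C :: "('k::field, 'o, 'm::ab_group_add, 'z) angcat_scheme" (structure) and d :: nat +
  fixes T :: 'o
  assumes OT: "OT_cluster_tilting_object C d T"
begin

abbreviation tilt :: "'o set" where
  "tilt \<equiv> add_closure C T"

lemma T_Ob: "T \<in> Ob C"
  using OT by (simp add: OT_cluster_tilting_object_def)

lemma tilt_Ob: "s \<in> tilt \<Longrightarrow> s \<in> Ob C"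
  by (auto simp: add_closure_def is_direct_sum_def is_biproduct_def)

lemma tilt_rigid: "s \<in> tilt \<Longrightarrow> s' \<in> tilt \<Longrightarrow> f \<in> Hom C s (SigO C s') \<Longrightarrow> f = 0"
  using OT by (auto simp: OT_cluster_tilting_object_def OT_cluster_tilting_subcategory_def)

lemma T_in_tilt: "T \<in> tilt"
proof -
  obtain z where z: "zero_obj C z" using zero_obj_exists by blast
  have zO: "z \<in> Ob C" "idm C z = 0" using z zero_obj_iff by auto
  have "is_copower C 1 T T"
    unfolding is_copower_def using T_Ob idm_in_Hom cmp_idm_left[OF T_Ob T_Ob idm_in_Hom[OF T_Ob]]
    by (auto intro!: exI[of _ "\<lambda>_. idm C T"])
  moreover have "is_biproduct C T T z (idm C T) 0 (idm C T) 0"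
    unfolding is_biproduct_def using T_Ob zO idm_in_Hom[OF T_Ob] Hom_zero
      cmp_idm_left[OF T_Ob T_Ob idm_in_Hom[OF T_Ob]] cmp_zero_left[of T T z "idm C T"]
      cmp_zero_left[of z T z 0] cmp_zero_left[of T z T 0] cmp_zero_right[of z T T "idm C T"] by simp
  ultimately show ?thesis unfolding add_closure_def is_direct_sum_def by blast
qed

lemma tilt_retract:
  assumes s: "s \<in> tilt" and t: "t \<in> Ob C" and f: "f \<in> Hom C t s" and g: "g \<in> Hom C s t"
    and gf: "g \<star> f = idm C t"
  shows "t \<in> tilt"
proof -
  obtain n P y i j p q where P: "is_copower C n T P" and bp: "is_biproduct C P s y i j p q"
    using s by (auto simp: add_closure_def is_direct_sum_def)
  note [simp] = bp[unfolded is_biproduct_def] t f g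
  have "(g \<star> p) \<star> (i \<star> f) = g \<star> (p \<star> (i \<star> f))"
    using cmp_assoc[of t P s t "i \<star> f" p g] cmp_in_Hom[of t s P f i] by simp
  also have "\<dots> = idm C t"
    using cmp_assoc[of t s P s f i p] cmp_idm_left[of t s f] gf by simp
  finally have "(g \<star> p) \<star> (i \<star> f) = idm C t" .
  moreover have "i \<star> f \<in> Hom C t P" "g \<star> p \<in> Hom C P t"
    using cmp_in_Hom[of t s P f i] cmp_in_Hom[of P s t p g] by simp_all
  moreover have "P \<in> Ob C" by simp
  ultimately obtain b j' q' where "is_biproduct C P t b (i \<star> f) j' (g \<star> p) q'"
    using retract_biproduct[OF _ t] by blast
  then show ?thesis using P unfolding add_closure_def is_direct_sum_def by blast
qed

text \<open>A resolution of \<open>u\<close> is kept as an angle ending in \<open>u\<close>; \<open>t\<^sub>i\<close> is its object number \<open>d - i\<close>.\<close>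

definition resolves :: "'o list \<times> 'm list \<Rightarrow> 'o \<Rightarrow> bool" where
  "resolves X u \<longleftrightarrow> X \<in> Ang C \<and> seq_ob C X (d + 1) = u \<and> (\<forall>i\<le>d. seq_ob C X i \<in> tilt)"

lemma S_resolution_resolves:
  assumes "S_resolution C d tilt u t"
  obtains X where "resolves X u" "\<And>i. i \<le> d \<Longrightarrow> seq_ob C X (d - i) = t i"
proof -
  obtain \<gamma> where X: "(map t (rev [0..<Suc d]) @ [u], \<gamma>) \<in> Ang C" and t: "\<And>i. i \<le> d \<Longrightarrow> t i \<in> tilt"
    using assms by (auto simp: S_resolution_def)
  let ?X = "(map t (rev [0..<Suc d]) @ [u], \<gamma>)"
  have ob: "seq_ob C ?X i = t (d - i)" if "i \<le> d" for i
    using that by (simp add: seq_ob_def nth_append rev_nth del: upt_Suc)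
  have "seq_ob C ?X (d + 1) = u" by (simp add: seq_ob_def nth_append del: upt_Suc)
  then have "resolves ?X u" using X ob t by (simp add: resolves_def)
  then show ?thesis using that[of ?X] ob by simp
qed

lemma S_resolution_exists: "u \<in> Ob C \<Longrightarrow> \<exists>t. S_resolution C d tilt u t"
  using OT by (simp add: OT_cluster_tilting_object_def OT_cluster_tilting_subcategory_def)

lemma resolution_exists: "u \<in> Ob C \<Longrightarrow> \<exists>X. resolves X u"
  using S_resolution_exists S_resolution_resolves by metis

text \<open>The dimensions of \<open>Hom(u, x)\<close> in the quotient category and of \<open>Hom\<^sup>[\<^sup>\<T>\<^sup>](\<Sigma>\<^sup>-\<^sup>d u, x)\<close>.\<close>

definition quot_dim :: "'o \<Rightarrow> 'o \<Rightarrow> int" where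
  "quot_dim u x = int (vs.dim (Hom C u x)) - int (vs.dim (Hom_through C (SigO C ` tilt) u x))"

definition through_dim :: "'o \<Rightarrow> 'o \<Rightarrow> int" where
  "through_dim u x = int (vs.dim (Hom_through C tilt (SigO_inv C u) x))"

context
  fixes X u assumes X: "resolves X u"
begin

abbreviation "r_ob \<equiv> seq_ob C X"
abbreviation "r_mor \<equiv> seq_mor C X"

lemma r_Ang: "X \<in> Ang C" and r_ob_end: "r_ob (Suc d) = u" and r_ob_tilt: "i \<le> d \<Longrightarrow> r_ob i \<in> tilt"
  using X by (simp_all add: resolves_def)

lemma r_ob_Ob: "i \<le> d \<Longrightarrow> r_ob i \<in> Ob C"
  using r_ob_tilt tilt_Ob by blast

lemma u_Ob: "u \<in> Ob C"
  using seq_ob_Ob[OF r_Ang, of "Suc d"] r_ob_end by simp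

lemma r_mor_Hom: "i < d \<Longrightarrow> r_mor i \<in> Hom C (r_ob i) (r_ob (Suc i))"
  and r_mor_Hom_d: "r_mor d \<in> Hom C (r_ob d) u"
  and r_mor_Hom_last: "r_mor (Suc d) \<in> Hom C u (SigO C (r_ob 0))"
  using seq_mor_Hom[OF r_Ang, of i] seq_mor_Hom[OF r_Ang, of d] seq_mor_Hom[OF r_Ang, of "Suc d"]
    r_ob_end seq_ob_Sigma[OF r_Ang] by simp_all

text \<open>By rigidity every morphism \<open>u \<rightarrow> \<Sigma>\<^sup>d s\<close> vanishes on \<open>t\<^sub>0\<close>.  Hence the morphisms out of \<open>u\<close> that factor
  through \<open>\<Sigma>\<^sup>d \<T>\<close> are those that factor through the one connecting morphism \<open>u \<rightarrow> \<Sigma>\<^sup>d t\<^sub>d\<close>, which makes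
  them the image of a linear map.\<close>

lemma factor_through_connecting:
  assumes s: "s \<in> tilt" and a: "a \<in> Hom C u (SigO C s)"
  obtains k where "k \<in> Hom C (SigO C (r_ob 0)) (SigO C s)" "a = k \<star> r_mor (Suc d)"
proof -
  have sO: "SigO C s \<in> Ob C" using SigO_Ob tilt_Ob s by blast
  have "a \<star> r_mor d \<in> Hom C (r_ob d) (SigO C s)"
    using cmp_in_Hom[of "r_ob d" u "SigO C s"] r_ob_Ob u_Ob sO r_mor_Hom_d a by simp
  then have "a \<star> r_mor d = 0" using tilt_rigid[OF r_ob_tilt[OF le_refl] s] by simp
  then show ?thesis
    using angle_exact_contra[OF r_Ang sO le_refl, of a] a r_ob_end that seq_ob_Sigma[OF r_Ang] by auto
qed

lemma Hom_through_Sigma_eq: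
  assumes x: "x \<in> Ob C"
  shows "Hom_through C (SigO C ` tilt) u x
    = (\<lambda>g. g \<star> r_mor (Suc d)) ` Hom C (SigO C (r_ob 0)) x"
proof (intro equalityI subsetI)
  fix h assume "h \<in> Hom_through C (SigO C ` tilt) u x"
  then obtain a b s where h: "h = b \<star> a" "s \<in> tilt" "a \<in> Hom C u (SigO C s)" "b \<in> Hom C (SigO C s) x"
    by (auto simp: Hom_through_def)
  obtain k where k: "k \<in> Hom C (SigO C (r_ob 0)) (SigO C s)" "a = k \<star> r_mor (Suc d)"
    using factor_through_connecting[OF h(2,3)] by blast
  have O: "SigO C (r_ob 0) \<in> Ob C" "SigO C s \<in> Ob C" using SigO_Ob tilt_Ob h r_ob_Ob by simp_all
  have "h = (b \<star> k) \<star> r_mor (Suc d)"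
    using h(1) k(2) cmp_assoc[OF u_Ob O x r_mor_Hom_last k(1) h(4)] by simp
  then show "h \<in> (\<lambda>g. g \<star> r_mor (Suc d)) ` Hom C (SigO C (r_ob 0)) x"
    using cmp_in_Hom[OF O x k(1) h(4)] by blast
next
  fix h assume "h \<in> (\<lambda>g. g \<star> r_mor (Suc d)) ` Hom C (SigO C (r_ob 0)) x"
  then show "h \<in> Hom_through C (SigO C ` tilt) u x"
    using r_mor_Hom_last r_ob_tilt[of 0] unfolding Hom_through_def by blast
qed

lemma Hom_through_Sigma_fin_dim:
  assumes x: "x \<in> Ob C" shows "vs.fin_dim (Hom_through C (SigO C ` tilt) u x)"
  unfolding Hom_through_Sigma_eq[OF x]
  by (rule vs.rank_nullity(3)[OF fin_dim_Hom linear_on_precomp[of u "SigO C (r_ob 0)" x]])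
    (use x u_Ob SigO_Ob r_ob_Ob r_mor_Hom_last in simp_all)

text \<open>\<open>r_in k\<close> is the morphism into object number \<open>k\<close> of the resolution; for \<open>k = 0\<close> it is
  \<open>\<Sigma>\<^sup>-\<^sup>d\<close> of the connecting morphism.\<close>

definition r_in :: "nat \<Rightarrow> 'm" where
  "r_in k = (if k = 0 then inv_into (Hom C (SigO_inv C u) (r_ob 0)) (SigM C) (r_mor (Suc d))
     else r_mor (k - 1))"

abbreviation r_src :: "nat \<Rightarrow> 'o" where
  "r_src k \<equiv> (if k = 0 then SigO_inv C u else r_ob (k - 1))"

lemma r_in_Suc [simp]: "r_in (Suc k) = r_mor k"
  by (simp add: r_in_def)

lemma r_in_0: "r_in 0 \<in> Hom C (SigO_inv C u) (r_ob 0)" "SigM C (r_in 0) = r_mor (Suc d)"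
proof -
  have im: "SigM C ` Hom C (SigO_inv C u) (r_ob 0) = Hom C u (SigO C (r_ob 0))"
    using SigM_bij[of "SigO_inv C u" "r_ob 0"] SigO_inv[OF u_Ob] r_ob_Ob[of 0] by (simp add: bij_betw_def)
  have m: "r_mor (Suc d) \<in> SigM C ` Hom C (SigO_inv C u) (r_ob 0)" using im r_mor_Hom_last by simp
  show "r_in 0 \<in> Hom C (SigO_inv C u) (r_ob 0)" "SigM C (r_in 0) = r_mor (Suc d)"
    using inv_into_into[OF m] f_inv_into_f[OF m] by (simp_all add: r_in_def)
qed

lemma r_src_Ob: "k \<le> Suc d \<Longrightarrow> r_src k \<in> Ob C"
  using r_ob_Ob SigO_inv(1)[OF u_Ob] by simp

lemma r_ob_Ob': "k \<le> Suc d \<Longrightarrow> r_ob k \<in> Ob C"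
  using r_ob_Ob u_Ob r_ob_end by (metis le_SucE)

lemma r_in_Hom: "k \<le> Suc d \<Longrightarrow> r_in k \<in> Hom C (r_src k) (r_ob k)"
  using r_in_0(1) seq_mor_Hom[OF r_Ang, of "k - 1"] by (cases k) auto

lemma r_in_exact:
  assumes x: "x \<in> Ob C" and k: "k \<le> d"
  shows "{a\<in>Hom C (r_ob k) x. a \<star> r_in k = 0} = (\<lambda>g. g \<star> r_mor k) ` Hom C (r_ob (Suc k)) x"
proof (cases k)
  case (Suc i)
  have O: "r_ob i \<in> Ob C" "r_ob k \<in> Ob C" "r_ob (Suc k) \<in> Ob C" using r_ob_Ob' k Suc by simp_all
  have m: "r_mor i \<in> Hom C (r_ob i) (r_ob k)" "r_mor k \<in> Hom C (r_ob k) (r_ob (Suc k))"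
    using seq_mor_Hom[OF r_Ang] k Suc by simp_all
  show ?thesis
  proof (intro equalityI subsetI)
    fix a assume "a \<in> {a\<in>Hom C (r_ob k) x. a \<star> r_in k = 0}"
    then show "a \<in> (\<lambda>g. g \<star> r_mor k) ` Hom C (r_ob (Suc k)) x"
      using angle_exact_contra[OF r_Ang x, of i a] k Suc by auto
  next
    fix a assume "a \<in> (\<lambda>g. g \<star> r_mor k) ` Hom C (r_ob (Suc k)) x"
    then obtain g where g: "g \<in> Hom C (r_ob (Suc k)) x" "a = g \<star> r_mor k" by blast
    have "a \<star> r_mor i = g \<star> (r_mor k \<star> r_mor i)" using g(2) cmp_assoc[OF O x m g(1)] by simp
    also have "\<dots> = 0" using angle_cmp_zero[OF r_Ang, of i] k Suc cmp_zero_right[OF O(1,3) x g(1)] by simp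
    finally show "a \<in> {a\<in>Hom C (r_ob k) x. a \<star> r_in k = 0}"
      using Suc g cmp_in_Hom[OF O(2,3) x m(2) g(1)] by simp
  qed
next
  case 0
  have O: "SigO_inv C u \<in> Ob C" "r_ob 0 \<in> Ob C" "r_ob 1 \<in> Ob C"
    using r_ob_Ob' SigO_inv(1)[OF u_Ob] by simp_all
  have S[simp]: "SigO C (SigO_inv C u) = u" using SigO_inv(2)[OF u_Ob] .
  have m: "r_mor 0 \<in> Hom C (r_ob 0) (r_ob 1)" using seq_mor_Hom[OF r_Ang, of 0] by simp
  note SO = SigO_Ob[OF O(2)] SigO_Ob[OF O(3)] SigO_Ob[OF x]
  show ?thesis
  proof (intro equalityI subsetI)
    fix a assume "a \<in> {a\<in>Hom C (r_ob k) x. a \<star> r_in k = 0}"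
    then have a: "a \<in> Hom C (r_ob 0) x" "a \<star> r_in 0 = 0" by (simp_all add: 0)
    have "SigM C a \<star> r_mor (d + 1) = 0"
      using SigM_cmp[OF O(1,2) x r_in_0(1) a(1)] a(2) r_in_0(2) by simp
    then obtain h where h: "h \<in> Hom C (SigO C (r_ob 1)) (SigO C x)" "SigM C a = h \<star> SigM C (r_mor 0)"
      using angle_exact_contra_last[OF r_Ang SO(3), of "SigM C a"] SigM_Hom[OF O(2) x a(1)]
        seq_ob_Sigma[OF r_Ang] by auto
    obtain k' where k': "k' \<in> Hom C (r_ob 1) x" "h = SigM C k'" using SigM_surj[OF O(3) x h(1)] by blast
    have "SigM C a = SigM C (k' \<star> r_mor 0)" using h k' SigM_cmp[OF O(2,3) x m k'(1)] by simp
    then have "a = k' \<star> r_mor 0" using SigM_inj[OF O(2) x a(1) cmp_in_Hom[OF O(2,3) x m k'(1)]] by blast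
    then show "a \<in> (\<lambda>g. g \<star> r_mor k) ` Hom C (r_ob (Suc k)) x" using k'(1) 0 by simp
  next
    fix a assume "a \<in> (\<lambda>g. g \<star> r_mor k) ` Hom C (r_ob (Suc k)) x"
    then obtain g where g: "g \<in> Hom C (r_ob 1) x" "a = g \<star> r_mor 0" using 0 by auto
    have "SigM C (r_mor 0 \<star> r_in 0) = 0"
      using SigM_cmp[OF O r_in_0(1) m] r_in_0(2) angle_cmp_zero_last[OF r_Ang] by simp
    then have z: "r_mor 0 \<star> r_in 0 = 0"
      using SigM_inj[OF O(1,3) cmp_in_Hom[OF O r_in_0(1) m] Hom_zero[OF O(1,3)]] by simp
    have "a \<star> r_in 0 = g \<star> (r_mor 0 \<star> r_in 0)" using g(2) cmp_assoc[OF O x r_in_0(1) m g(1)] by simp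
    also have "\<dots> = 0" using z cmp_zero_right[OF O(1,3) x g(1)] by simp
    finally show "a \<in> {a\<in>Hom C (r_ob k) x. a \<star> r_in k = 0}"
      using 0 g cmp_in_Hom[OF O(2,3) x m g(1)] by simp
  qed
qed

lemma Hom_through_tilt_eq:
  assumes x: "x \<in> Ob C"
  shows "Hom_through C tilt (SigO_inv C u) x = (\<lambda>g. g \<star> r_in 0) ` Hom C (r_ob 0) x"
proof (intro equalityI subsetI)
  fix h assume "h \<in> Hom_through C tilt (SigO_inv C u) x"
  then obtain a b s where h: "h = b \<star> a" "s \<in> tilt" "a \<in> Hom C (SigO_inv C u) s" "b \<in> Hom C s x"
    by (auto simp: Hom_through_def)
  have O: "SigO_inv C u \<in> Ob C" "r_ob 0 \<in> Ob C" "s \<in> Ob C"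
    using r_ob_Ob' SigO_inv(1)[OF u_Ob] tilt_Ob h by simp_all
  obtain k where k: "k \<in> Hom C (SigO C (r_ob 0)) (SigO C s)" "SigM C a = k \<star> r_mor (Suc d)"
    using factor_through_connecting[OF h(2), of "SigM C a"] SigM_Hom[OF O(1,3) h(3)] SigO_inv(2)[OF u_Ob] by auto
  obtain k' where k': "k' \<in> Hom C (r_ob 0) s" "k = SigM C k'" using SigM_surj[OF O(2,3) k(1)] by blast
  have "SigM C a = SigM C (k' \<star> r_in 0)" using k k' SigM_cmp[OF O r_in_0(1) k'(1)] r_in_0(2) by simp
  then have "a = k' \<star> r_in 0" using SigM_inj[OF O(1,3) h(3) cmp_in_Hom[OF O r_in_0(1) k'(1)]] by blast
  then have "h = (b \<star> k') \<star> r_in 0" using h(1) cmp_assoc[OF O x r_in_0(1) k'(1) h(4)] by simp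
  then show "h \<in> (\<lambda>g. g \<star> r_in 0) ` Hom C (r_ob 0) x"
    using cmp_in_Hom[OF O(2,3) x k'(1) h(4)] by blast
next
  fix h assume "h \<in> (\<lambda>g. g \<star> r_in 0) ` Hom C (r_ob 0) x"
  then show "h \<in> Hom_through C tilt (SigO_inv C u) x"
    using r_in_0(1) r_ob_tilt[of 0] unfolding Hom_through_def by blast
qed

lemma Hom_through_tilt_fin_dim:
  assumes x: "x \<in> Ob C" shows "vs.fin_dim (Hom_through C tilt (SigO_inv C u) x)"
  unfolding Hom_through_tilt_eq[OF x]
  by (rule vs.rank_nullity(3)[OF fin_dim_Hom linear_on_precomp[of "SigO_inv C u" "r_ob 0" x]])
    (use x SigO_inv(1)[OF u_Ob] r_ob_Ob r_in_0(1) in simp_all)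

text \<open>A model of \<open>Hom(u, x)\<close> in the quotient category that is a subspace and not a quotient: the
  kernel of \<open>Hom(t\<^sub>0, x) \<rightarrow> Hom(t\<^sub>1, x)\<close>, which is the image of \<open>Hom(u, x)\<close>.\<close>

definition quot_space :: "'o \<Rightarrow> 'm set" where
  "quot_space x = {a\<in>Hom C (r_ob d) x. a \<star> r_in d = 0}"

lemma quot_space_eq:
  assumes "x \<in> Ob C" shows "quot_space x = (\<lambda>g. g \<star> r_mor d) ` Hom C u x"
  using r_in_exact[OF assms le_refl] r_ob_end by (simp add: quot_space_def)

lemma Hom_through_Sigma_kernel:
  assumes x: "x \<in> Ob C"
  shows "Hom_through C (SigO C ` tilt) u x = {g\<in>Hom C u x. g \<star> r_mor d = 0}"
  unfolding Hom_through_Sigma_eq[OF x]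
proof (intro equalityI subsetI)
  fix g assume "g \<in> {g\<in>Hom C u x. g \<star> r_mor d = 0}"
  then show "g \<in> (\<lambda>g. g \<star> r_mor (Suc d)) ` Hom C (SigO C (r_ob 0)) x"
    using angle_exact_contra[OF r_Ang x le_refl, of g] r_ob_end seq_ob_Sigma[OF r_Ang] by auto
next
  have O: "r_ob d \<in> Ob C" "u \<in> Ob C" "SigO C (r_ob 0) \<in> Ob C" using r_ob_Ob u_Ob SigO_Ob by simp_all
  fix g assume "g \<in> (\<lambda>g. g \<star> r_mor (Suc d)) ` Hom C (SigO C (r_ob 0)) x"
  then obtain h where h: "h \<in> Hom C (SigO C (r_ob 0)) x" "g = h \<star> r_mor (Suc d)" by blast
  have "g \<star> r_mor d = h \<star> (r_mor (Suc d) \<star> r_mor d)"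
    using h(2) cmp_assoc[OF O x r_mor_Hom_d r_mor_Hom_last h(1)] by simp
  also have "\<dots> = 0" using angle_cmp_zero[OF r_Ang le_refl] cmp_zero_right[OF O(1,3) x h(1)] by simp
  finally show "g \<in> {g\<in>Hom C u x. g \<star> r_mor d = 0}"
    using h cmp_in_Hom[OF O(2,3) x r_mor_Hom_last h(1)] by simp
qed

lemma quot_space_fin_dim: "x \<in> Ob C \<Longrightarrow> vs.fin_dim (quot_space x)"
  and quot_dim_eq: "x \<in> Ob C \<Longrightarrow> quot_dim u x = int (vs.dim (quot_space x))"
proof -
  assume x: "x \<in> Ob C"
  have lin: "vs.linear_on (Hom C u x) (\<lambda>g. g \<star> r_mor d)"
    by (rule linear_on_precomp[OF _ u_Ob x r_mor_Hom_d]) (simp add: r_ob_Ob)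
  show "vs.fin_dim (quot_space x)"
    unfolding quot_space_eq[OF x] by (rule vs.rank_nullity(3)[OF fin_dim_Hom[OF u_Ob x] lin])
  show "quot_dim u x = int (vs.dim (quot_space x))"
    unfolding quot_dim_def Hom_through_Sigma_kernel[OF x]
    using vs.rank_nullity(1)[OF fin_dim_Hom[OF u_Ob x] lin] quot_space_eq[OF x] by simp
qed

text \<open>\<open>Hom(-, x)\<close> turns the resolution into a complex from \<open>Hom(t\<^sub>0, x)\<close> to \<open>Hom(t\<^sub>d, x)\<close> that is exact
  in between; its first kernel is \<open>Hom(u, x)\<close> in the quotient category and its last image
  is \<open>Hom\<^sup>[\<^sup>T\<^sup>](\<Sigma>\<^sup>-\<^sup>d u, x)\<close>.\<close>

lemma resolution_Euler_characteristic:
  assumes x: "x \<in> Ob C"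
  shows "(\<Sum>i\<le>d. (- 1) ^ i * int (vs.dim (Hom C (r_ob (d - i)) x)))
    = quot_dim u x + (- 1) ^ d * through_dim u x"
proof -
  have lin: "vs.linear_on (Hom C (r_ob (d - j)) x) (\<lambda>g. g \<star> r_in (d - j))" for j
    by (rule linear_on_precomp[OF r_src_Ob r_ob_Ob x r_in_Hom]) auto
  have "(\<Sum>i\<le>d. (- 1) ^ i * int (vs.dim (Hom C (r_ob (d - i)) x)))
    = int (vs.dim {g\<in>Hom C (r_ob (d - 0)) x. g \<star> r_in (d - 0) = 0})
      + (- 1) ^ d * int (vs.dim ((\<lambda>g. g \<star> r_in (d - d)) ` Hom C (r_ob (d - d)) x))"
  proof (rule vs.alternating_dim_sum)
    show "vs.fin_dim (Hom C (r_ob (d - j)) x)" for j using fin_dim_Hom r_ob_Ob x by simp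
    show "vs.linear_on (Hom C (r_ob (d - j)) x) (\<lambda>g. g \<star> r_in (d - j))" for j by (rule lin)
    fix j assume j: "j < d"
    then have "d - j = Suc (d - Suc j)" by simp
    then show "(\<lambda>g. g \<star> r_in (d - j)) ` Hom C (r_ob (d - j)) x
      = {g\<in>Hom C (r_ob (d - Suc j)) x. g \<star> r_in (d - Suc j) = 0}"
      using r_in_exact[OF x, of "d - Suc j"] by simp
  qed
  then show ?thesis
    using quot_dim_eq[OF x] Hom_through_tilt_eq[OF x] by (simp add: quot_space_def through_dim_def)
qed

end

lemma quot_dim_nonneg: "u \<in> Ob C \<Longrightarrow> x \<in> Ob C \<Longrightarrow> 0 \<le> quot_dim u x"
  by (metis resolution_exists quot_dim_eq of_nat_0_le_iff)

lemma Hom_through_postcomp: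
  assumes "A \<subseteq> Ob C" "u \<in> Ob C" "x \<in> Ob C" "y \<in> Ob C" "f \<in> Hom_through C A u x" "g \<in> Hom C x y"
  shows "g \<star> f \<in> Hom_through C A u y"
proof -
  obtain a b s where f: "f = b \<star> a" "s \<in> A" "a \<in> Hom C u s" "b \<in> Hom C s x"
    using assms(5) by (auto simp: Hom_through_def)
  then have s: "s \<in> Ob C" using assms by blast
  have "g \<star> f = (g \<star> b) \<star> a" using cmp_assoc[OF assms(2) s assms(3,4) f(3,4) assms(6)] f by simp
  then show ?thesis
    unfolding Hom_through_def using f cmp_in_Hom[OF s assms(3,4) f(4) assms(6)] by blast
qed

lemma Hom_through_subset:
  "A \<subseteq> Ob C \<Longrightarrow> u \<in> Ob C \<Longrightarrow> x \<in> Ob C \<Longrightarrow> Hom_through C A u x \<subseteq> Hom C u x"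
  unfolding Hom_through_def using cmp_in_Hom by blast

lemma Sigma_tilt_Ob: "SigO C ` tilt \<subseteq> Ob C"
  using tilt_Ob SigO_Ob by blast

lemma Hom_through_Sigma_subfunctor:
  assumes u: "u \<in> Ob C" shows "Hom_subfunctor u (Hom_through C (SigO C ` tilt) u)"
proof -
  obtain X where X: "resolves X u" using resolution_exists[OF u] by blast
  show ?thesis
    unfolding Hom_subfunctor_def
    using vs.fin_dim_subspace[OF Hom_through_Sigma_fin_dim[OF X]] Hom_through_subset[OF Sigma_tilt_Ob u]
      Hom_through_postcomp[OF Sigma_tilt_Ob u] by blast
qed

lemma Hom_through_tilt_subfunctor:
  assumes u: "u \<in> Ob C" shows "Hom_subfunctor (SigO_inv C u) (Hom_through C tilt (SigO_inv C u))"
proof -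
  obtain X where X: "resolves X u" using resolution_exists[OF u] by blast
  have t: "tilt \<subseteq> Ob C" using tilt_Ob by blast
  show ?thesis
    unfolding Hom_subfunctor_def
    using vs.fin_dim_subspace[OF Hom_through_tilt_fin_dim[OF X]]
      Hom_through_subset[OF t SigO_inv(1)[OF u]] Hom_through_postcomp[OF t SigO_inv(1)[OF u]] by blast
qed

lemma Hom_subfunctor_self: "u \<in> Ob C \<Longrightarrow> Hom_subfunctor u (Hom C u)"
  unfolding Hom_subfunctor_def using Hom_subspace cmp_in_Hom by blast

lemma quot_dim_sum:
  assumes u: "u \<in> Ob C" and s: "is_direct_sum C s a b"
  shows "quot_dim u s = quot_dim u a + quot_dim u b"
proof -
  obtain i j p q where bp: "is_biproduct C s a b i j p q" using s by (auto simp: is_direct_sum_def)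
  have sO: "s \<in> Ob C" using bp by (simp add: is_biproduct_def)
  obtain X where X: "resolves X u" using resolution_exists[OF u] by blast
  show ?thesis
    unfolding quot_dim_def
    using dim_subfunctor_biproduct[OF bp u Hom_subfunctor_self[OF u] fin_dim_Hom[OF u sO]]
      dim_subfunctor_biproduct[OF bp u Hom_through_Sigma_subfunctor[OF u] Hom_through_Sigma_fin_dim[OF X sO]]
    by simp
qed

lemma through_dim_sum:
  assumes u: "u \<in> Ob C" and s: "is_direct_sum C s a b"
  shows "through_dim u s = through_dim u a + through_dim u b"
proof -
  obtain i j p q where bp: "is_biproduct C s a b i j p q" using s by (auto simp: is_direct_sum_def)
  have sO: "s \<in> Ob C" using bp by (simp add: is_biproduct_def)
  obtain X where X: "resolves X u" using resolution_exists[OF u] by blast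
  show ?thesis
    unfolding through_dim_def
    using dim_subfunctor_biproduct[OF bp SigO_inv(1)[OF u] Hom_through_tilt_subfunctor[OF u]
      Hom_through_tilt_fin_dim[OF X sO]] by simp
qed

lemma subfunctor_zero_obj:
  assumes "Hom_subfunctor u I" "u \<in> Ob C" "zero_obj C z" shows "I z = {0}"
proof -
  have z: "z \<in> Ob C" "Hom C u z = {0}" using assms by (auto simp: zero_obj_def)
  have "vs.subspace (I z)" "I z \<subseteq> Hom C u z" using assms(1) z by (auto simp: Hom_subfunctor_def)
  then show ?thesis using z vs.subspace_0 by blast
qed

lemma dim_zero_obj:
  assumes u: "u \<in> Ob C" and z: "zero_obj C z"
  shows "quot_dim u z = 0" "through_dim u z = 0"
  unfolding quot_dim_def through_dim_def
  using subfunctor_zero_obj[OF Hom_through_Sigma_subfunctor[OF u] u z]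
    subfunctor_zero_obj[OF Hom_subfunctor_self[OF u] u z]
    subfunctor_zero_obj[OF Hom_through_tilt_subfunctor[OF u] SigO_inv(1)[OF u] z] by simp_all

end

section \<open>Additive functions on the split Grothendieck group\<close>

definition split_additive ::
  "('k, 'o, 'm::ab_group_add, 'z) lincat_scheme \<Rightarrow> 'o set \<Rightarrow> ('o \<Rightarrow> int) \<Rightarrow> bool" where
  "split_additive C S \<phi> \<longleftrightarrow>
     (\<forall>t\<in>S. \<forall>t'\<in>S. \<forall>t''\<in>S. is_direct_sum C t t' t'' \<longrightarrow> \<phi> t = \<phi> t' + \<phi> t'')"

text \<open>The homomorphism from the free abelian group to the integers that extends \<open>\<phi>\<close>, obtained from the
  universal property with the free abelian group on one generator as target.\<close>

definition frag_eval :: "('o \<Rightarrow> int) \<Rightarrow> ('o \<Rightarrow>\<^sub>0 int) \<Rightarrow> int" where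
  "frag_eval \<phi> x = Poly_Mapping.lookup (frag_extend (\<lambda>t. frag_cmul (\<phi> t) (frag_of ())) x) ()"

lemma frag_eval_simps [simp]:
  "frag_eval \<phi> 0 = 0" "frag_eval \<phi> (frag_of t) = \<phi> t" "frag_eval \<phi> (x + y) = frag_eval \<phi> x + frag_eval \<phi> y"
  "frag_eval \<phi> (- x) = - frag_eval \<phi> x" "frag_eval \<phi> (x - y) = frag_eval \<phi> x - frag_eval \<phi> y"
  "frag_eval \<phi> (frag_cmul k x) = k * frag_eval \<phi> x"
  by (simp_all add: frag_eval_def frag_extend_add frag_extend_minus frag_extend_diff frag_extend_cmul
      lookup_add lookup_minus)

lemma frag_eval_sum: "frag_eval \<phi> (\<Sum>i\<in>I. f i) = (\<Sum>i\<in>I. frag_eval \<phi> (f i))"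
  by (induction I rule: infinite_finite_induct) auto

lemma split_relations_generators:
  "{frag_of t - (frag_of t' + frag_of t'') | t t' t''.
      t \<in> S \<and> t' \<in> S \<and> t'' \<in> S \<and> is_direct_sum C t t' t''} \<subseteq> carrier (free_Abelian_group S)"
proof -
  have "Poly_Mapping.keys (frag_of t - (frag_of t' + frag_of t'')) \<subseteq> S"
    if "t \<in> S" "t' \<in> S" "t'' \<in> S" for t t' t'' :: 'a
    using keys_diff[of "frag_of t" "frag_of t' + frag_of t''"] keys_add[of "frag_of t'" "frag_of t''"] that
    by fastforce
  then show ?thesis by auto
qed

lemma split_relations_subgroup: "subgroup (split_relations C S) (free_Abelian_group S)"
  unfolding split_relations_def
  by (rule group.generate_is_subgroup[OF group_free_Abelian_group split_relations_generators])

lemma frag_eval_split_relations: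
  assumes "split_additive C S \<phi>" "x \<in> split_relations C S"
  shows "frag_eval \<phi> x = 0"
  using assms(2) unfolding split_relations_def
proof (induction rule: generate.induct)
  case (incl h)
  then show ?case using assms(1) by (auto simp: split_additive_def)
next
  case (inv h)
  then have "inv\<^bsub>free_Abelian_group S\<^esub> h = - h"
    using subsetD[OF split_relations_generators inv] by simp
  then show ?case using inv assms(1) by (auto simp: split_additive_def)
qed simp_all

lemma K0_finprod:
  assumes "finite I" "\<And>i. i \<in> I \<Longrightarrow> t i \<in> S"
  shows "finprod (K0_split C S) (\<lambda>i. K0_class C S (t i) [^]\<^bsub>K0_split C S\<^esub> (e i :: int)) I
    = split_relations C S #>\<^bsub>free_Abelian_group S\<^esub> (\<Sum>i\<in>I. frag_cmul (e i) (frag_of (t i)))"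
proof -
  let ?G = "free_Abelian_group S" and ?N = "split_relations C S"
  interpret G: comm_group ?G by (rule abelian_free_Abelian_group)
  interpret N: normal ?N ?G by (rule G.subgroup_imp_normal[OF split_relations_subgroup])
  interpret K: comm_group "?G Mod ?N" by (rule G.abelian_FactGroup[OF split_relations_subgroup])
  have pow: "K0_class C S (t i) [^]\<^bsub>?G Mod ?N\<^esub> e i = ?N #>\<^bsub>?G\<^esub> frag_cmul (e i) (frag_of (t i))"
    if "i \<in> I" for i
    using N.FactGroup_int_pow[of "frag_of (t i)" "e i"] assms(2)[OF that] by (simp add: K0_class_def)
  have c: "frag_cmul (e i) (frag_of (t i)) \<in> carrier ?G" if "i \<in> I" for i
    using that assms(2) keys_cmul[of "e i" "frag_of (t i)"] by force
  have car: "(\<Sum>i\<in>J. frag_cmul (e i) (frag_of (t i))) \<in> carrier ?G" if "J \<subseteq> I" for J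
    by (rule sum_closed_free_Abelian_group) (use that c in blast)
  have "J \<subseteq> I \<Longrightarrow> finprod (?G Mod ?N) (\<lambda>i. K0_class C S (t i) [^]\<^bsub>?G Mod ?N\<^esub> e i) J
    = ?N #>\<^bsub>?G\<^esub> (\<Sum>i\<in>J. frag_cmul (e i) (frag_of (t i)))" if "finite J" for J
    using that
  proof (induction J rule: finite_induct)
    case empty
    then show ?case using G.coset_mult_one[OF N.subset] 
      unfolding K.finprod_empty by (simp add: FactGroup_def)
  next
    case (insert j J)
    have cl: "K0_class C S (t i) [^]\<^bsub>?G Mod ?N\<^esub> e i \<in> carrier (?G Mod ?N)" if "i \<in> I" for i
      using pow[OF that] c[OF that] unfolding FactGroup_def RCOSETS_def by auto
    have "finprod (?G Mod ?N) (\<lambda>i. K0_class C S (t i) [^]\<^bsub>?G Mod ?N\<^esub> e i) (insert j J)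
      = K0_class C S (t j) [^]\<^bsub>?G Mod ?N\<^esub> e j \<otimes>\<^bsub>?G Mod ?N\<^esub>
        finprod (?G Mod ?N) (\<lambda>i. K0_class C S (t i) [^]\<^bsub>?G Mod ?N\<^esub> e i) J"
      by (rule K.finprod_insert) (use insert cl in auto)
    also have "\<dots> = (?N #>\<^bsub>?G\<^esub> frag_cmul (e j) (frag_of (t j)))
        <#>\<^bsub>?G\<^esub> (?N #>\<^bsub>?G\<^esub> (\<Sum>i\<in>J. frag_cmul (e i) (frag_of (t i))))"
      using insert pow by (simp add: FactGroup_def)
    also have "\<dots> = ?N #>\<^bsub>?G\<^esub> (frag_cmul (e j) (frag_of (t j))
        \<otimes>\<^bsub>?G\<^esub> (\<Sum>i\<in>J. frag_cmul (e i) (frag_of (t i))))"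
      by (rule N.rcos_sum) (use insert c car in auto)
    finally show ?case using insert by simp
  qed
  then show ?thesis using assms(1) unfolding K0_split_def by simp
qed

text \<open>The extension of \<open>\<phi>\<close> to the free abelian group kills the split relations, so it takes equal values on
  the alternating sums of the resolutions that are chosen in the definition of the index.\<close>

lemma ot_index_additive:
  assumes phi: "split_additive C S \<phi>"
    and ex: "\<exists>t. S_resolution C d S c t" "\<exists>t. S_resolution C d S c' t"
    and eq: "ot_index C d S c = ot_index C d S c'"
  obtains t t' where "S_resolution C d S c t" "S_resolution C d S c' t'"
    "(\<Sum>i\<le>d. (- 1) ^ i * \<phi> (t i)) = (\<Sum>i\<le>d. (- 1) ^ i * \<phi> (t' i))"
proof -
  let ?G = "free_Abelian_group S" and ?N = "split_relations C S"
  interpret G: comm_group ?G by (rule abelian_free_Abelian_group)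
  define r where "r = (\<lambda>c. SOME t. S_resolution C d S c t)"
  define w where "w = (\<lambda>c. \<Sum>i\<le>d. frag_cmul ((- 1) ^ i) (frag_of (r c i)))"
  have r: "S_resolution C d S c (r c)" "S_resolution C d S c' (r c')"
    unfolding r_def using someI_ex[OF ex(1)] someI_ex[OF ex(2)] .
  have S: "r x i \<in> S" if "x \<in> {c, c'}" "i \<le> d" for x i using r that by (auto simp: S_resolution_def)
  have ind: "ot_index C d S x = ?N #>\<^bsub>?G\<^esub> w x" if "x \<in> {c, c'}" for x
    unfolding ot_index_def Let_def w_def r_def[symmetric, THEN fun_cong]
    by (rule K0_finprod) (use S that in auto)
  have car: "w x \<in> carrier ?G" if "x \<in> {c, c'}" for x
    unfolding w_def by (rule sum_closed_free_Abelian_group) (use S[OF that] keys_cmul in fastforce)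
  have "w c' \<in> ?N #>\<^bsub>?G\<^esub> w c"
    by (rule G.repr_independenceD[OF split_relations_subgroup]) (use car ind eq in auto)
  then obtain n where n: "n \<in> ?N" "w c' = n + w c" by (auto simp: r_coset_def)
  then have "frag_eval \<phi> (w c') = frag_eval \<phi> (w c)" using frag_eval_split_relations[OF phi n(1)] by simp
  then show ?thesis using that[OF r] by (simp add: w_def frag_eval_sum)
qed

context oppermann_thomas_category
begin

lemma split_additive_dim_Hom:
  assumes x: "x \<in> Ob C" shows "split_additive C tilt (\<lambda>t. int (vs.dim (Hom C t x)))"
  unfolding split_additive_def is_direct_sum_def
proof safe
  fix t t' t'' i j p q
  assume bp: "is_biproduct C t t' t'' i j p q"
  then have "t \<in> Ob C" by (simp add: is_biproduct_def)
  then show "int (vs.dim (Hom C t x)) = int (vs.dim (Hom C t' x)) + int (vs.dim (Hom C t'' x))"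
    using dim_Hom_biproduct_left[OF bp x fin_dim_Hom[OF _ x]] by simp
qed

lemma index_determines_Euler_characteristic:
  assumes c: "c \<in> Ob C" "c' \<in> Ob C" and eq: "ot_index C d tilt c = ot_index C d tilt c'"
    and x: "x \<in> Ob C"
  shows "quot_dim c x + (- 1) ^ d * through_dim c x = quot_dim c' x + (- 1) ^ d * through_dim c' x"
proof -
  obtain t t' where t: "S_resolution C d tilt c t" "S_resolution C d tilt c' t'"
    "(\<Sum>i\<le>d. (- 1) ^ i * int (vs.dim (Hom C (t i) x))) = (\<Sum>i\<le>d. (- 1) ^ i * int (vs.dim (Hom C (t' i) x)))"
    using ot_index_additive[OF split_additive_dim_Hom[OF x] S_resolution_exists[OF c(1)]
        S_resolution_exists[OF c(2)] eq] by blast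
  obtain X where X: "resolves X c" "\<And>i. i \<le> d \<Longrightarrow> seq_ob C X (d - i) = t i"
    using S_resolution_resolves[OF t(1)] by blast
  obtain X' where X': "resolves X' c'" "\<And>i. i \<le> d \<Longrightarrow> seq_ob C X' (d - i) = t' i"
    using S_resolution_resolves[OF t(2)] by blast
  show ?thesis
    using resolution_Euler_characteristic[OF X(1) x] resolution_Euler_characteristic[OF X'(1) x] t(3)
      X(2) X'(2) by simp
qed

end

section \<open>Indecomposables are determined by dimensions in the quotient category\<close>

context oppermann_thomas_category
begin

context
  fixes X u Y
  assumes X: "resolves X u" and Y: "Y \<in> Ang C"
    and mono: "\<And>s a. s \<in> tilt \<Longrightarrow> a \<in> Hom C s (seq_ob C Y 0) \<Longrightarrow> seq_mor C Y 0 \<star> a = 0 \<Longrightarrow> a = 0"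
begin

text \<open>A chase in the double complex of the spaces \<open>Hom(t\<^sub>i, c\<^sup>j)\<close>, where \<open>t\<^sub>i\<close> is object number \<open>k = d - i\<close> of the
  resolution of \<open>u\<close> and \<open>c\<^sup>j\<close> is object number \<open>j\<close> of \<open>Y\<close>.  A cocycle \<open>a\<close> is lifted to \<open>b\<close> along \<open>Y\<close>.  The vertical
  differential of \<open>b\<close> is a cocycle one step further left and one step further down, so by induction
  it is the image of some vertical cocycle \<open>e\<close>.  As the columns are exact below the top, \<open>e\<close> is the
  differential of some \<open>g\<close>, and subtracting the image of \<open>g\<close> from \<open>b\<close> gives a lift that is a vertical
  cocycle.  The bound \<open>j \<le> k\<close> means that the chase reaches \<open>c\<^sup>0\<close>, where the assumption \<open>mono\<close> ends it,
  before it runs out of rows.\<close>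

lemma double_complex_exact:
  assumes "j \<le> k" "k \<le> d" "a \<in> Hom C (seq_ob C X k) (seq_ob C Y j)"
    and "seq_mor C Y j \<star> a = 0" "a \<star> r_in X u k = 0"
  shows "if j = 0 then a = 0 else
    \<exists>b\<in>Hom C (seq_ob C X k) (seq_ob C Y (j - 1)). seq_mor C Y (j - 1) \<star> b = a \<and> b \<star> r_in X u k = 0"
  using assms
proof (induction j arbitrary: k a)
  case 0
  then show ?case using mono[OF r_ob_tilt[OF X, of k]] by simp
next
  case (Suc j)
  obtain l where k: "k = Suc l" using Suc.prems(1) by (cases k) auto
  have l: "j \<le> l" "l \<le> d" using Suc.prems k by auto
  have O: "seq_ob C X l \<in> Ob C" "seq_ob C X k \<in> Ob C" "seq_ob C Y j \<in> Ob C" "seq_ob C Y (Suc j) \<in> Ob C"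
    "seq_ob C Y (Suc (Suc j)) \<in> Ob C"
    using r_ob_Ob[OF X] seq_ob_Ob[OF Y] l Suc.prems(2) by simp_all
  have m: "seq_mor C X l \<in> Hom C (seq_ob C X l) (seq_ob C X k)" using r_mor_Hom[OF X, of l] k Suc.prems by simp
  have n: "seq_mor C Y j \<in> Hom C (seq_ob C Y j) (seq_ob C Y (Suc j))"
    "seq_mor C Y (Suc j) \<in> Hom C (seq_ob C Y (Suc j)) (seq_ob C Y (Suc (Suc j)))"
    using seq_mor_Hom[OF Y] l by simp_all
  have rk: "r_in X u k = seq_mor C X l" using r_in_Suc[OF X] k by simp
  obtain b where b: "b \<in> Hom C (seq_ob C X k) (seq_ob C Y j)" "a = seq_mor C Y j \<star> b"
    using angle_exact_cov[OF Y O(2) _ Suc.prems(3,4)] l by auto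
  define c where "c = b \<star> seq_mor C X l"
  have c: "c \<in> Hom C (seq_ob C X l) (seq_ob C Y j)" unfolding c_def by (rule cmp_in_Hom[OF O(1,2,3) m b(1)])
  have "seq_mor C Y j \<star> c = a \<star> seq_mor C X l"
    unfolding c_def b(2) by (rule cmp_assoc[OF O(1,2,3,4) m b(1) n(1), symmetric])
  then have c1: "seq_mor C Y j \<star> c = 0" using Suc.prems(5) rk by simp
  have c2: "c \<star> r_in X u l = 0"
    using r_in_exact[OF X O(3) l(2)] b(1) k unfolding c_def by auto
  have "\<exists>e\<in>Hom C (seq_ob C X k) (seq_ob C Y j). seq_mor C Y j \<star> e = a \<and> e \<star> seq_mor C X l = 0"
  proof (cases j)
    case 0
    then have "c = 0" using Suc.IH[OF l c c1 c2] by simp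
    then show ?thesis using b unfolding c_def by blast
  next
    case (Suc j')
    have Oj: "seq_ob C Y j' \<in> Ob C" using seq_ob_Ob[OF Y] l Suc by simp
    have nj: "seq_mor C Y j' \<in> Hom C (seq_ob C Y j') (seq_ob C Y j)" using seq_mor_Hom[OF Y, of j'] l Suc by simp
    obtain e where e: "e \<in> Hom C (seq_ob C X l) (seq_ob C Y j')" "seq_mor C Y j' \<star> e = c" "e \<star> r_in X u l = 0"
      using Suc.IH[OF l c c1 c2] Suc by auto
    obtain g where g: "g \<in> Hom C (seq_ob C X k) (seq_ob C Y j')" "e = g \<star> seq_mor C X l"
      using r_in_exact[OF X Oj l(2)] e(1,3) k by auto
    let ?g = "seq_mor C Y j' \<star> g"
    have g': "?g \<in> Hom C (seq_ob C X k) (seq_ob C Y j)" by (rule cmp_in_Hom[OF O(2) Oj O(3) g(1) nj])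
    have "seq_mor C Y j \<star> ?g = (seq_mor C Y j \<star> seq_mor C Y j') \<star> g"
      by (rule cmp_assoc[OF O(2) Oj O(3,4) g(1) nj n(1), symmetric])
    also have "\<dots> = 0" using angle_cmp_zero[OF Y, of j'] l Suc cmp_zero_left[OF O(2) Oj O(4) g(1)] by simp
    finally have "seq_mor C Y j \<star> (b - ?g) = a"
      using cmp_diff_right[OF O(2,3,4) b(1) g' n(1)] b(2) by simp
    moreover have "?g \<star> seq_mor C X l = c"
      using cmp_assoc[OF O(1,2) Oj O(3) m g(1) nj] g(2) e(2) by simp
    then have "(b - ?g) \<star> seq_mor C X l = 0"
      using cmp_diff_left[OF O(1,2,3) m b(1) g'] by (simp add: c_def)
    ultimately show ?thesis using Hom_diff[OF O(2,3) b(1) g'] by blast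
  qed
  then show ?case using rk by simp
qed

text \<open>The sequence of the spaces \<open>Hom(u, c\<^sup>j)\<close> in the quotient category, \<open>j = 0, \<dots>, d\<close>, is exact and starts
  with \<open>0\<close>, so the dimensions of its terms determine the rank of the map from the last one.\<close>

lemma quot_space_rank:
  "(\<Sum>j\<le>d. (- 1) ^ j * quot_dim u (seq_ob C Y j))
    = (- 1) ^ d * int (vs.dim ((\<lambda>a. seq_mor C Y d \<star> a) ` quot_space X u (seq_ob C Y d)))"
proof -
  have O: "seq_ob C Y j \<in> Ob C" if "j \<le> Suc d" for j using seq_ob_Ob[OF Y] that by simp
  have n: "seq_mor C Y j \<in> Hom C (seq_ob C Y j) (seq_ob C Y (Suc j))" if "j \<le> d" for j
    using seq_mor_Hom[OF Y] that by simp
  have Xd: "seq_ob C X d \<in> Ob C" using r_ob_Ob[OF X] by simp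
  have rin: "r_in X u d \<in> Hom C (seq_ob C X (d - 1)) (seq_ob C X d)" "seq_ob C X (d - 1) \<in> Ob C"
    using r_in_Hom[OF X, of d] r_ob_Ob[OF X, of "d - 1"] d_pos by simp_all
  have "(\<Sum>j\<le>d. (- 1) ^ j * int (vs.dim (quot_space X u (seq_ob C Y j))))
    = int (vs.dim {a\<in>quot_space X u (seq_ob C Y 0). seq_mor C Y 0 \<star> a = 0})
      + (- 1) ^ d * int (vs.dim ((\<lambda>a. seq_mor C Y d \<star> a) ` quot_space X u (seq_ob C Y d)))"
  proof (rule vs.alternating_dim_sum)
    fix j assume j: "j \<le> d"
    show "vs.fin_dim (quot_space X u (seq_ob C Y j))" using quot_space_fin_dim[OF X] O j by simp
    show "vs.linear_on (quot_space X u (seq_ob C Y j)) (\<lambda>a. seq_mor C Y j \<star> a)"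
      by (rule vs.linear_on_subset[OF linear_on_postcomp[OF Xd _ _ n[OF j]]])
        (use O j in \<open>auto simp: quot_space_def[OF X]\<close>)
  next
    fix j assume j: "j < d"
    show "(\<lambda>a. seq_mor C Y j \<star> a) ` quot_space X u (seq_ob C Y j)
      = {a\<in>quot_space X u (seq_ob C Y (Suc j)). seq_mor C Y (Suc j) \<star> a = 0}"
    proof (intro equalityI subsetI)
      fix a assume "a \<in> {a\<in>quot_space X u (seq_ob C Y (Suc j)). seq_mor C Y (Suc j) \<star> a = 0}"
      then show "a \<in> (\<lambda>a. seq_mor C Y j \<star> a) ` quot_space X u (seq_ob C Y j)"
        using double_complex_exact[of "Suc j" d a] j by (auto simp: quot_space_def[OF X])
    next
      fix a assume "a \<in> (\<lambda>a. seq_mor C Y j \<star> a) ` quot_space X u (seq_ob C Y j)"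
      then obtain b where b: "b \<in> Hom C (seq_ob C X d) (seq_ob C Y j)" "b \<star> r_in X u d = 0"
        and a: "a = seq_mor C Y j \<star> b" by (auto simp: quot_space_def[OF X])
      have Oj: "seq_ob C Y j \<in> Ob C" "seq_ob C Y (Suc j) \<in> Ob C" "seq_ob C Y (Suc (Suc j)) \<in> Ob C"
        using O j by simp_all
      have nj: "seq_mor C Y j \<in> Hom C (seq_ob C Y j) (seq_ob C Y (Suc j))"
        "seq_mor C Y (Suc j) \<in> Hom C (seq_ob C Y (Suc j)) (seq_ob C Y (Suc (Suc j)))" using n j by simp_all
      have "a \<star> r_in X u d = 0"
        using a b(2) cmp_assoc[OF rin(2) Xd Oj(1,2) rin(1) b(1) nj(1)] cmp_zero_right[OF rin(2) Oj(1,2) nj(1)]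
        by simp
      moreover have "seq_mor C Y (Suc j) \<star> a = 0"
        using a cmp_assoc[OF Xd Oj b(1) nj] angle_cmp_zero[OF Y, of j] j cmp_zero_left[OF Xd Oj(1,3) b(1)]
        by simp
      moreover have "a \<in> Hom C (seq_ob C X d) (seq_ob C Y (Suc j))"
        unfolding a by (rule cmp_in_Hom[OF Xd Oj(1,2) b(1) nj(1)])
      ultimately show "a \<in> {a\<in>quot_space X u (seq_ob C Y (Suc j)). seq_mor C Y (Suc j) \<star> a = 0}"
        by (simp add: quot_space_def[OF X])
    qed
  qed
  moreover have "{a\<in>quot_space X u (seq_ob C Y 0). seq_mor C Y 0 \<star> a = 0} = {0}"
    using mono[OF r_ob_tilt[OF X, of d]] Hom_zero[OF Xd O[of 0]] cmp_zero_left[OF rin(2) Xd O[of 0] rin(1)]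
      cmp_zero_right[OF Xd O[of 0] O[of 1]] n[of 0] by (auto simp: quot_space_def[OF X])
  ultimately show ?thesis using quot_dim_eq[OF X O] by simp
qed

end

text \<open>Objects of \<open>\<T>\<close> are summands of copies of \<open>T\<close>, so morphisms out of them can be tested on \<open>T\<close>.\<close>

lemma tilt_morphism_zero:
  assumes s: "s \<in> tilt" and x: "x \<in> Ob C" and g: "g \<in> Hom C s x"
    and zero: "\<And>m. m \<in> Hom C T s \<Longrightarrow> g \<star> m = 0"
  shows "g = 0"
proof -
  obtain n P y i j p q where P: "is_copower C n T P" and bp: "is_biproduct C P s y i j p q"
    using s by (auto simp: add_closure_def is_direct_sum_def)
  obtain \<iota> \<pi> where \<iota>: "\<And>k. k < n \<Longrightarrow> \<iota> k \<in> Hom C T P" "\<And>k. k < n \<Longrightarrow> \<pi> k \<in> Hom C P T"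
    "(\<Sum>k<n. \<iota> k \<star> \<pi> k) = idm C P"
    using P by (auto simp: is_copower_def)
  note [simp] = bp[unfolded is_biproduct_def] x g T_Ob \<iota>(1,2)
  have gp: "g \<star> p \<in> Hom C P x" using cmp_in_Hom[of P s x p g] by simp
  have "(g \<star> p) \<star> (\<iota> k \<star> \<pi> k) = 0" if k: "k < n" for k
  proof -
    have "(g \<star> p) \<star> \<iota> k = 0"
      using k cmp_assoc[of T P s x "\<iota> k" p g] zero[of "p \<star> \<iota> k"] cmp_in_Hom[of T P s "\<iota> k" p] by simp
    then show ?thesis
      using k gp cmp_assoc[of P T P x "\<pi> k" "\<iota> k" "g \<star> p"] cmp_zero_left[of P T x "\<pi> k"] by simp
  qed
  then have "(g \<star> p) \<star> (\<Sum>k<n. \<iota> k \<star> \<pi> k) = 0"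
    using cmp_sum_right[of P P x "g \<star> p" "{..<n}" "\<lambda>k. \<iota> k \<star> \<pi> k"] gp cmp_in_Hom[of P T P] by simp
  then have "g \<star> p = 0" using \<iota>(3) cmp_idm_right[of P x "g \<star> p"] gp by simp
  then show ?thesis
    using cmp_assoc[of s P s x i p g] cmp_idm_right[of s x g] cmp_zero_left[of s P x i] by simp
qed

lemma quot_dim_zero_of_unit_through:
  assumes c: "c \<in> Ob C" and w: "w \<in> Hom_through C (SigO C ` tilt) c c" "End_unit c w"
  shows "quot_dim c c = 0"
proof -
  obtain k where k: "k \<in> Hom C c c" "k \<star> w = idm C c" and wH: "w \<in> Hom C c c"
    using w by (auto simp: End_unit_def)
  have "g \<in> Hom_through C (SigO C ` tilt) c c" if g: "g \<in> Hom C c c" for g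
  proof -
    have "g = (g \<star> k) \<star> w" using cmp_assoc[OF c c c c wH k(1) g] k(2) cmp_idm_right[OF c c g] by simp
    then show ?thesis
      using Hom_through_postcomp[OF Sigma_tilt_Ob c c c w(1) cmp_in_Hom[OF c c c k(1) g]] by simp
  qed
  then have "Hom_through C (SigO C ` tilt) c c = Hom C c c"
    using Hom_through_subset[OF Sigma_tilt_Ob c c] by blast
  then show ?thesis by (simp add: quot_dim_def)
qed

text \<open>The dual of Bongartz's argument for modules.  The approximation \<open>f\<close> is by \<open>c'\<close> and \<open>\<Sigma>\<^sup>d T\<close>
  together: factoring the morphisms from \<open>\<Sigma>\<^sup>d T\<close> to \<open>c\<close> through \<open>f\<close> makes \<open>Hom(s, c\<^sup>0) \<rightarrow> Hom(s, c\<^sup>1)\<close> injective for \<open>s\<close> in \<open>\<T>\<close>.\<close>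

lemma isomorphic_if_quot_dim_eq:
  assumes c: "indecomposable C c" and c': "indecomposable C c'"
    and dim: "\<And>x. x \<in> Ob C \<Longrightarrow> quot_dim c x = quot_dim c' x" and nz: "quot_dim c c \<noteq> 0"
  shows "isomorphic_obj C c c'"
proof -
  have O: "c \<in> Ob C" "c' \<in> Ob C" using c c' by (simp_all add: indecomposable_def)
  let ?A = "{c', SigO C T}"
  have A: "finite ?A" "?A \<subseteq> Ob C" using O SigO_Ob T_Ob by auto
  obtain Q f where Q: "Q \<in> finite_sums ?A" and f: "f \<in> Hom C Q c"
    and fact: "\<And>a h. a \<in> ?A \<Longrightarrow> h \<in> Hom C a c \<Longrightarrow> \<exists>k\<in>Hom C a Q. h = f \<star> k"
    using right_approximation[OF A O(1)] by blast
  have QO: "Q \<in> Ob C" using finite_sums_Ob[OF Q] .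
  obtain Y where Y: "Y \<in> Ang C" "seq_ob C Y d = Q" "seq_ob C Y (d + 1) = c" "seq_mor C Y d = f"
    using angle_with_penultimate_morphism[OF QO O(1) f] by blast
  have Y0: "seq_ob C Y 0 \<in> Ob C" "SigO C (seq_ob C Y 0) \<in> Ob C" using seq_ob_Ob[OF Y(1)] SigO_Ob by simp_all
  have last: "seq_mor C Y (d + 1) \<in> Hom C c (SigO C (seq_ob C Y 0))"
    using seq_mor_Hom[OF Y(1), of "d + 1"] Y(3) seq_ob_Sigma[OF Y(1)] by simp
  \<comment> \<open>A morphism \<open>a\<close> from \<open>s\<close> killed by \<open>c\<^sup>0 \<rightarrow> c\<^sup>1\<close> satisfies \<open>\<Sigma>\<^sup>d a = \<eta> h\<close> with \<open>h : \<Sigma>\<^sup>d s \<rightarrow> c\<close> and \<open>\<eta> : c \<rightarrow> \<Sigma>\<^sup>d c\<^sup>0\<close>;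
    restricted to \<open>\<Sigma>\<^sup>d T\<close>, \<open>h\<close> factors through \<open>f\<close>, and \<open>\<eta> f = 0\<close>.\<close>
  have mono: "a = 0" if s: "s \<in> tilt" and a: "a \<in> Hom C s (seq_ob C Y 0)" "seq_mor C Y 0 \<star> a = 0" for s a
  proof (rule tilt_morphism_zero[OF s Y0(1) a(1)])
    fix m assume m: "m \<in> Hom C T s"
    have sO: "s \<in> Ob C" "SigO C s \<in> Ob C" "SigO C T \<in> Ob C" using s tilt_Ob SigO_Ob T_Ob by simp_all
    obtain h where h: "h \<in> Hom C (SigO C s) c" "SigM C a = seq_mor C Y (d + 1) \<star> h"
      using angle_exact_cov_first[OF Y(1) sO(1) a] Y(3) by auto
    have Sm: "SigM C m \<in> Hom C (SigO C T) (SigO C s)" using SigM_Hom[OF T_Ob sO(1) m] .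
    obtain k where k: "k \<in> Hom C (SigO C T) Q" "h \<star> SigM C m = f \<star> k"
      using fact[of "SigO C T" "h \<star> SigM C m"] cmp_in_Hom[OF sO(3,2) O(1) Sm h(1)] by auto
    have "SigM C (a \<star> m) = seq_mor C Y (d + 1) \<star> (f \<star> k)"
      using SigM_cmp[OF T_Ob sO(1) Y0(1) m a(1)] h(2) k(2) cmp_assoc[OF sO(3,2) O(1) Y0(2) Sm h(1) last] by simp
    also have "\<dots> = (seq_mor C Y (d + 1) \<star> f) \<star> k"
      by (rule cmp_assoc[OF sO(3) QO O(1) Y0(2) k(1) f last, symmetric])
    also have "\<dots> = 0"
      using angle_cmp_zero[OF Y(1) le_refl] Y(4) cmp_zero_left[OF sO(3) QO Y0(2) k(1)] by simp
    finally show "a \<star> m = 0"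
      using SigM_inj[OF T_Ob Y0(1) cmp_in_Hom[OF T_Ob sO(1) Y0(1) m a(1)] Hom_zero[OF T_Ob Y0(1)]] by simp
  qed
  obtain X X' where X: "resolves X c" and X': "resolves X' c'" using resolution_exists O by blast
  have YO: "seq_ob C Y j \<in> Ob C" if "j \<le> d" for j using seq_ob_Ob[OF Y(1)] that by simp
  have "(- 1) ^ d * int (vs.dim ((\<lambda>a. f \<star> a) ` quot_space X c Q))
    = (- 1) ^ d * int (vs.dim ((\<lambda>a. f \<star> a) ` quot_space X' c' Q))"
    using quot_space_rank[OF X Y(1) mono] quot_space_rank[OF X' Y(1) mono] dim YO Y(2,4) by simp
  then have rank: "vs.dim ((\<lambda>a. f \<star> a) ` quot_space X c Q) = vs.dim ((\<lambda>a. f \<star> a) ` quot_space X' c' Q)"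
    by simp
  have sub: "(\<lambda>a. f \<star> a) ` quot_space Z v Q \<subseteq> quot_space Z v c" if Z: "resolves Z v" for Z v
  proof (rule image_subsetI)
    fix a assume "a \<in> quot_space Z v Q"
    then obtain g where g: "g \<in> Hom C v Q" "a = g \<star> seq_mor C Z d" using quot_space_eq[OF Z QO] by auto
    have "f \<star> a = (f \<star> g) \<star> seq_mor C Z d"
      using g cmp_assoc[OF r_ob_Ob[OF Z le_refl] u_Ob[OF Z] QO O(1) r_mor_Hom_d[OF Z] g(1) f] by simp
    then show "f \<star> a \<in> quot_space Z v c"
      using quot_space_eq[OF Z O(1)] cmp_in_Hom[OF u_Ob[OF Z] QO O(1) g(1) f] by blast
  qed
  \<comment> \<open>For \<open>c'\<close> the map induced by \<open>f\<close> is onto by the choice of \<open>f\<close>; equal ranks make it onto for \<open>c\<close>.\<close>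
  have "quot_space X' c' c \<subseteq> (\<lambda>a. f \<star> a) ` quot_space X' c' Q"
  proof
    fix a assume "a \<in> quot_space X' c' c"
    then obtain g where g: "g \<in> Hom C c' c" "a = g \<star> seq_mor C X' d" using quot_space_eq[OF X' O(1)] by auto
    obtain k where k: "k \<in> Hom C c' Q" "g = f \<star> k" using fact g(1) by auto
    have "a = f \<star> (k \<star> seq_mor C X' d)"
      using g k cmp_assoc[OF r_ob_Ob[OF X' le_refl] O(2) QO O(1) r_mor_Hom_d[OF X'] k(1) f] by simp
    then show "a \<in> (\<lambda>a. f \<star> a) ` quot_space X' c' Q" using quot_space_eq[OF X' QO] k(1) by blast
  qed
  then have "(\<lambda>a. f \<star> a) ` quot_space X' c' Q = quot_space X' c' c" using sub[OF X'] by blast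
  then have "vs.dim (quot_space X c c) \<le> vs.dim ((\<lambda>a. f \<star> a) ` quot_space X c Q)"
    using rank dim[OF O(1)] quot_dim_eq[OF X O(1)] quot_dim_eq[OF X' O(1)] by simp
  moreover have "vs.subspace ((\<lambda>a. f \<star> a) ` quot_space X c Q)"
  proof (rule vs.fin_dim_subspace[OF vs.rank_nullity(3)[OF quot_space_fin_dim[OF X QO]]])
    show "vs.linear_on (quot_space X c Q) (\<lambda>a. f \<star> a)"
      by (rule vs.linear_on_subset[OF linear_on_postcomp[OF r_ob_Ob[OF X le_refl] QO O(1) f]])
        (auto simp: quot_space_def[OF X])
  qed
  ultimately have onto: "(\<lambda>a. f \<star> a) ` quot_space X c Q = quot_space X c c"
    using vs.fin_dim_eqI[OF quot_space_fin_dim[OF X O(1)] _ sub[OF X]] by blast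
  have Xd: "seq_ob C X d \<in> Ob C" "seq_mor C X d \<in> Hom C (seq_ob C X d) c"
    using r_ob_Ob[OF X] r_mor_Hom_d[OF X] by simp_all
  have "seq_mor C X d \<in> quot_space X c c"
    using quot_space_eq[OF X O(1)] cmp_idm_left[OF Xd(1) O(1) Xd(2)] idm_in_Hom[OF O(1)] by force
  then obtain h where h: "h \<in> Hom C c Q" "seq_mor C X d = f \<star> (h \<star> seq_mor C X d)"
    using onto quot_space_eq[OF X QO] by auto
  \<comment> \<open>Modulo morphisms that factor through \<open>\<Sigma>\<^sup>d \<T>\<close>, the identity of \<open>c\<close> factors through \<open>Q\<close>.\<close>
  define w where "w = idm C c - f \<star> h"
  have fh: "f \<star> h \<in> Hom C c c" by (rule cmp_in_Hom[OF O(1) QO O(1) h(1) f])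
  then have wH: "w \<in> Hom C c c" unfolding w_def using idm_in_Hom Hom_diff O by blast
  have "w \<star> seq_mor C X d = 0"
    unfolding w_def using cmp_diff_left[OF Xd(1) O(1) O(1) Xd(2) idm_in_Hom[OF O(1)] fh]
      cmp_idm_left[OF Xd(1) O(1) Xd(2)] cmp_assoc[OF Xd(1) O(1) QO O(1) Xd(2) h(1) f] h(2) by simp
  then have wt: "w \<in> Hom_through C (SigO C ` tilt) c c" using Hom_through_Sigma_kernel[OF X O(1)] wH by simp
  have id_unit: "End_unit c (idm C c)"
    unfolding End_unit_def using idm_in_Hom[OF O(1)] cmp_idm_left[OF O(1) O(1)] by blast
  then have "End_unit c (f \<star> h + w)" by (simp add: w_def)
  then have "End_unit c (f \<star> h) \<or> End_unit c w" by (rule indecomposable_unit_sum[OF c fh wH])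
  then have "End_unit c (f \<star> h)" using quot_dim_zero_of_unit_through[OF O(1) wt] nz by blast
  then obtain a f' g' where a: "a \<in> ?A" "f' \<in> Hom C c a" "g' \<in> Hom C a c" "g' \<star> f' = idm C c"
    using unit_through_finite_sums[OF c Q h(1) f] by blast
  have "a \<noteq> SigO C T"
  proof
    assume "a = SigO C T"
    then have "g' \<star> f' \<in> Hom_through C (SigO C ` tilt) c c"
      using a(2,3) T_in_tilt unfolding Hom_through_def by blast
    then have "idm C c \<in> Hom_through C (SigO C ` tilt) c c" by (simp add: a(4))
    then show False using quot_dim_zero_of_unit_through[OF O(1) _ id_unit] nz by blast
  qed
  then show ?thesis using indecomposable_retract_iso[OF O(1) _ c'] a c by (auto simp: indecomposable_def)
qed

end

section \<open>Indecomposables and their index\<close>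

context angulated_category
begin

lemma SigM_biproduct:
  assumes "is_biproduct C s a b i j p q"
  shows "is_biproduct C (SigO C s) (SigO C a) (SigO C b) (SigM C i) (SigM C j) (SigM C p) (SigM C q)"
proof -
  note [simp] = assms[unfolded is_biproduct_def]
  have H: "i \<star> p \<in> Hom C s s" "j \<star> q \<in> Hom C s s" using cmp_in_Hom[of s a s p i] cmp_in_Hom[of s b s q j] by simp_all
  show ?thesis
    unfolding is_biproduct_def
    using SigM_cmp[of a s a i p] SigM_cmp[of b s b j q] SigM_cmp[of b s a j p] SigM_cmp[of a s b i q]
      SigM_cmp[of s a s p i] SigM_cmp[of s b s q j] SigM_add[of s s "i \<star> p" "j \<star> q"] H
    by (simp add: SigO_Ob SigM_Hom SigM_idm)
qed

lemma SigO_zero_obj: "x \<in> Ob C \<Longrightarrow> zero_obj C (SigO C x) \<longleftrightarrow> zero_obj C x"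
  unfolding zero_obj_iff by (metis SigM_idm SigM_inj SigM_zero SigO_Ob idm_in_Hom Hom_zero)

lemma SigO_inv_indecomposable:
  assumes c: "indecomposable C c" shows "indecomposable C (SigO_inv C c)"
proof -
  have O: "c \<in> Ob C" "SigO_inv C c \<in> Ob C" "SigO C (SigO_inv C c) = c"
    using c SigO_inv by (simp_all add: indecomposable_def)
  have "zero_obj C a \<or> zero_obj C b" if ab: "is_direct_sum C (SigO_inv C c) a b" for a b
  proof -
    have "is_direct_sum C c (SigO C a) (SigO C b)" "a \<in> Ob C" "b \<in> Ob C"
      using ab SigM_biproduct O(3) unfolding is_direct_sum_def by (metis, auto simp: is_biproduct_def)
    then show ?thesis using c SigO_zero_obj by (auto simp: indecomposable_def)
  qed
  then show ?thesis using c O SigO_zero_obj[OF O(2)] by (auto simp: indecomposable_def)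
qed

lemma SigO_isomorphic:
  assumes "isomorphic_obj C x y" shows "isomorphic_obj C (SigO C x) (SigO C y)"
proof -
  obtain f g where O: "x \<in> Ob C" "y \<in> Ob C" and fg: "f \<in> Hom C x y" "g \<in> Hom C y x"
    "g \<star> f = idm C x" "f \<star> g = idm C y"
    using assms by (auto simp: isomorphic_obj_def)
  have "SigM C g \<star> SigM C f = idm C (SigO C x)" "SigM C f \<star> SigM C g = idm C (SigO C y)"
    using SigM_cmp[of x y x f g] SigM_cmp[of y x y g f] O fg SigM_idm by simp_all
  then show ?thesis unfolding isomorphic_obj_def using SigM_Hom O fg SigO_Ob by blast
qed

end

context oppermann_thomas_category
begin

text \<open>The identity of \<open>c\<close> factors through some \<open>\<Sigma>\<^sup>d s\<close>, so \<open>\<Sigma>\<^sup>-\<^sup>d c\<close> is a retract of \<open>s\<close>.\<close>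

lemma quot_dim_zero_shift_tilt:
  assumes c: "c \<in> Ob C" and z: "quot_dim c c = 0"
  shows "SigO_inv C c \<in> tilt"
proof -
  let ?t = "SigO_inv C c"
  have t: "?t \<in> Ob C" "SigO C ?t = c" using SigO_inv[OF c] by simp_all
  obtain X where X: "resolves X c" using resolution_exists[OF c] by blast
  have fin: "vs.fin_dim (Hom C c c)" "vs.subspace (Hom_through C (SigO C ` tilt) c c)"
    using fin_dim_Hom[OF c c] vs.fin_dim_subspace[OF Hom_through_Sigma_fin_dim[OF X c]] by simp_all
  have "Hom_through C (SigO C ` tilt) c c = Hom C c c"
    by (rule vs.fin_dim_eqI[OF fin Hom_through_subset[OF Sigma_tilt_Ob c c]])
      (use z in \<open>simp add: quot_dim_def\<close>)
  then have "idm C c \<in> Hom_through C (SigO C ` tilt) c c" using idm_in_Hom[OF c] by simp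
  then obtain f g s where s: "s \<in> tilt" and f: "f \<in> Hom C c (SigO C s)" and g: "g \<in> Hom C (SigO C s) c"
    and gf: "idm C c = g \<star> f"
    by (auto simp: Hom_through_def)
  have sO: "s \<in> Ob C" using tilt_Ob s by simp
  obtain f' where f': "f' \<in> Hom C ?t s" "f = SigM C f'" using SigM_surj[OF t(1) sO] f t(2) by metis
  obtain g' where g': "g' \<in> Hom C s ?t" "g = SigM C g'" using SigM_surj[OF sO t(1)] g t(2) by metis
  have "SigM C (g' \<star> f') = SigM C (idm C ?t)"
    using SigM_cmp[OF t(1) sO t(1) f'(1) g'(1)] f' g' gf SigM_idm[OF t(1)] t(2) by simp
  then have "g' \<star> f' = idm C ?t"
    using SigM_inj[OF t(1) t(1) cmp_in_Hom[OF t(1) sO t(1) f'(1) g'(1)] idm_in_Hom[OF t(1)]] by simp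
  then show ?thesis by (rule tilt_retract[OF s t(1) f'(1) g'(1)])
qed

text \<open>A morphism out of \<open>t \<in> \<T>\<close> always factors through \<open>\<T>\<close>, and by rigidity it factors through \<open>\<Sigma>\<^sup>d \<T>\<close>
  only if it is zero.\<close>

lemma through_dim_shift_tilt:
  assumes t: "SigO_inv C c \<in> tilt" and x: "x \<in> Ob C"
  shows "through_dim c x = quot_dim (SigO_inv C c) x"
    and "through_dim c x = int (vs.dim (Hom C (SigO_inv C c) x))"
proof -
  let ?t = "SigO_inv C c"
  have tO: "?t \<in> Ob C" using tilt_Ob t by simp
  have "tilt \<subseteq> Ob C" using tilt_Ob by blast
  moreover have "f \<in> Hom_through C tilt ?t x" if f: "f \<in> Hom C ?t x" for f
    using cmp_idm_right[OF tO x f, symmetric] t f idm_in_Hom[OF tO] unfolding Hom_through_def by blast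
  ultimately have "Hom_through C tilt ?t x = Hom C ?t x" using Hom_through_subset[OF _ tO x] by blast
  then show *: "through_dim c x = int (vs.dim (Hom C ?t x))" by (simp add: through_dim_def)
  have "f = 0" if f: "f \<in> Hom_through C (SigO C ` tilt) ?t x" for f
  proof -
    obtain a b s where ab: "f = b \<star> a" "s \<in> tilt" "a \<in> Hom C ?t (SigO C s)" "b \<in> Hom C (SigO C s) x"
      using f by (auto simp: Hom_through_def)
    have "a = 0" using tilt_rigid[OF t ab(2,3)] .
    then show ?thesis using ab cmp_zero_right[OF tO _ x ab(4)] SigO_Ob tilt_Ob by simp
  qed
  moreover have "vs.subspace (Hom_through C (SigO C ` tilt) ?t x)"
    using Hom_through_Sigma_subfunctor[OF tO] x by (simp add: Hom_subfunctor_def)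
  ultimately have "Hom_through C (SigO C ` tilt) ?t x = {0}" using vs.subspace_0 by blast
  then show "through_dim c x = quot_dim ?t x" using * by (simp add: quot_dim_def)
qed

text \<open>The first dimensions identify \<open>c\<close> unless it vanishes in the quotient category; in that case the
  second ones are the first ones for \<open>\<Sigma>\<^sup>-\<^sup>d c\<close>, which lies in \<open>\<T>\<close>.\<close>

theorem isomorphic_if_dims_eq:
  assumes c: "indecomposable C c" and c': "indecomposable C c'"
    and q: "\<And>x. x \<in> Ob C \<Longrightarrow> quot_dim c x = quot_dim c' x"
    and t: "\<And>x. x \<in> Ob C \<Longrightarrow> through_dim c x = through_dim c' x"
  shows "isomorphic_obj C c c'"
proof (cases "quot_dim c c = 0 \<and> quot_dim c' c' = 0")
  case False
  then consider "quot_dim c c \<noteq> 0" | "quot_dim c' c' \<noteq> 0" by blast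
  then show ?thesis
  proof cases
    case 1
    then show ?thesis using isomorphic_if_quot_dim_eq[OF c c' q] by blast
  next
    case 2
    then have "isomorphic_obj C c' c" using isomorphic_if_quot_dim_eq[OF c' c] q by simp
    then show ?thesis unfolding isomorphic_obj_def by blast
  qed
next
  case True
  have O: "c \<in> Ob C" "c' \<in> Ob C" using c c' by (simp_all add: indecomposable_def)
  let ?t = "SigO_inv C c" and ?t' = "SigO_inv C c'"
  have T: "?t \<in> tilt" "?t' \<in> tilt" using quot_dim_zero_shift_tilt True O by simp_all
  have tO: "?t \<in> Ob C" using tilt_Ob T by simp
  have ind: "indecomposable C ?t" "indecomposable C ?t'" using SigO_inv_indecomposable c c' by simp_all
  have "idm C ?t \<noteq> 0" using ind(1) zero_obj_iff by (auto simp: indecomposable_def)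
  then have "vs.dim (Hom C ?t ?t) \<noteq> 0"
    using vs.fin_dim_eq_zero_iff[OF fin_dim_Hom[OF tO tO]] idm_in_Hom[OF tO] by auto
  then have "quot_dim ?t ?t \<noteq> 0" using through_dim_shift_tilt[OF T(1) tO] by simp
  moreover have "quot_dim ?t x = quot_dim ?t' x" if "x \<in> Ob C" for x
    using through_dim_shift_tilt(1)[OF T(1) that] through_dim_shift_tilt(1)[OF T(2) that] t[OF that] by simp
  ultimately have "isomorphic_obj C ?t ?t'" using isomorphic_if_quot_dim_eq[OF ind] by blast
  then show ?thesis using SigO_isomorphic SigO_inv(2) O by metis
qed

lemma through_dim_zero_or_quot_dim_zero:
  assumes O: "c \<in> Ob C" "x \<in> Ob C"
    and hyp: "\<not> (quot_Hom C (SigO C ` tilt) c x \<noteq> {quot_class C (SigO C ` tilt) c x 0}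
        \<and> Hom_through C tilt (SigO_inv C c) x \<noteq> {0})"
  shows "quot_dim c x = 0 \<or> through_dim c x = 0"
proof (cases "Hom_through C tilt (SigO_inv C c) x = {0}")
  case False
  let ?I = "Hom_through C (SigO C ` tilt) c x"
  have eq: "quot_Hom C (SigO C ` tilt) c x = {quot_class C (SigO C ` tilt) c x 0}" using hyp False by blast
  have "0 \<in> ?I" using Hom_through_Sigma_subfunctor[OF O(1)] O(2) vs.subspace_0 by (simp add: Hom_subfunctor_def)
  have "f \<in> ?I" if f: "f \<in> Hom C c x" for f
  proof -
    have "f + 0 \<in> quot_class C (SigO C ` tilt) c x f"
      unfolding quot_class_def using \<open>0 \<in> ?I\<close> by (rule imageI)
    moreover have "quot_class C (SigO C ` tilt) c x f = quot_class C (SigO C ` tilt) c x 0"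
      using eq f unfolding quot_Hom_def by blast
    ultimately show ?thesis by (simp add: quot_class_def)
  qed
  then have "?I = Hom C c x" using Hom_through_subset[OF Sigma_tilt_Ob O] by blast
  then show ?thesis by (simp add: quot_dim_def)
qed (simp add: through_dim_def)

text \<open>Two non-negative numbers of which one is zero are determined by their difference.\<close>

theorem indecomposable_determined_by_index:
  assumes d: "odd d"
    and hyp: "\<And>c x. indecomposable C c \<Longrightarrow> indecomposable C x \<Longrightarrow>
      \<not> (quot_Hom C (SigO C ` tilt) c x \<noteq> {quot_class C (SigO C ` tilt) c x 0}
        \<and> Hom_through C tilt (SigO_inv C c) x \<noteq> {0})"
    and c: "indecomposable C c" and c': "indecomposable C c'"
    and eq: "ot_index C d tilt c = ot_index C d tilt c'"
  shows "isomorphic_obj C c c'"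
proof -
  have O: "c \<in> Ob C" "c' \<in> Ob C" using c c' by (simp_all add: indecomposable_def)
  have dims: "quot_dim c x = quot_dim c' x \<and> through_dim c x = through_dim c' x" if "x \<in> Ob C" for x
    using that
  proof (induction rule: indecomposable_decomposition_induct)
    case (zero z)
    then show ?case using dim_zero_obj O by simp
  next
    case (indecomposable x)
    then have x: "x \<in> Ob C" by (simp add: indecomposable_def)
    have "quot_dim c x - through_dim c x = quot_dim c' x - through_dim c' x"
      using index_determines_Euler_characteristic[OF O eq x] d by simp
    moreover have "quot_dim c x = 0 \<or> through_dim c x = 0" "quot_dim c' x = 0 \<or> through_dim c' x = 0"
      using through_dim_zero_or_quot_dim_zero[OF _ x] hyp c c' indecomposable O by blast+
    moreover have "0 \<le> quot_dim c x" "0 \<le> quot_dim c' x" "0 \<le> through_dim c x" "0 \<le> through_dim c' x"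
      using quot_dim_nonneg O x by (simp_all add: through_dim_def)
    ultimately show ?case by linarith
  next
    case (sum s a b)
    then show ?case using quot_dim_sum through_dim_sum O by simp
  qed
  show ?thesis by (rule isomorphic_if_dims_eq[OF c c']) (use dims in blast)+
qed

end

theorem theoremA:
  fixes C :: "('k::alg_closed_field, 'o, 'm::ab_group_add) angcat"
    and d :: nat and T :: 'o
  assumes "odd d"
    and "angulated_category C d"
    and "hom_finite C"
    and "idempotents_split C"
    and "OT_cluster_tilting_object C d T"
    and "\<And>c x. indecomposable C c \<Longrightarrow> indecomposable C x \<Longrightarrow>
           \<not> (quot_Hom C (SigO C ` add_closure C T) c x
                 \<noteq> {quot_class C (SigO C ` add_closure C T) c x 0}
              \<and> Hom_through C (add_closure C T) (SigO_inv C c) x \<noteq> {0})"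
  shows "\<And>c c'. indecomposable C c \<Longrightarrow> indecomposable C c' \<Longrightarrow>
           ot_index C d (add_closure C T) c = ot_index C d (add_closure C T) c' \<Longrightarrow>
           isomorphic_obj C c c'"
proof -
  fix c c'
  assume c: "indecomposable C c" "indecomposable C c'"
    "ot_index C d (add_closure C T) c = ot_index C d (add_closure C T) c'"
  interpret angulated_category C d by fact
  interpret oppermann_thomas_category C d T
    by unfold_locales fact+
  show "isomorphic_obj C c c'"
    by (rule indecomposable_determined_by_index[OF assms(1,6) c])
qed

end
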